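(* Let $R$ be a Noetherian domain and $Q$ the field of fractions of $R$. Then $Q$ is a (Matlis) reflexive $R$-module if and only if $R$ is a complete local domain of dimension at most one.
   Context: For a commutative Noetherian ring $R$, let $E_R=\bigoplus_{m} E_R(R/m)$, where $m$ ranges over all maximal ideals of $R$ and $E_R(-)$ denotes the injective hull; $E_R$ is the minimal injective cogenerator of the category of $R$-modules. An $R$-module $M$ is (Matlis) reflexive if the natural evaluation map $M\to \operatorname{Hom}_R(\operatorname{Hom}_R(M,E_R),E_R)$ is an isomorphism. A local ring is complete if it is complete with respect to the topology defined by powers of its maximal ideal. Dimension means Krull dimension. *)

theory Defs
  imports "HOL-Algebra.Algebra" "HOL-Library.Extended_Nat"
begin

section \<open>Modules over a commutative ring\<close>

text \<open>
  Linear maps are extensional (they are \<^const>\<open>undefined\<close> outside the carrier of the source), so that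
  equal maps are equal as HOL functions and \<open>Hom_module\<close> is a genuine module.
\<close>

definition lin_maps ::
  "('a, 'r) ring_scheme \<Rightarrow> ('a, 'm, 'k) module_scheme \<Rightarrow> ('a, 'n, 'l) module_scheme \<Rightarrow> ('m \<Rightarrow> 'n) set"
  where "lin_maps R M N =
    {f \<in> carrier M \<rightarrow>\<^sub>E carrier N.
       (\<forall>x\<in>carrier M. \<forall>y\<in>carrier M. f (x \<oplus>\<^bsub>M\<^esub> y) = f x \<oplus>\<^bsub>N\<^esub> f y) \<and>
       (\<forall>a\<in>carrier R. \<forall>x\<in>carrier M. f (a \<odot>\<^bsub>M\<^esub> x) = a \<odot>\<^bsub>N\<^esub> f x)}"

definition lin_isos ::
  "('a, 'r) ring_scheme \<Rightarrow> ('a, 'm, 'k) module_scheme \<Rightarrow> ('a, 'n, 'l) module_scheme \<Rightarrow> ('m \<Rightarrow> 'n) set"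
  where "lin_isos R M N = {f \<in> lin_maps R M N. bij_betw f (carrier M) (carrier N)}"

text \<open>
  The record type of modules extends that of rings; its fields \<open>monoid.mult\<close> and \<open>monoid.one\<close> play no role for
  modules and are left unspecified in \<open>Hom_module\<close> and \<open>direct_sum\<close>.
\<close>

definition Hom_module ::
  "('a, 'r) ring_scheme \<Rightarrow> ('a, 'm, 'k) module_scheme \<Rightarrow> ('a, 'n, 'l) module_scheme
    \<Rightarrow> ('a, 'm \<Rightarrow> 'n) module"
  where "Hom_module R M N =
    \<lparr>carrier = lin_maps R M N, monoid.mult = undefined, monoid.one = undefined,
     ring.zero = (\<lambda>x\<in>carrier M. \<zero>\<^bsub>N\<^esub>),
     ring.add = (\<lambda>f g. \<lambda>x\<in>carrier M. f x \<oplus>\<^bsub>N\<^esub> g x),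
     smult = (\<lambda>a f. \<lambda>x\<in>carrier M. a \<odot>\<^bsub>N\<^esub> f x)\<rparr>"

definition direct_sum ::
  "'i set \<Rightarrow> ('i \<Rightarrow> ('a, 'm, 'k) module_scheme) \<Rightarrow> ('a, 'i \<Rightarrow> 'm) module"
  where "direct_sum I M =
    \<lparr>carrier = {x \<in> (\<Pi>\<^sub>E i\<in>I. carrier (M i)). finite {i \<in> I. x i \<noteq> \<zero>\<^bsub>M i\<^esub>}},
     monoid.mult = undefined, monoid.one = undefined,
     ring.zero = (\<lambda>i\<in>I. \<zero>\<^bsub>M i\<^esub>),
     ring.add = (\<lambda>x y. \<lambda>i\<in>I. x i \<oplus>\<^bsub>M i\<^esub> y i),
     smult = (\<lambda>a x. \<lambda>i\<in>I. a \<odot>\<^bsub>M i\<^esub> x i)\<rparr>"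

text \<open>The target \<open>S\<close> of a ring homomorphism \<open>\<phi>\<close> from \<open>R\<close>, regarded as an \<open>R\<close>-module through \<open>\<phi>\<close>.\<close>

definition restrict_scalars ::
  "('a \<Rightarrow> 'b) \<Rightarrow> ('b, 's) ring_scheme \<Rightarrow> ('a, 'b) module"
  where "restrict_scalars \<phi> S =
    \<lparr>carrier = carrier S, monoid.mult = monoid.mult S, monoid.one = monoid.one S, ring.zero = ring.zero S, ring.add = ring.add S,
     smult = (\<lambda>a x. \<phi> a \<otimes>\<^bsub>S\<^esub> x)\<rparr>"

definition quotient_module :: "('a, 'r) ring_scheme \<Rightarrow> 'a set \<Rightarrow> ('a, 'a set) module"
  where "quotient_module R I = restrict_scalars (\<lambda>a. I +>\<^bsub>R\<^esub> a) (R Quot I)"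


section \<open>Injective modules and injective hulls\<close>

text \<open>
  HOL cannot quantify over all types inside a formula, so the type \<open>'c\<close> over which the
  test modules \<open>A \<rightarrow> B\<close> range is a parameter.  By Baer's criterion (see
  \<open>injective_module_transfer\<close> below) it suffices that \<open>'c\<close> is the type \<open>'a\<close> of the elements of
  \<open>R\<close>: then \<open>E\<close> is injective with respect to test modules of every type.
\<close>

definition injective_module ::
  "'c itself \<Rightarrow> ('a, 'r) ring_scheme \<Rightarrow> ('a, 'e, 'k) module_scheme \<Rightarrow> bool"
  where "injective_module T R E \<longleftrightarrow> module R E \<and>
    (\<forall>(A :: ('a, 'c) module) (B :: ('a, 'c) module). module R A \<and> module R B \<longrightarrow>
      (\<forall>i \<in> lin_maps R A B. inj_on i (carrier A) \<longrightarrow>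
        (\<forall>g \<in> lin_maps R A E. \<exists>h \<in> lin_maps R B E. \<forall>x\<in>carrier A. h (i x) = g x)))"

lemma lin_mapsD:
  assumes "f \<in> lin_maps R M N"
  shows "x \<in> carrier M \<Longrightarrow> f x \<in> carrier N"
    and "x \<in> carrier M \<Longrightarrow> y \<in> carrier M \<Longrightarrow> f (x \<oplus>\<^bsub>M\<^esub> y) = f x \<oplus>\<^bsub>N\<^esub> f y"
    and "a \<in> carrier R \<Longrightarrow> x \<in> carrier M \<Longrightarrow> f (a \<odot>\<^bsub>M\<^esub> x) = a \<odot>\<^bsub>N\<^esub> f x"
  using assms by (auto simp: lin_maps_def)

lemma lin_maps_zero:
  assumes "module R M" "module R N" "f \<in> lin_maps R M N"
  shows "f \<zero>\<^bsub>M\<^esub> = \<zero>\<^bsub>N\<^esub>"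
proof -
  interpret M: module R M by fact
  interpret N: module R N by fact
  have "f \<zero>\<^bsub>M\<^esub> = f (\<zero>\<^bsub>R\<^esub> \<odot>\<^bsub>M\<^esub> \<zero>\<^bsub>M\<^esub>)" by simp
  also have "\<dots> = \<zero>\<^bsub>R\<^esub> \<odot>\<^bsub>N\<^esub> f \<zero>\<^bsub>M\<^esub>" by (rule lin_mapsD(3)[OF assms(3)]) auto
  also have "\<dots> = \<zero>\<^bsub>N\<^esub>" using lin_mapsD(1)[OF assms(3)] by simp
  finally show ?thesis .
qed

lemma regular_module: "cring R \<Longrightarrow> module R (restrict_scalars (\<lambda>a. a) R)"
proof -
  assume "cring R"
  then interpret cring R .
  show ?thesis
  proof (rule moduleI)
    show "abelian_group (restrict_scalars (\<lambda>a. a) R)"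
      by (rule abelian_groupI) (auto simp: restrict_scalars_def a_ac intro: bexI[of _ "\<ominus>\<^bsub>R\<^esub> _"] l_neg)
  qed (auto simp: restrict_scalars_def l_distr r_distr m_assoc is_cring)
qed

lemma injective_module_transfer:
  fixes E :: "('a, 'e, 'k) module_scheme"
  assumes "injective_module TYPE('a) R E"
  shows "injective_module TYPE('c) R E"
  unfolding injective_module_def
proof (intro conjI allI impI ballI; (elim conjE)?)
  show ER: "module R E" using assms by (simp add: injective_module_def)
  fix A B :: "('a, 'c) module" and i g
  assume AR: "module R A" and BR: "module R B" and i: "i \<in> lin_maps R A B"
    and inj: "inj_on i (carrier A)" and g: "g \<in> lin_maps R A E"
  interpret A: module R A by fact
  interpret B: module R B by fact
  interpret E: module R E by fact
  let ?Rm = "restrict_scalars (\<lambda>a. a) R"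
  define P where "P G \<longleftrightarrow> G \<subseteq> carrier B \<times> carrier E \<and> (\<forall>x\<in>carrier A. (i x, g x) \<in> G) \<and>
    (\<forall>b e b' e'. (b, e) \<in> G \<longrightarrow> (b', e') \<in> G \<longrightarrow> (b \<oplus>\<^bsub>B\<^esub> b', e \<oplus>\<^bsub>E\<^esub> e') \<in> G) \<and>
    (\<forall>a\<in>carrier R. \<forall>b e. (b, e) \<in> G \<longrightarrow> (a \<odot>\<^bsub>B\<^esub> b, a \<odot>\<^bsub>E\<^esub> e) \<in> G) \<and>
    (\<forall>e. (\<zero>\<^bsub>B\<^esub>, e) \<in> G \<longrightarrow> e = \<zero>\<^bsub>E\<^esub>)" for G
  have iz: "i \<zero>\<^bsub>A\<^esub> = \<zero>\<^bsub>B\<^esub>" and gz: "g \<zero>\<^bsub>A\<^esub> = \<zero>\<^bsub>E\<^esub>"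
    using lin_maps_zero[OF AR BR i] lin_maps_zero[OF AR ER g] by auto
  have "P ((\<lambda>x. (i x, g x)) ` carrier A)"
    unfolding P_def
  proof (intro conjI allI impI ballI)
    fix e assume "(\<zero>\<^bsub>B\<^esub>, e) \<in> (\<lambda>x. (i x, g x)) ` carrier A"
    then obtain x where x: "x \<in> carrier A" "i x = \<zero>\<^bsub>B\<^esub>" "e = g x" by auto
    then have "x = \<zero>\<^bsub>A\<^esub>" using inj iz by (metis A.M.zero_closed inj_onD)
    then show "e = \<zero>\<^bsub>E\<^esub>" using gz x by simp
  next
    fix b e b' e'
    assume "(b, e) \<in> (\<lambda>x. (i x, g x)) ` carrier A" "(b', e') \<in> (\<lambda>x. (i x, g x)) ` carrier A"
    then obtain x y where "x \<in> carrier A" "y \<in> carrier A" "b = i x" "e = g x" "b' = i y" "e' = g y"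
      by auto
    then show "(b \<oplus>\<^bsub>B\<^esub> b', e \<oplus>\<^bsub>E\<^esub> e') \<in> (\<lambda>x. (i x, g x)) ` carrier A"
      using lin_mapsD(2)[OF i, of x y] lin_mapsD(2)[OF g, of x y]
      by (intro image_eqI[of _ _ "x \<oplus>\<^bsub>A\<^esub> y"]) auto
  next
    fix a b e assume "a \<in> carrier R" "(b, e) \<in> (\<lambda>x. (i x, g x)) ` carrier A"
    then obtain x where "x \<in> carrier A" "b = i x" "e = g x" by auto
    with \<open>a \<in> carrier R\<close> show "(a \<odot>\<^bsub>B\<^esub> b, a \<odot>\<^bsub>E\<^esub> e) \<in> (\<lambda>x. (i x, g x)) ` carrier A"
      using lin_mapsD(3)[OF i, of a x] lin_mapsD(3)[OF g, of a x]
      by (intro image_eqI[of _ _ "a \<odot>\<^bsub>A\<^esub> x"]) auto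
  qed (use lin_mapsD(1)[OF i] lin_mapsD(1)[OF g] in auto)
  then have ne: "Collect P \<noteq> {}" by auto
  have "\<exists>G\<in>Collect P. \<forall>Y\<in>Collect P. G \<subseteq> Y \<longrightarrow> Y = G"
  proof (rule subset_Zorn_nonempty[OF ne])
    fix C assume C: "C \<noteq> {}" "subset.chain (Collect P) C"
    then have CP: "P G" if "G \<in> C" for G using that by (auto simp: subset_chain_def)
    have "P (\<Union>C)" unfolding P_def
    proof (intro conjI allI impI ballI)
      fix b e b' e' assume "(b, e) \<in> \<Union>C" "(b', e') \<in> \<Union>C"
      then obtain G G' where "G \<in> C" "(b, e) \<in> G" "G' \<in> C" "(b', e') \<in> G'" by auto
      then obtain H where "H \<in> C" "(b, e) \<in> H" "(b', e') \<in> H"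
        using C(2) by (metis subset_chain_def subsetD)
      then show "(b \<oplus>\<^bsub>B\<^esub> b', e \<oplus>\<^bsub>E\<^esub> e') \<in> \<Union>C" using CP unfolding P_def by blast
    next
      show "\<Union>C \<subseteq> carrier B \<times> carrier E" using CP unfolding P_def by (meson Union_least)
    next
      fix x assume "x \<in> carrier A"
      then show "(i x, g x) \<in> \<Union>C" using C(1) CP unfolding P_def by (meson UnionI all_not_in_conv)
    next
      fix a b e assume a: "a \<in> carrier R" and "(b, e) \<in> \<Union>C"
      then obtain G where "G \<in> C" "(b, e) \<in> G" by auto
      moreover from this have "(a \<odot>\<^bsub>B\<^esub> b, a \<odot>\<^bsub>E\<^esub> e) \<in> G" using CP a unfolding P_def by metis
      ultimately show "(a \<odot>\<^bsub>B\<^esub> b, a \<odot>\<^bsub>E\<^esub> e) \<in> \<Union>C" by blast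
    next
      fix e assume "(\<zero>\<^bsub>B\<^esub>, e) \<in> \<Union>C"
      then obtain G where "G \<in> C" "(\<zero>\<^bsub>B\<^esub>, e) \<in> G" by auto
      then show "e = \<zero>\<^bsub>E\<^esub>" using CP unfolding P_def by metis
    qed
    then show "\<Union>C \<in> Collect P" by simp
  qed
  then obtain G where PG: "P G" and max: "\<And>Y. P Y \<Longrightarrow> G \<subseteq> Y \<Longrightarrow> Y = G" by auto
  have sub: "b \<in> carrier B" "e \<in> carrier E" if "(b, e) \<in> G" for b e
    using PG that unfolding P_def by auto
  have base: "(i x, g x) \<in> G" if "x \<in> carrier A" for x using PG that unfolding P_def by auto
  have add: "(b \<oplus>\<^bsub>B\<^esub> b', e \<oplus>\<^bsub>E\<^esub> e') \<in> G" if "(b, e) \<in> G" "(b', e') \<in> G" for b e b' e'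
    using PG that unfolding P_def by blast
  have smult: "(a \<odot>\<^bsub>B\<^esub> b, a \<odot>\<^bsub>E\<^esub> e) \<in> G" if "a \<in> carrier R" "(b, e) \<in> G" for a b e
    using PG that unfolding P_def by blast
  have ker: "e = \<zero>\<^bsub>E\<^esub>" if "(\<zero>\<^bsub>B\<^esub>, e) \<in> G" for e using PG that unfolding P_def by blast
  have zero: "(\<zero>\<^bsub>B\<^esub>, \<zero>\<^bsub>E\<^esub>) \<in> G" using base[of "\<zero>\<^bsub>A\<^esub>"] iz gz by simp
  have neg: "(\<ominus>\<^bsub>B\<^esub> b, \<ominus>\<^bsub>E\<^esub> e) \<in> G" if "(b, e) \<in> G" for b e
    using smult[of "\<ominus>\<^bsub>R\<^esub> \<one>\<^bsub>R\<^esub>", OF _ that] sub[OF that]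
    by (simp add: B.smult_l_minus E.smult_l_minus)
  have fnl: "e = e'" if "(b, e) \<in> G" "(b, e') \<in> G" for b e e'
  proof -
    have "(b \<oplus>\<^bsub>B\<^esub> \<ominus>\<^bsub>B\<^esub> b, e \<oplus>\<^bsub>E\<^esub> \<ominus>\<^bsub>E\<^esub> e') \<in> G" by (rule add[OF that(1) neg[OF that(2)]])
    then have "e \<oplus>\<^bsub>E\<^esub> \<ominus>\<^bsub>E\<^esub> e' = \<zero>\<^bsub>E\<^esub>" using ker sub[OF that(1)] by (simp add: B.M.r_neg)
    then show ?thesis using sub(2)[OF that(1)] sub(2)[OF that(2)]
      by (metis E.M.minus_equality E.M.minus_minus E.M.a_inv_closed)
  qed
  have ThE: "(THE e. (b, e) \<in> G) = e" if "(b, e) \<in> G" for b e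
    using that fnl by blast
  have total: "\<exists>e. (b, e) \<in> G" if b: "b \<in> carrier B" for b
  proof (rule ccontr)
    assume nb: "\<nexists>e. (b, e) \<in> G"
    define I where "I = {r \<in> carrier R. \<exists>e. (r \<odot>\<^bsub>B\<^esub> b, e) \<in> G}"
    define k where "k = (\<lambda>r\<in>I. THE e. (r \<odot>\<^bsub>B\<^esub> b, e) \<in> G)"
    have kG: "(r \<odot>\<^bsub>B\<^esub> b, k r) \<in> G" if "r \<in> I" for r
      using that ThE unfolding I_def k_def by fastforce
    have kI: "r \<in> I" "k r = e" if "r \<in> carrier R" "(r \<odot>\<^bsub>B\<^esub> b, e) \<in> G" for r e
      using that ThE[OF that(2)] unfolding I_def k_def by auto
    have IR: "I \<subseteq> carrier R" unfolding I_def by auto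
    have Rm: "module R ?Rm" by (rule regular_module) (rule A.R.is_cring)
    interpret Rm: module R ?Rm by fact
    have Iadd: "r \<oplus>\<^bsub>R\<^esub> s \<in> I" "k (r \<oplus>\<^bsub>R\<^esub> s) = k r \<oplus>\<^bsub>E\<^esub> k s" if "r \<in> I" "s \<in> I" for r s
      using kI[of "r \<oplus>\<^bsub>R\<^esub> s" "k r \<oplus>\<^bsub>E\<^esub> k s"] add[OF kG[OF that(1)] kG[OF that(2)]] that IR b
      by (auto simp: B.smult_l_distr subset_iff)
    have Ismult: "a \<otimes>\<^bsub>R\<^esub> r \<in> I" "k (a \<otimes>\<^bsub>R\<^esub> r) = a \<odot>\<^bsub>E\<^esub> k r" if "a \<in> carrier R" "r \<in> I" for a r
      using kI[of "a \<otimes>\<^bsub>R\<^esub> r" "a \<odot>\<^bsub>E\<^esub> k r"] smult[OF that(1) kG[OF that(2)]] that IR b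
      by (auto simp: B.smult_assoc1 subset_iff)
    have car: "carrier ?Rm = carrier R" "a_inv ?Rm = a_inv R"
      by (auto simp: restrict_scalars_def a_inv_def m_inv_def fun_eq_iff)
    have "submodule I R ?Rm"
    proof (rule Rm.submoduleI)
      show "\<zero>\<^bsub>?Rm\<^esub> \<in> I" using kI(1)[of "\<zero>\<^bsub>R\<^esub>"] zero b by (simp add: restrict_scalars_def)
      fix r assume r: "r \<in> I"
      then have "(\<ominus>\<^bsub>R\<^esub> \<one>\<^bsub>R\<^esub>) \<otimes>\<^bsub>R\<^esub> r = \<ominus>\<^bsub>R\<^esub> r" using IR A.R.l_minus[of "\<one>\<^bsub>R\<^esub>" r] by auto
      then show "\<ominus>\<^bsub>?Rm\<^esub> r \<in> I" using Ismult(1)[of "\<ominus>\<^bsub>R\<^esub> \<one>\<^bsub>R\<^esub>" r] r by (simp add: car)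
    qed (use IR Iadd(1) Ismult(1) in \<open>auto simp: restrict_scalars_def\<close>)
    then have I: "module R (?Rm\<lparr>carrier := I\<rparr>)" by (rule submodule.submodule_is_module) fact
    have incl: "(\<lambda>r\<in>I. r) \<in> lin_maps R (?Rm\<lparr>carrier := I\<rparr>) ?Rm"
      using IR Iadd(1) Ismult(1) by (auto simp: lin_maps_def restrict_scalars_def)
    have inji: "inj_on (\<lambda>r\<in>I. r) (carrier (?Rm\<lparr>carrier := I\<rparr>))" by (auto simp: inj_on_def)
    have k: "k \<in> lin_maps R (?Rm\<lparr>carrier := I\<rparr>) E"
      using Iadd(2) Ismult(2) sub(2)[OF kG]
      by (auto simp: lin_maps_def restrict_scalars_def k_def)
    from assms I Rm incl inji k obtain h where h: "h \<in> lin_maps R ?Rm E"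
      and hk: "\<And>r. r \<in> I \<Longrightarrow> h r = k r"
      unfolding injective_module_def by fastforce
    define e0 where "e0 = h \<one>\<^bsub>R\<^esub>"
    have e0: "e0 \<in> carrier E" unfolding e0_def
      using lin_mapsD(1)[OF h, of "\<one>\<^bsub>R\<^esub>"] by (simp add: car)
    have he0: "h r = r \<odot>\<^bsub>E\<^esub> e0" if "r \<in> carrier R" for r
      using lin_mapsD(3)[OF h that, of "\<one>\<^bsub>R\<^esub>"] that by (simp add: e0_def restrict_scalars_def)
    define G' where "G' = {(x \<oplus>\<^bsub>B\<^esub> r \<odot>\<^bsub>B\<^esub> b, y \<oplus>\<^bsub>E\<^esub> r \<odot>\<^bsub>E\<^esub> e0) | x y r. (x, y) \<in> G \<and> r \<in> carrier R}"
    have G'I: "(u, v) \<in> G'" if "(x, y) \<in> G" "r \<in> carrier R"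
      "u = x \<oplus>\<^bsub>B\<^esub> r \<odot>\<^bsub>B\<^esub> b" "v = y \<oplus>\<^bsub>E\<^esub> r \<odot>\<^bsub>E\<^esub> e0" for x y r u v
      using that unfolding G'_def by blast
    have GG': "G \<subseteq> G'"
    proof
      fix p assume "p \<in> G"
      then show "p \<in> G'" using G'I[of "fst p" "snd p" "\<zero>\<^bsub>R\<^esub>" "fst p" "snd p"] sub[of "fst p" "snd p"] b e0
        by simp
    qed
    have "P G'" unfolding P_def
    proof (intro conjI allI impI ballI)
      show "G' \<subseteq> carrier B \<times> carrier E" unfolding G'_def using sub b e0 by auto
      show "(i x, g x) \<in> G'" if "x \<in> carrier A" for x using base[OF that] GG' by auto
    next
      fix u v u' v' assume "(u, v) \<in> G'" "(u', v') \<in> G'"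
      then obtain x y r x' y' r' where *: "(x, y) \<in> G" "r \<in> carrier R" "(x', y') \<in> G" "r' \<in> carrier R"
        "u = x \<oplus>\<^bsub>B\<^esub> r \<odot>\<^bsub>B\<^esub> b" "v = y \<oplus>\<^bsub>E\<^esub> r \<odot>\<^bsub>E\<^esub> e0" "u' = x' \<oplus>\<^bsub>B\<^esub> r' \<odot>\<^bsub>B\<^esub> b" "v' = y' \<oplus>\<^bsub>E\<^esub> r' \<odot>\<^bsub>E\<^esub> e0"
        unfolding G'_def by blast
      show "(u \<oplus>\<^bsub>B\<^esub> u', v \<oplus>\<^bsub>E\<^esub> v') \<in> G'"
        by (rule G'I[OF add[OF *(1,3)], of "r \<oplus>\<^bsub>R\<^esub> r'"])
          (use * sub[OF *(1)] sub[OF *(3)] b e0 in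
            \<open>simp_all add: B.smult_l_distr E.smult_l_distr B.M.a_ac E.M.a_ac\<close>)
    next
      fix a u v assume a: "a \<in> carrier R" and "(u, v) \<in> G'"
      then obtain x y r where *: "(x, y) \<in> G" "r \<in> carrier R"
        "u = x \<oplus>\<^bsub>B\<^esub> r \<odot>\<^bsub>B\<^esub> b" "v = y \<oplus>\<^bsub>E\<^esub> r \<odot>\<^bsub>E\<^esub> e0"
        unfolding G'_def by blast
      show "(a \<odot>\<^bsub>B\<^esub> u, a \<odot>\<^bsub>E\<^esub> v) \<in> G'"
        by (rule G'I[OF smult[OF a *(1)], of "a \<otimes>\<^bsub>R\<^esub> r"])
          (use * sub[OF *(1)] b e0 a in
            \<open>simp_all add: B.smult_r_distr E.smult_r_distr B.smult_assoc1 E.smult_assoc1\<close>)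
    next
      fix v assume "(\<zero>\<^bsub>B\<^esub>, v) \<in> G'"
      then obtain x y r where *: "(x, y) \<in> G" "r \<in> carrier R"
        "\<zero>\<^bsub>B\<^esub> = x \<oplus>\<^bsub>B\<^esub> r \<odot>\<^bsub>B\<^esub> b" "v = y \<oplus>\<^bsub>E\<^esub> r \<odot>\<^bsub>E\<^esub> e0"
        unfolding G'_def by blast
      have "r \<odot>\<^bsub>B\<^esub> b = \<ominus>\<^bsub>B\<^esub> x"
        using *(2,3) sub[OF *(1)] b by (metis B.M.minus_equality B.M.a_comm B.smult_closed)
      then have "r \<in> I" "k r = \<ominus>\<^bsub>E\<^esub> y" using kI[OF *(2)] neg[OF *(1)] by auto
      then show "v = \<zero>\<^bsub>E\<^esub>" using *(4) he0[OF *(2)] hk[of r] E.M.r_neg[OF sub(2)[OF *(1)]] by metis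
    qed
    then have "G' = G" using max GG' by blast
    moreover have "(b, e0) \<in> G'"
      by (rule G'I[OF zero, of "\<one>\<^bsub>R\<^esub>"]) (use b e0 in auto)
    ultimately show False using nb by auto
  qed
  define h where "h = (\<lambda>b\<in>carrier B. THE e. (b, e) \<in> G)"
  have hG: "(b, h b) \<in> G" if "b \<in> carrier B" for b
    using total[OF that] ThE that by (auto simp: h_def)
  have hI: "h b = e" if "(b, e) \<in> G" for b e using ThE[OF that] sub[OF that] by (simp add: h_def)
  have "h \<in> lin_maps R B E"
    unfolding lin_maps_def
    using sub(2)[OF hG] hI[OF add[OF hG hG]] hI[OF smult[OF _ hG]]
    by (auto simp: h_def)
  moreover have "\<forall>x\<in>carrier A. h (i x) = g x" using hI[OF base] by blast
  ultimately show "\<exists>h\<in>lin_maps R B E. \<forall>x\<in>carrier A. h (i x) = g x" by blast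
qed

text \<open>
  Hulls are characterised rather than constructed; they are unique up to isomorphism, so a statement
  about every hull of \<open>M\<close> (in every type) is a statement about the hull of \<open>M\<close>.
\<close>

definition essential_embedding ::
  "('a, 'r) ring_scheme \<Rightarrow> ('a, 'm, 'k) module_scheme \<Rightarrow> ('a, 'e, 'l) module_scheme
    \<Rightarrow> ('m \<Rightarrow> 'e) \<Rightarrow> bool"
  where "essential_embedding R M E i \<longleftrightarrow>
    i \<in> lin_maps R M E \<and> inj_on i (carrier M) \<and>
    (\<forall>N. submodule N R E \<and> N \<noteq> {\<zero>\<^bsub>E\<^esub>} \<longrightarrow> N \<inter> i ` carrier M \<noteq> {\<zero>\<^bsub>E\<^esub>})"

definition injective_hull ::
  "('a, 'r) ring_scheme \<Rightarrow> ('a, 'm, 'k) module_scheme \<Rightarrow> ('a, 'e, 'l) module_scheme \<Rightarrow> bool"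
  where "injective_hull R M E \<longleftrightarrow>
    injective_module TYPE('a) R E \<and> (\<exists>i. essential_embedding R M E i)"


section \<open>Matlis reflexivity\<close>

definition evaluation_map ::
  "('a, 'r) ring_scheme \<Rightarrow> ('a, 'e, 'k) module_scheme \<Rightarrow> ('a, 'm, 'l) module_scheme
    \<Rightarrow> 'm \<Rightarrow> ('m \<Rightarrow> 'e) \<Rightarrow> 'e"
  where "evaluation_map R E M = (\<lambda>x\<in>carrier M. \<lambda>f\<in>lin_maps R M E. f x)"

definition reflexive_wrt ::
  "('a, 'r) ring_scheme \<Rightarrow> ('a, 'e, 'k) module_scheme \<Rightarrow> ('a, 'm, 'l) module_scheme \<Rightarrow> bool"
  where "reflexive_wrt R E M \<longleftrightarrow>
    evaluation_map R E M \<in> lin_isos R M (Hom_module R (Hom_module R M E) E)"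


section \<open>Rings\<close>

definition fraction_field ::
  "('a, 'r) ring_scheme \<Rightarrow> ('q, 's) ring_scheme \<Rightarrow> ('a \<Rightarrow> 'q) \<Rightarrow> bool"
  where "fraction_field R Q \<phi> \<longleftrightarrow>
    field Q \<and> \<phi> \<in> ring_hom R Q \<and> inj_on \<phi> (carrier R) \<and>
    (\<forall>x\<in>carrier Q. \<exists>a\<in>carrier R. \<exists>b\<in>carrier R - {\<zero>\<^bsub>R\<^esub>}. x = \<phi> a \<otimes>\<^bsub>Q\<^esub> inv\<^bsub>Q\<^esub> (\<phi> b))"

definition ideal_power :: "('a, 'r) ring_scheme \<Rightarrow> 'a set \<Rightarrow> nat \<Rightarrow> 'a set"
  where "ideal_power R I n = I [^]\<^bsub>ideals_set R\<^esub> n"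

definition adic_Cauchy :: "('a, 'r) ring_scheme \<Rightarrow> 'a set \<Rightarrow> (nat \<Rightarrow> 'a) \<Rightarrow> bool"
  where "adic_Cauchy R I s \<longleftrightarrow> range s \<subseteq> carrier R \<and>
    (\<forall>k. \<exists>N. \<forall>i\<ge>N. \<forall>j\<ge>N. s i \<ominus>\<^bsub>R\<^esub> s j \<in> ideal_power R I k)"

definition adic_limit :: "('a, 'r) ring_scheme \<Rightarrow> 'a set \<Rightarrow> (nat \<Rightarrow> 'a) \<Rightarrow> 'a \<Rightarrow> bool"
  where "adic_limit R I s x \<longleftrightarrow> x \<in> carrier R \<and>
    (\<forall>k. \<exists>N. \<forall>i\<ge>N. s i \<ominus>\<^bsub>R\<^esub> x \<in> ideal_power R I k)"

text \<open>As usual in commutative algebra, complete includes separated, hence the unique existence.\<close>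

definition adic_complete :: "('a, 'r) ring_scheme \<Rightarrow> 'a set \<Rightarrow> bool"
  where "adic_complete R I \<longleftrightarrow> (\<forall>s. adic_Cauchy R I s \<longrightarrow> (\<exists>!x. adic_limit R I s x))"

definition local_ring :: "('a, 'r) ring_scheme \<Rightarrow> bool"
  where "local_ring R \<longleftrightarrow> cring R \<and> (\<exists>!m. maximalideal m R)"

definition complete_local_ring :: "('a, 'r) ring_scheme \<Rightarrow> bool"
  where "complete_local_ring R \<longleftrightarrow> local_ring R \<and> (\<forall>m. maximalideal m R \<longrightarrow> adic_complete R m)"

text \<open>For the zero ring this yields 0 instead of \<open>-\<infinity>\<close>.\<close>

definition krull_dim :: "('a, 'r) ring_scheme \<Rightarrow> enat"
  where "krull_dim R =
    Sup {enat n | n. \<exists>P. (\<forall>i\<le>n. primeideal (P i) R) \<and> (\<forall>i<n. P i \<subset> P (Suc i))}"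

end

theory Submission
  imports Defs
begin

text \<open>
  Suppose that \<open>Q\<close> is reflexive. An endomorphism \<open>g\<close> of the minimal injective cogenerator \<open>E\<close> gives the
  functional \<open>f \<mapsto> g (f 1)\<close> on \<open>Hom(Q, E)\<close>, which is the evaluation at a point of \<open>R\<close>, so \<open>g\<close> is a
  multiplication. The projections of \<open>E\<close> then show that \<open>R\<close> is local, and the limits of Cauchy sequences,
  acting on the \<open>m\<close>-power torsion module \<open>E\<close>, show that \<open>R\<close> is complete. If \<open>a \<noteq> 0\<close> and no power of
  \<open>b \<in> m\<close> is divisible by \<open>a\<close>, then for large \<open>s\<close> the powers of \<open>t = b^s / a\<close> are a basis of
  \<open>R[t] / m R[t]\<close> over \<open>R / m\<close>; a module with such a subquotient is not reflexive. Hence \<open>m\<close> is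
  the radical of \<open>a R\<close>, and the dimension is at most one.

  Conversely, completeness makes every endomorphism of \<open>E\<close> a multiplication. It follows that a linear
  \<open>G\<close> on \<open>Hom(Q, E)\<close> agrees on any finite set of maps with the evaluation at a point. In dimension at
  most one, \<open>Q / R\<close> has an essential socle of finite length, so finitely many maps separate its points and
  \<open>G\<close> is an evaluation on the maps that vanish on \<open>R\<close>; what remains is an endomorphism of \<open>E\<close>.
\<close>

section \<open>Linear maps and extensions into injective modules\<close>

text \<open>By reflexivity the functional \<open>f \<mapsto> g (f 1)\<close> is the evaluation at
  some \<open>q\<close> of \<open>Q\<close>. That \<open>q\<close> lies in \<open>R\<close> is a
  separation argument: otherwise some map vanishes on \<open>R\<close>, hence at \<open>1\<close>,
  but not at \<open>q\<close>. Conversely, every element of a hull is some \<open>f 1\<close>,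
  because the hull is injective and \<open>Q\<close> is torsion-free. The obstacle in the other
  direction is that \<open>Hom(Q, E)\<close> is not finitely generated in general, while
  interpolation finds a point only up to the common kernel of finitely many maps. Dimension at most
  one supplies one finite set \<open>F\<close> whose common kernel is inside \<open>R\<close>. A
  point that fits \<open>F\<close> is then determined up to \<open>R\<close>, an ambiguity that maps
  vanishing on \<open>R\<close> do not see; the rest of the functional depends on \<open>f 1\<close>
  alone. Of the hull of \<open>R / m\<close> only three things are used: it is injective, some
  element \<open>e\<^sub>0\<close> has annihilator \<open>m\<close>, and every nonzero element has
  \<open>e\<^sub>0\<close> as a multiple. The quotient \<open>Q / R\<close> is never formed: colon
  ideals of \<open>R\<close> in \<open>Q\<close> stand for annihilators of its elements.\<close>

lemma (in noetherian_ring) ex_maximal_ideal_in: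
  assumes "S \<noteq> {}" "\<And>I. I \<in> S \<Longrightarrow> ideal I R"
  obtains I where "I \<in> S" "\<And>J. J \<in> S \<Longrightarrow> I \<subseteq> J \<Longrightarrow> J = I"
proof -
  have "\<exists>I\<in>S. \<forall>J\<in>S. I \<subseteq> J \<longrightarrow> J = I"
  proof (rule subset_Zorn_nonempty[OF assms(1)])
    fix C assume C: "C \<noteq> {}" "subset.chain S C"
    then have "subset.chain {I. ideal I R} C" using assms(2) by (auto simp: subset_chain_def)
    \<comment> \<open>A nonempty chain of ideals in a Noetherian ring contains its union, so Zorn
      applies to an arbitrary family \<open>S\<close> without any closure condition.\<close>
    then have "\<Union>C \<in> C" using ideal_chain_is_trivial C(1) by blast
    then show "\<Union>C \<in> S" using C(2) by (auto simp: subset_chain_def)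
  qed
  then show thesis using that by blast
qed

lemma (in noetherian_domain) ideal_le_maximal:
  assumes "ideal I R" "I \<noteq> carrier R"
  obtains m where "maximalideal m R" "I \<subseteq> m"
proof -
  let ?S = "{J. ideal J R \<and> I \<subseteq> J \<and> J \<noteq> carrier R}"
  obtain m where m: "m \<in> ?S" "\<And>J. J \<in> ?S \<Longrightarrow> m \<subseteq> J \<Longrightarrow> J = m"
  proof (rule ex_maximal_ideal_in[of ?S])
    show "?S \<noteq> {}" using assms by auto
  qed (auto intro: that)
  have "maximalideal m R"
  proof (rule maximalidealI)
    fix J assume "ideal J R" "m \<subseteq> J" "J \<subseteq> carrier R"
    then show "J = m \<or> J = carrier R" using m(1) m(2)[of J] by blast
  qed (use m(1) in auto)
  then show thesis using that m(1) by auto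
qed

lemma (in cring) idealI':
  assumes "I \<subseteq> carrier R" "\<zero> \<in> I" "\<And>x y. x \<in> I \<Longrightarrow> y \<in> I \<Longrightarrow> x \<oplus> y \<in> I"
    "\<And>a x. a \<in> carrier R \<Longrightarrow> x \<in> I \<Longrightarrow> a \<otimes> x \<in> I"
  shows "ideal I R"
proof (rule idealI)
  show "subgroup I (add_monoid R)"
  proof (rule add.subgroupI)
    fix x assume "x \<in> I"
    then show "\<ominus> x \<in> I" using assms(4)[of "\<ominus> \<one>" x] assms(1) l_minus[of \<one> x] by (auto simp: subset_iff)
  qed (use assms in auto)
  fix a x assume "a \<in> I" "x \<in> carrier R"
  then show "x \<otimes> a \<in> I" "a \<otimes> x \<in> I" using assms m_comm[of a x] by auto
qed (rule ring_axioms)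

lemma (in abelian_group) minus_eq_zero_iff:
  assumes "x \<in> carrier G" "y \<in> carrier G"
  shows "x \<ominus> y = \<zero> \<longleftrightarrow> x = y"
proof
  assume "x \<ominus> y = \<zero>"
  then have "\<ominus> y \<oplus> x = \<zero>" using assms by (simp add: minus_eq a_comm)
  then show "x = y" using assms by (metis a_inv_closed minus_equality minus_minus l_neg a_comm)
qed (use assms in \<open>simp add: minus_eq r_neg\<close>)

lemma (in module) submoduleI':
  assumes "N \<subseteq> carrier M" "\<zero>\<^bsub>M\<^esub> \<in> N" "\<And>x y. x \<in> N \<Longrightarrow> y \<in> N \<Longrightarrow> x \<oplus>\<^bsub>M\<^esub> y \<in> N"
    "\<And>a x. a \<in> carrier R \<Longrightarrow> x \<in> N \<Longrightarrow> a \<odot>\<^bsub>M\<^esub> x \<in> N"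
  shows "submodule N R M"
proof (rule submoduleI)
  fix x assume "x \<in> N"
  then show "\<ominus>\<^bsub>M\<^esub> x \<in> N"
    using assms(4)[of "\<ominus> \<one>" x] assms(1) smult_l_minus[of \<one> x] by (auto simp: subset_iff)
qed (use assms in auto)

section \<open>Linear maps and the module \<open>Hom(M, N)\<close>\<close>

lemma lin_maps_restrictI:
  assumes "module R M"
    and "\<And>x. x \<in> carrier M \<Longrightarrow> f x \<in> carrier N"
    and "\<And>x y. x \<in> carrier M \<Longrightarrow> y \<in> carrier M \<Longrightarrow> f (x \<oplus>\<^bsub>M\<^esub> y) = f x \<oplus>\<^bsub>N\<^esub> f y"
    and "\<And>a x. a \<in> carrier R \<Longrightarrow> x \<in> carrier M \<Longrightarrow> f (a \<odot>\<^bsub>M\<^esub> x) = a \<odot>\<^bsub>N\<^esub> f x"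
  shows "(\<lambda>x\<in>carrier M. f x) \<in> lin_maps R M N"
proof -
  interpret module R M by fact
  show ?thesis using assms(2-) by (auto simp: lin_maps_def)
qed

lemma lin_maps_eqI:
  assumes "f \<in> lin_maps R M N" "g \<in> lin_maps R M N" "\<And>x. x \<in> carrier M \<Longrightarrow> f x = g x"
  shows "f = g"
  using assms by (auto simp: lin_maps_def intro: PiE_ext)

lemma Hom_module_simps [simp]:
  "carrier (Hom_module R M N) = lin_maps R M N"
  "\<zero>\<^bsub>Hom_module R M N\<^esub> = (\<lambda>x\<in>carrier M. \<zero>\<^bsub>N\<^esub>)"
  "f \<oplus>\<^bsub>Hom_module R M N\<^esub> g = (\<lambda>x\<in>carrier M. f x \<oplus>\<^bsub>N\<^esub> g x)"
  "a \<odot>\<^bsub>Hom_module R M N\<^esub> f = (\<lambda>x\<in>carrier M. a \<odot>\<^bsub>N\<^esub> f x)"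
  by (auto simp: Hom_module_def)

lemma lin_maps_add:
  assumes "module R M" "module R N" "f \<in> lin_maps R M N" "g \<in> lin_maps R M N"
  shows "(\<lambda>x\<in>carrier M. f x \<oplus>\<^bsub>N\<^esub> g x) \<in> lin_maps R M N"
proof -
  interpret N: module R N by fact
  show ?thesis
    by (rule lin_maps_restrictI[OF assms(1)])
      (use lin_mapsD[OF assms(3)] lin_mapsD[OF assms(4)] in
        \<open>simp_all add: N.smult_r_distr N.M.a_ac\<close>)
qed

lemma lin_maps_smult:
  assumes "module R M" "module R N" "f \<in> lin_maps R M N" "a \<in> carrier R"
  shows "(\<lambda>x\<in>carrier M. a \<odot>\<^bsub>N\<^esub> f x) \<in> lin_maps R M N"
proof -
  interpret N: module R N by fact
  have "a \<odot>\<^bsub>N\<^esub> (b \<odot>\<^bsub>N\<^esub> f x) = b \<odot>\<^bsub>N\<^esub> (a \<odot>\<^bsub>N\<^esub> f x)" if "b \<in> carrier R" "x \<in> carrier M" for b x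
    using that assms(4) lin_mapsD(1)[OF assms(3)] by (metis N.smult_assoc1 N.R.m_comm)
  then show ?thesis
    by (intro lin_maps_restrictI[OF assms(1)])
      (use lin_mapsD[OF assms(3)] assms(4) in \<open>auto simp: N.smult_r_distr\<close>)
qed

lemma lin_maps_comp:
  assumes "module R M" "f \<in> lin_maps R M N" "g \<in> lin_maps R N P"
  shows "(\<lambda>x\<in>carrier M. g (f x)) \<in> lin_maps R M P"
  by (rule lin_maps_restrictI[OF assms(1)])
    (use lin_mapsD[OF assms(2)] lin_mapsD[OF assms(3)] in auto)

lemma lin_maps_zero_map:
  assumes "module R M" "module R N"
  shows "(\<lambda>x\<in>carrier M. \<zero>\<^bsub>N\<^esub>) \<in> lin_maps R M N"
proof -
  interpret N: module R N by fact
  show ?thesis by (rule lin_maps_restrictI[OF assms(1)]) auto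
qed

lemma lin_maps_minus:
  assumes "module R M" "module R N" "f \<in> lin_maps R M N" "x \<in> carrier M"
  shows "f (\<ominus>\<^bsub>M\<^esub> x) = \<ominus>\<^bsub>N\<^esub> f x"
proof -
  interpret M: module R M by fact
  interpret N: module R N by fact
  show ?thesis
    using lin_mapsD(3)[OF assms(3), of "\<ominus>\<^bsub>R\<^esub> \<one>\<^bsub>R\<^esub>" x] lin_mapsD(1)[OF assms(3,4)] assms(4)
    by (simp add: M.smult_l_minus N.smult_l_minus)
qed

lemma lin_maps_diff:
  assumes "module R M" "module R N" "f \<in> lin_maps R M N" "x \<in> carrier M" "y \<in> carrier M"
  shows "f (x \<ominus>\<^bsub>M\<^esub> y) = f x \<ominus>\<^bsub>N\<^esub> f y"
proof -
  interpret M: module R M by fact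
  interpret N: module R N by fact
  show ?thesis
    using lin_mapsD(2)[OF assms(3), of x "\<ominus>\<^bsub>M\<^esub> y"] lin_maps_minus[OF assms(1-3,5)] assms(4,5)
    by (simp add: a_minus_def)
qed

lemma Hom_module_is_module:
  assumes "module R M" "module R N"
  shows "module R (Hom_module R M N)"
proof -
  interpret M: module R M by fact
  interpret N: module R N by fact
  let ?H = "Hom_module R M N"
  have D: "f x \<in> carrier N" if "f \<in> lin_maps R M N" "x \<in> carrier M" for f x
    using lin_mapsD(1)[OF that] .
  have eq': "(\<lambda>x\<in>carrier M. f x) = g" if "g \<in> lin_maps R M N" "\<And>x. x \<in> carrier M \<Longrightarrow> f x = g x" for f g
    using that by (auto simp: lin_maps_def intro: PiE_ext)
  note add = lin_maps_add[OF assms] and smult = lin_maps_smult[OF assms]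
  show ?thesis
  proof (rule moduleI)
    show "abelian_group ?H"
    proof (rule abelian_groupI)
      fix f assume "f \<in> carrier ?H"
      then have f: "f \<in> lin_maps R M N" by simp
      show "\<zero>\<^bsub>?H\<^esub> \<oplus>\<^bsub>?H\<^esub> f = f" using f D[OF f] by (simp add: eq')
      let ?g = "\<lambda>x\<in>carrier M. (\<ominus>\<^bsub>R\<^esub> \<one>\<^bsub>R\<^esub>) \<odot>\<^bsub>N\<^esub> f x"
      have "?g \<in> lin_maps R M N" using smult[OF f] by simp
      moreover have "?g \<oplus>\<^bsub>?H\<^esub> f = \<zero>\<^bsub>?H\<^esub>"
        using D[OF f] by (simp add: N.smult_l_minus N.M.l_neg cong: restrict_cong)
      ultimately show "\<exists>g\<in>carrier ?H. g \<oplus>\<^bsub>?H\<^esub> f = \<zero>\<^bsub>?H\<^esub>"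
        unfolding Hom_module_simps(1) by blast
    next
      show "\<zero>\<^bsub>?H\<^esub> \<in> carrier ?H" using lin_maps_zero_map[OF assms] by simp
    next
      fix f g assume "f \<in> carrier ?H" "g \<in> carrier ?H"
      then have fg: "f \<in> lin_maps R M N" "g \<in> lin_maps R M N" by auto
      show "f \<oplus>\<^bsub>?H\<^esub> g \<in> carrier ?H" using add[OF fg] by simp
      show "f \<oplus>\<^bsub>?H\<^esub> g = g \<oplus>\<^bsub>?H\<^esub> f" using D[OF fg(1)] D[OF fg(2)] by (simp cong: restrict_cong add: N.M.a_comm)
      fix h assume "h \<in> carrier ?H"
      then have h: "h \<in> lin_maps R M N" by auto
      show "f \<oplus>\<^bsub>?H\<^esub> g \<oplus>\<^bsub>?H\<^esub> h = f \<oplus>\<^bsub>?H\<^esub> (g \<oplus>\<^bsub>?H\<^esub> h)"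
        using D[OF fg(1)] D[OF fg(2)] D[OF h] by (simp cong: restrict_cong add: N.M.a_assoc)
    qed
  next
    show "cring R" by (rule M.is_cring)
  next
    fix f a assume "f \<in> carrier ?H" and a: "a \<in> carrier R"
    then have f: "f \<in> lin_maps R M N" by simp
    show "a \<odot>\<^bsub>?H\<^esub> f \<in> carrier ?H" using smult[OF f a] by simp
    fix b assume b: "b \<in> carrier R"
    show "(a \<oplus>\<^bsub>R\<^esub> b) \<odot>\<^bsub>?H\<^esub> f = a \<odot>\<^bsub>?H\<^esub> f \<oplus>\<^bsub>?H\<^esub> b \<odot>\<^bsub>?H\<^esub> f"
      using D[OF f] a b by (simp cong: restrict_cong add: N.smult_l_distr)
    show "(a \<otimes>\<^bsub>R\<^esub> b) \<odot>\<^bsub>?H\<^esub> f = a \<odot>\<^bsub>?H\<^esub> (b \<odot>\<^bsub>?H\<^esub> f)"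
      using D[OF f] a b by (simp cong: restrict_cong add: N.smult_assoc1)
  next
    fix a f g assume a: "a \<in> carrier R" and "f \<in> carrier ?H" "g \<in> carrier ?H"
    then have fg: "f \<in> lin_maps R M N" "g \<in> lin_maps R M N" by auto
    show "a \<odot>\<^bsub>?H\<^esub> (f \<oplus>\<^bsub>?H\<^esub> g) = a \<odot>\<^bsub>?H\<^esub> f \<oplus>\<^bsub>?H\<^esub> a \<odot>\<^bsub>?H\<^esub> g"
      using D[OF fg(1)] D[OF fg(2)] a by (simp cong: restrict_cong add: N.smult_r_distr)
  next
    fix f assume "f \<in> carrier ?H"
    then have f: "f \<in> lin_maps R M N" by simp
    show "\<one>\<^bsub>R\<^esub> \<odot>\<^bsub>?H\<^esub> f = f" using f D[OF f] by (simp add: eq')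
  qed
qed

text \<open>Injectivity for a map given only on a submodule: the test modules are \<open>M\<close>
  and \<open>M\<close> with the smaller carrier \<open>N\<close>. Their elements have type
  \<open>'m\<close>, so the hypothesis over the type \<open>'a\<close> is first carried over by
  \<open>injective_module_transfer\<close>.\<close>

lemma injective_extend:
  fixes M :: "('a, 'm) module"
  assumes E: "injective_module TYPE('a) R E" and M: "module R M" and N: "submodule N R M"
    and g: "\<And>x. x \<in> N \<Longrightarrow> g x \<in> carrier E"
      "\<And>x y. x \<in> N \<Longrightarrow> y \<in> N \<Longrightarrow> g (x \<oplus>\<^bsub>M\<^esub> y) = g x \<oplus>\<^bsub>E\<^esub> g y"
      "\<And>a x. a \<in> carrier R \<Longrightarrow> x \<in> N \<Longrightarrow> g (a \<odot>\<^bsub>M\<^esub> x) = a \<odot>\<^bsub>E\<^esub> g x"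
  obtains h where "h \<in> lin_maps R M E" "\<And>x. x \<in> N \<Longrightarrow> h x = g x"
proof -
  interpret M: module R M by fact
  have NM: "module R (M\<lparr>carrier := N\<rparr>)" by (rule submodule.submodule_is_module[OF N M])
  have sub: "N \<subseteq> carrier M" using M.submoduleE(1)[OF N] .
  have i: "(\<lambda>x\<in>carrier (M\<lparr>carrier := N\<rparr>). x) \<in> lin_maps R (M\<lparr>carrier := N\<rparr>) M"
    by (rule lin_maps_restrictI[OF NM]) (use sub in auto)
  have g': "(\<lambda>x\<in>carrier (M\<lparr>carrier := N\<rparr>). g x) \<in> lin_maps R (M\<lparr>carrier := N\<rparr>) E"
    by (rule lin_maps_restrictI[OF NM]) (use g in auto)
  have "inj_on (\<lambda>x\<in>carrier (M\<lparr>carrier := N\<rparr>). x) (carrier (M\<lparr>carrier := N\<rparr>))"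
    by (auto simp: inj_on_def)
  with injective_module_transfer[OF E, where 'c = 'm] NM M i g'
  obtain h where "h \<in> lin_maps R M E" "\<And>x. x \<in> N \<Longrightarrow> h x = g x"
    unfolding injective_module_def by fastforce
  then show thesis using that by blast
qed

text \<open>The rule \<open>n + r x \<mapsto> r e\<close> on \<open>N + R x\<close> is well defined
  as soon as the colon ideal \<open>(N : x)\<close> kills \<open>e\<close>, and then it extends to
  \<open>M\<close>. Separation of points and divisibility both come from here.\<close>

lemma injective_extend_cyclic:
  fixes M :: "('a, 'm) module"
  assumes E: "injective_module TYPE('a) R E" and M: "module R M" and N: "submodule N R M"
    and x: "x \<in> carrier M" and e: "e \<in> carrier E"
    and xe: "\<And>r. r \<in> carrier R \<Longrightarrow> r \<odot>\<^bsub>M\<^esub> x \<in> N \<Longrightarrow> r \<odot>\<^bsub>E\<^esub> e = \<zero>\<^bsub>E\<^esub>"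
  obtains f where "f \<in> lin_maps R M E" "\<And>y. y \<in> N \<Longrightarrow> f y = \<zero>\<^bsub>E\<^esub>" "f x = e"
proof -
  interpret M: module R M by fact
  have "module R E" using E by (simp add: injective_module_def)
  then interpret E: module R E .
  note sub = M.submoduleE(1)[OF N]
  have zN: "\<zero>\<^bsub>M\<^esub> \<in> N" using N by (simp add: submodule_def subgroup_def)
  let ?N = "{n \<oplus>\<^bsub>M\<^esub> r \<odot>\<^bsub>M\<^esub> x | n r. n \<in> N \<and> r \<in> carrier R}"
  have uniq: "r \<odot>\<^bsub>E\<^esub> e = r' \<odot>\<^bsub>E\<^esub> e"
    if "n \<in> N" "n' \<in> N" "r \<in> carrier R" "r' \<in> carrier R" "n \<oplus>\<^bsub>M\<^esub> r \<odot>\<^bsub>M\<^esub> x = n' \<oplus>\<^bsub>M\<^esub> r' \<odot>\<^bsub>M\<^esub> x" for n n' r r'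
  proof -
    have nn: "n \<in> carrier M" "n' \<in> carrier M" using that sub by auto
    have "(r \<ominus>\<^bsub>R\<^esub> r') \<odot>\<^bsub>M\<^esub> x = r \<odot>\<^bsub>M\<^esub> x \<ominus>\<^bsub>M\<^esub> r' \<odot>\<^bsub>M\<^esub> x"
      using that x by (simp add: M.R.minus_eq M.M.minus_eq M.smult_l_distr M.smult_l_minus)
    also have "\<dots> = n' \<ominus>\<^bsub>M\<^esub> n"
    proof -
      have "r \<odot>\<^bsub>M\<^esub> x = (\<ominus>\<^bsub>M\<^esub> n \<oplus>\<^bsub>M\<^esub> n') \<oplus>\<^bsub>M\<^esub> r' \<odot>\<^bsub>M\<^esub> x"
        using that x nn by (metis M.M.a_assoc M.M.a_inv_closed M.M.r_neg1 M.smult_closed)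
      then show ?thesis using that x nn
        by (simp add: M.M.minus_eq M.M.a_assoc M.M.r_neg M.M.a_comm[of n' "\<ominus>\<^bsub>M\<^esub> n"])
    qed
    also have "\<dots> \<in> N" using M.submoduleE(3,5)[OF N] that by (simp add: M.M.minus_eq)
    finally have "(r \<ominus>\<^bsub>R\<^esub> r') \<odot>\<^bsub>E\<^esub> e = \<zero>\<^bsub>E\<^esub>" using xe that by simp
    then have "r \<odot>\<^bsub>E\<^esub> e \<ominus>\<^bsub>E\<^esub> r' \<odot>\<^bsub>E\<^esub> e = \<zero>\<^bsub>E\<^esub>" using that e
      by (simp add: M.R.minus_eq E.M.minus_eq E.smult_l_distr E.smult_l_minus)
    then show ?thesis using E.M.minus_eq_zero_iff[of "r \<odot>\<^bsub>E\<^esub> e" "r' \<odot>\<^bsub>E\<^esub> e"] that(3,4) e by blast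
  qed
  define g where "g y = (SOME z. \<exists>n\<in>N. \<exists>r\<in>carrier R. y = n \<oplus>\<^bsub>M\<^esub> r \<odot>\<^bsub>M\<^esub> x \<and> z = r \<odot>\<^bsub>E\<^esub> e)" for y
  have gI: "g (n \<oplus>\<^bsub>M\<^esub> r \<odot>\<^bsub>M\<^esub> x) = r \<odot>\<^bsub>E\<^esub> e" if "n \<in> N" "r \<in> carrier R" for n r
    unfolding g_def
  proof (rule some_equality)
    fix z assume "\<exists>n'\<in>N. \<exists>r'\<in>carrier R. n \<oplus>\<^bsub>M\<^esub> r \<odot>\<^bsub>M\<^esub> x = n' \<oplus>\<^bsub>M\<^esub> r' \<odot>\<^bsub>M\<^esub> x \<and> z = r' \<odot>\<^bsub>E\<^esub> e"
    then obtain n' r' where *: "n' \<in> N" "r' \<in> carrier R"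
      "n \<oplus>\<^bsub>M\<^esub> r \<odot>\<^bsub>M\<^esub> x = n' \<oplus>\<^bsub>M\<^esub> r' \<odot>\<^bsub>M\<^esub> x" "z = r' \<odot>\<^bsub>E\<^esub> e" by blast
    show "z = r \<odot>\<^bsub>E\<^esub> e" unfolding *(4) by (rule uniq[OF that(1) *(1) that(2) *(2,3), symmetric])
  qed (use that in blast)
  have add: "(n \<oplus>\<^bsub>M\<^esub> r \<odot>\<^bsub>M\<^esub> x) \<oplus>\<^bsub>M\<^esub> (n' \<oplus>\<^bsub>M\<^esub> r' \<odot>\<^bsub>M\<^esub> x) = (n \<oplus>\<^bsub>M\<^esub> n') \<oplus>\<^bsub>M\<^esub> (r \<oplus>\<^bsub>R\<^esub> r') \<odot>\<^bsub>M\<^esub> x"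
    if "n \<in> N" "n' \<in> N" "r \<in> carrier R" "r' \<in> carrier R" for n n' r r'
  proof -
    have "n \<in> carrier M" "n' \<in> carrier M" using that sub by auto
    then show ?thesis using that x by (simp add: M.smult_l_distr M.M.a_ac)
  qed
  have mult: "a \<odot>\<^bsub>M\<^esub> (n \<oplus>\<^bsub>M\<^esub> r \<odot>\<^bsub>M\<^esub> x) = a \<odot>\<^bsub>M\<^esub> n \<oplus>\<^bsub>M\<^esub> (a \<otimes>\<^bsub>R\<^esub> r) \<odot>\<^bsub>M\<^esub> x"
    if "n \<in> N" "a \<in> carrier R" "r \<in> carrier R" for n a r
  proof -
    have "n \<in> carrier M" using that sub by auto
    then show ?thesis using that x by (simp add: M.smult_r_distr M.smult_assoc1)
  qed
  have NI: "n \<oplus>\<^bsub>M\<^esub> r \<odot>\<^bsub>M\<^esub> x \<in> ?N" if "n \<in> N" "r \<in> carrier R" for n r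
    using that by blast
  have N': "submodule ?N R M"
  proof (rule M.submoduleI')
    show "?N \<subseteq> carrier M" using sub x by auto
    have "\<zero>\<^bsub>M\<^esub> = \<zero>\<^bsub>M\<^esub> \<oplus>\<^bsub>M\<^esub> \<zero>\<^bsub>R\<^esub> \<odot>\<^bsub>M\<^esub> x" using x by simp
    then show "\<zero>\<^bsub>M\<^esub> \<in> ?N" using NI[OF zN M.R.zero_closed] by argo
  next
    fix y z assume "y \<in> ?N" "z \<in> ?N"
    then obtain n r n' r' where *: "n \<in> N" "n' \<in> N" "r \<in> carrier R" "r' \<in> carrier R"
      "y = n \<oplus>\<^bsub>M\<^esub> r \<odot>\<^bsub>M\<^esub> x" "z = n' \<oplus>\<^bsub>M\<^esub> r' \<odot>\<^bsub>M\<^esub> x" by blast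
    show "y \<oplus>\<^bsub>M\<^esub> z \<in> ?N" unfolding *(5,6) add[OF *(1-4)]
      by (rule NI[OF M.submoduleE(5)[OF N *(1,2)] M.R.a_closed[OF *(3,4)]])
  next
    fix a y assume a: "a \<in> carrier R" and "y \<in> ?N"
    then obtain n r where *: "n \<in> N" "r \<in> carrier R" "y = n \<oplus>\<^bsub>M\<^esub> r \<odot>\<^bsub>M\<^esub> x" by blast
    show "a \<odot>\<^bsub>M\<^esub> y \<in> ?N" unfolding *(3) mult[OF *(1) a *(2)]
      by (rule NI[OF M.submoduleE(4)[OF N a *(1)] M.R.m_closed[OF a *(2)]])
  qed
  obtain h where h: "h \<in> lin_maps R M E" "\<And>y. y \<in> ?N \<Longrightarrow> h y = g y"
  proof (rule injective_extend[OF E M N', of g])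
    fix y assume "y \<in> ?N"
    then obtain n r where *: "n \<in> N" "r \<in> carrier R" "y = n \<oplus>\<^bsub>M\<^esub> r \<odot>\<^bsub>M\<^esub> x" by blast
    show "g y \<in> carrier E" unfolding *(3) gI[OF *(1,2)] using * e by simp
  next
    fix y z assume "y \<in> ?N" "z \<in> ?N"
    then obtain n r n' r' where *: "n \<in> N" "n' \<in> N" "r \<in> carrier R" "r' \<in> carrier R"
      "y = n \<oplus>\<^bsub>M\<^esub> r \<odot>\<^bsub>M\<^esub> x" "z = n' \<oplus>\<^bsub>M\<^esub> r' \<odot>\<^bsub>M\<^esub> x" by blast
    show "g (y \<oplus>\<^bsub>M\<^esub> z) = g y \<oplus>\<^bsub>E\<^esub> g z" unfolding *(5,6) add[OF *(1-4)]
      using * M.submoduleE(5)[OF N *(1,2)] e by (simp add: gI E.smult_l_distr)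
  next
    fix a y assume a: "a \<in> carrier R" and "y \<in> ?N"
    then obtain n r where *: "n \<in> N" "r \<in> carrier R" "y = n \<oplus>\<^bsub>M\<^esub> r \<odot>\<^bsub>M\<^esub> x" by blast
    show "g (a \<odot>\<^bsub>M\<^esub> y) = a \<odot>\<^bsub>E\<^esub> g y" unfolding *(3) mult[OF *(1) a *(2)]
      using * a M.submoduleE(4)[OF N a *(1)] e by (simp add: gI E.smult_assoc1)
  qed (rule that)
  have hn: "h (n \<oplus>\<^bsub>M\<^esub> r \<odot>\<^bsub>M\<^esub> x) = r \<odot>\<^bsub>E\<^esub> e" if "n \<in> N" "r \<in> carrier R" for n r
    using h(2)[OF NI[OF that]] unfolding gI[OF that] .
  have "h n = \<zero>\<^bsub>E\<^esub>" if "n \<in> N" for n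
  proof -
    have "n \<in> carrier M" using that sub by auto
    then show ?thesis using hn[OF that M.R.zero_closed] x e by simp
  qed
  moreover have "h x = e" using hn[OF zN M.R.one_closed] x e by simp
  ultimately show thesis using that h(1) by blast
qed


section \<open>The injective hull of a residue field\<close>

context module
begin

lemma smult_diff_l:
  assumes "a \<in> carrier R" "b \<in> carrier R" "x \<in> carrier M"
  shows "(a \<ominus> b) \<odot>\<^bsub>M\<^esub> x = a \<odot>\<^bsub>M\<^esub> x \<ominus>\<^bsub>M\<^esub> b \<odot>\<^bsub>M\<^esub> x"
  using assms by (simp add: R.minus_eq M.minus_eq smult_l_distr smult_l_minus)

lemma smult_diff_r:
  assumes "a \<in> carrier R" "x \<in> carrier M" "y \<in> carrier M"
  shows "a \<odot>\<^bsub>M\<^esub> (x \<ominus>\<^bsub>M\<^esub> y) = a \<odot>\<^bsub>M\<^esub> x \<ominus>\<^bsub>M\<^esub> a \<odot>\<^bsub>M\<^esub> y"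
  using assms by (simp add: M.minus_eq smult_r_distr smult_r_minus)

lemma smult_diff_zero_iff:
  assumes "a \<in> carrier R" "b \<in> carrier R" "x \<in> carrier M"
  shows "(a \<ominus> b) \<odot>\<^bsub>M\<^esub> x = \<zero>\<^bsub>M\<^esub> \<longleftrightarrow> a \<odot>\<^bsub>M\<^esub> x = b \<odot>\<^bsub>M\<^esub> x"
  using assms smult_diff_l[OF assms] M.minus_eq_zero_iff by simp

lemma smult_left_commute:
  assumes "a \<in> carrier R" "b \<in> carrier R" "x \<in> carrier M"
  shows "a \<odot>\<^bsub>M\<^esub> (b \<odot>\<^bsub>M\<^esub> x) = b \<odot>\<^bsub>M\<^esub> (a \<odot>\<^bsub>M\<^esub> x)"
  using assms by (metis smult_assoc1 R.m_comm)

lemma annihilator_ideal: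
  assumes "U \<subseteq> carrier M"
  shows "ideal {a \<in> carrier R. \<forall>x\<in>U. a \<odot>\<^bsub>M\<^esub> x = \<zero>\<^bsub>M\<^esub>} R"
  by (rule R.idealI') (use assms in \<open>auto simp: smult_l_distr smult_assoc1 subset_iff\<close>)

lemma colon_ideal:
  assumes "submodule N R M" "x \<in> carrier M"
  shows "ideal {a \<in> carrier R. a \<odot>\<^bsub>M\<^esub> x \<in> N} R"
proof (rule R.idealI')
  show "\<zero> \<in> {a \<in> carrier R. a \<odot>\<^bsub>M\<^esub> x \<in> N}"
    using assms by (simp add: submodule_def subgroup_def)
qed (use assms submoduleE(4,5)[OF assms(1)] in \<open>auto simp: smult_l_distr smult_assoc1\<close>)

end

context cring
begin

text \<open>Invertibility in the residue field without forming the quotient: the elements congruent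
  modulo \<open>m\<close> to a multiple of \<open>r\<close> form an ideal that properly contains
  \<open>m\<close>.\<close>

lemma unit_mod_maximal:
  assumes maximal: "maximalideal m R" and r: "r \<in> carrier R" "r \<notin> m"
  shows "\<exists>u\<in>carrier R. u \<otimes> r \<ominus> \<one> \<in> m"
proof -
  interpret m: ideal m R using maximal by (simp add: maximalideal_def)
  let ?J = "{a \<in> carrier R. \<exists>u\<in>carrier R. a \<ominus> u \<otimes> r \<in> m}"
  have "ideal ?J R"
  proof (rule idealI')
    have "\<zero> \<ominus> \<zero> \<otimes> r \<in> m" using assms by (simp add: minus_eq)
    then show "\<zero> \<in> ?J" by blast
  next
    fix x y assume "x \<in> ?J" "y \<in> ?J"
    then obtain u v where *: "x \<in> carrier R" "y \<in> carrier R" "u \<in> carrier R" "v \<in> carrier R"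
      "x \<ominus> u \<otimes> r \<in> m" "y \<ominus> v \<otimes> r \<in> m" by blast
    have "(x \<oplus> y) \<ominus> (u \<oplus> v) \<otimes> r = (x \<ominus> u \<otimes> r) \<oplus> (y \<ominus> v \<otimes> r)"
      using *(1-4) r(1) by algebra
    also have "\<dots> \<in> m" using * by simp
    finally have "(x \<oplus> y) \<ominus> (u \<oplus> v) \<otimes> r \<in> m" .
    then show "x \<oplus> y \<in> ?J" using *(1-4) by (intro CollectI conjI bexI[of _ "u \<oplus> v"]) auto
  next
    fix a x assume a: "a \<in> carrier R" "x \<in> ?J"
    then obtain u where *: "x \<in> carrier R" "u \<in> carrier R" "x \<ominus> u \<otimes> r \<in> m" by blast
    have "a \<otimes> x \<ominus> (a \<otimes> u) \<otimes> r = a \<otimes> (x \<ominus> u \<otimes> r)"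
      using *(1,2) a(1) r(1) by algebra
    also have "\<dots> \<in> m" using * a m.I_l_closed by simp
    finally have "a \<otimes> x \<ominus> (a \<otimes> u) \<otimes> r \<in> m" .
    then show "a \<otimes> x \<in> ?J" using *(1,2) a(1) by (intro CollectI conjI bexI[of _ "a \<otimes> u"]) auto
  qed auto
  moreover have "m \<subseteq> ?J"
  proof
    fix a assume a: "a \<in> m"
    then have "a \<ominus> \<zero> \<otimes> r \<in> m" using r(1) m.Icarr by (simp add: minus_eq)
    then show "a \<in> ?J" using m.Icarr[OF a] by blast
  qed
  moreover have "r \<in> ?J"
  proof -
    have "r \<ominus> \<one> \<otimes> r = \<zero>" using r(1) by algebra
    then have "r \<ominus> \<one> \<otimes> r \<in> m" by simp
    then show ?thesis using r(1) by blast
  qed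
  ultimately have "?J = carrier R"
    using maximal r(2) unfolding maximalideal_def maximalideal_axioms_def by blast
  then have "\<one> \<in> ?J" by simp
  then obtain u where u: "u \<in> carrier R" "\<one> \<ominus> u \<otimes> r \<in> m" by blast
  have "\<ominus> (\<one> \<ominus> u \<otimes> r) = u \<otimes> r \<ominus> \<one>" using u(1) r(1) by algebra
  then show ?thesis using u m.a_inv_closed by metis
qed

section \<open>Powers of an ideal\<close>

lemma ideal_power_0: "ideal_power R I 0 = carrier R"
  by (simp add: ideal_power_def nat_pow_def ideals_set_def)

lemma ideal_power_Suc: "ideal_power R I (Suc n) = ideal_prod R (ideal_power R I n) I"
  by (simp add: ideal_power_def nat_pow_def ideals_set_def)

lemma ideal_power_ideal: "ideal I R \<Longrightarrow> ideal (ideal_power R I n) R"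
  by (induction n) (auto simp: ideal_power_0 ideal_power_Suc oneideal ideal_prod_is_ideal)

lemma ideal_power_antimono:
  assumes "ideal I R" "k \<le> n"
  shows "ideal_power R I n \<subseteq> ideal_power R I k"
  using assms(2)
proof (induction rule: dec_induct)
  case (step n)
  then show ?case
    using ideal_prod_inter[OF ideal_power_ideal[OF assms(1)] assms(1)] by (auto simp: ideal_power_Suc)
qed auto

end

lemma evaluation_lin_map:
  assumes "module R M" "module R N" "q \<in> carrier M"
  shows "(\<lambda>f\<in>lin_maps R M N. f q) \<in> lin_maps R (Hom_module R M N) N"
  using lin_maps_restrictI[OF Hom_module_is_module[OF assms(1,2)], of "\<lambda>f. f q" N]
    lin_mapsD(1)[of _ R M N q] assms(3) by simp

text \<open>An elementary description of the hull of \<open>R / m\<close>: \<open>e\<^sub>0\<close>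
  is the image of the class of \<open>1\<close>, and essentiality becomes the condition that every
  nonzero element has \<open>e\<^sub>0\<close> as a multiple. In this form it passes easily to a
  direct sum with a single summand.\<close>

locale residue_hull = noetherian_domain R + E: module R E
  for R :: "('a, 'r) ring_scheme" (structure) and E :: "('a, 'e) module" +
  fixes m :: "'a set" and e\<^sub>0 :: 'e
  assumes maximal: "maximalideal m R"
    and injective: "injective_module TYPE('a) R E"
    and e0_closed [simp]: "e\<^sub>0 \<in> carrier E"
    and e0_annihilator: "r \<in> carrier R \<Longrightarrow> r \<odot>\<^bsub>E\<^esub> e\<^sub>0 = \<zero>\<^bsub>E\<^esub> \<longleftrightarrow> r \<in> m"
    and essential: "x \<in> carrier E \<Longrightarrow> x \<noteq> \<zero>\<^bsub>E\<^esub> \<Longrightarrow> \<exists>r\<in>carrier R. r \<odot>\<^bsub>E\<^esub> x = e\<^sub>0"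
begin

sublocale m: ideal m R using maximal by (simp add: maximalideal_def)

lemma one_notin_m: "\<one> \<notin> m"
  using maximal m.one_imp_carrier by (auto simp: maximalideal_def maximalideal_axioms_def)

lemma e0_nonzero: "e\<^sub>0 \<noteq> \<zero>\<^bsub>E\<^esub>"
  using e0_annihilator[of \<one>] one_notin_m by auto

text \<open>If \<open>r x = e\<^sub>0\<close> and \<open>m\<close> kills \<open>x\<close>, then
  \<open>r \<notin> m\<close>; an inverse of \<open>r\<close> modulo \<open>m\<close> acts on
  \<open>x\<close> as a true inverse, so \<open>x\<close> is recovered from
  \<open>e\<^sub>0\<close>.\<close>

lemma socle:
  assumes "x \<in> carrier E" "\<And>a. a \<in> m \<Longrightarrow> a \<odot>\<^bsub>E\<^esub> x = \<zero>\<^bsub>E\<^esub>"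
  shows "\<exists>u\<in>carrier R. x = u \<odot>\<^bsub>E\<^esub> e\<^sub>0"
proof (cases "x = \<zero>\<^bsub>E\<^esub>")
  case True
  then show ?thesis by (intro bexI[of _ \<zero>]) auto
next
  case False
  then obtain r where r: "r \<in> carrier R" "r \<odot>\<^bsub>E\<^esub> x = e\<^sub>0" using essential assms(1) by blast
  then have "r \<notin> m" using assms(2) e0_nonzero by auto
  then obtain u where u: "u \<in> carrier R" "u \<otimes> r \<ominus> \<one> \<in> m" using unit_mod_maximal[OF maximal] r by blast
  then have "(u \<otimes> r \<ominus> \<one>) \<odot>\<^bsub>E\<^esub> x = \<zero>\<^bsub>E\<^esub>" using assms(2) by blast
  then have "(u \<otimes> r) \<odot>\<^bsub>E\<^esub> x = \<one> \<odot>\<^bsub>E\<^esub> x"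
    using u r assms(1) E.smult_diff_zero_iff[of "u \<otimes> r" \<one> x] by simp
  then have "x = u \<odot>\<^bsub>E\<^esub> e\<^sub>0" using u r assms(1) by (simp add: E.smult_assoc1)
  then show ?thesis using u by blast
qed

text \<open>
  Noetherian induction on the annihilator of \<open>e\<close>: a multiplier \<open>r\<close> with \<open>r e = e\<^sub>0\<close> annihilates
  \<open>a e\<close> for every \<open>a \<in> m\<close>, but not \<open>e\<close>.
\<close>

lemma power_torsion:
  assumes "e \<in> carrier E"
  shows "\<exists>k. \<forall>a\<in>ideal_power R m k. a \<odot>\<^bsub>E\<^esub> e = \<zero>\<^bsub>E\<^esub>"
proof (rule ccontr)
  define bad where "bad e \<longleftrightarrow> e \<in> carrier E \<and> \<not> (\<exists>k. \<forall>a\<in>ideal_power R m k. a \<odot>\<^bsub>E\<^esub> e = \<zero>\<^bsub>E\<^esub>)" for e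
  define ann where "ann e = {a \<in> carrier R. \<forall>x\<in>{e}. a \<odot>\<^bsub>E\<^esub> x = \<zero>\<^bsub>E\<^esub>}" for e
  assume "\<not> ?thesis"
  then have "bad e" using assms by (simp add: bad_def)
  then have ne: "ann ` Collect bad \<noteq> {}" by auto
  have id: "ideal I R" if "I \<in> ann ` Collect bad" for I
  proof -
    from that obtain x where "bad x" "I = ann x" by blast
    have "ideal (ann x) R"
      unfolding ann_def by (rule E.annihilator_ideal) (use \<open>bad x\<close> in \<open>simp add: bad_def\<close>)
    then show ?thesis using \<open>I = ann x\<close> by simp
  qed
  obtain I where I: "I \<in> ann ` Collect bad" "\<And>J. J \<in> ann ` Collect bad \<Longrightarrow> I \<subseteq> J \<Longrightarrow> J = I"
  proof (rule ex_maximal_ideal_in[OF ne])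
    fix I assume "I \<in> ann ` Collect bad"
    then show "ideal I R" by (rule id)
  qed (rule that)
  then obtain e where e: "bad e" and max: "\<And>x. bad x \<Longrightarrow> ann e \<subseteq> ann x \<Longrightarrow> ann x = ann e" by auto
  have eE: "e \<in> carrier E" using e by (simp add: bad_def)
  have "e \<noteq> \<zero>\<^bsub>E\<^esub>"
    using e m.Icarr ideal.Icarr[OF ideal_power_ideal[OF m.ideal_axioms]] by (auto simp: bad_def)
  then obtain r where r: "r \<in> carrier R" "r \<odot>\<^bsub>E\<^esub> e = e\<^sub>0" using essential eE by blast
  have "\<exists>k. \<forall>c\<in>ideal_power R m k. c \<odot>\<^bsub>E\<^esub> (a \<odot>\<^bsub>E\<^esub> e) = \<zero>\<^bsub>E\<^esub>" if a: "a \<in> m" for a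
  proof (rule ccontr)
    have aR: "a \<in> carrier R" using a m.Icarr by simp
    assume "\<not> ?thesis"
    then have "bad (a \<odot>\<^bsub>E\<^esub> e)" using aR eE by (simp add: bad_def)
    moreover have "ann e \<subseteq> ann (a \<odot>\<^bsub>E\<^esub> e)"
      using aR eE by (auto simp: ann_def E.smult_left_commute[of _ a e])
    ultimately have "ann (a \<odot>\<^bsub>E\<^esub> e) = ann e" by (rule max)
    moreover have "r \<in> ann (a \<odot>\<^bsub>E\<^esub> e)"
      using r a aR eE e0_annihilator by (simp add: ann_def E.smult_left_commute[of r a e])
    ultimately show False using r e0_nonzero by (auto simp: ann_def)
  qed
  then obtain k where k: "\<And>a c. a \<in> m \<Longrightarrow> c \<in> ideal_power R m (k a) \<Longrightarrow> c \<odot>\<^bsub>E\<^esub> (a \<odot>\<^bsub>E\<^esub> e) = \<zero>\<^bsub>E\<^esub>"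
    by metis
  obtain A where A: "A \<subseteq> carrier R" "finite A" "m = Idl A" using finetely_gen[OF m.ideal_axioms] by blast
  have Am: "A \<subseteq> m" using A genideal_self by auto
  \<comment> \<open>The exponent \<open>k a\<close> depends on \<open>a\<close>, but a common one is
    required only for the finitely many generators of \<open>m\<close>, since the elements that kill
    \<open>?U\<close> form an ideal. The \<open>0\<close> keeps \<open>Max\<close> meaningful when
    the generating set is empty.\<close>
  define K where "K = Max (insert 0 (k ` A))"
  let ?P = "ideal_power R m K"
  have PR: "?P \<subseteq> carrier R" using ideal.Icarr[OF ideal_power_ideal[OF m.ideal_axioms]] by auto
  let ?U = "(\<lambda>c. c \<odot>\<^bsub>E\<^esub> e) ` ?P"
  have "a \<odot>\<^bsub>E\<^esub> (c \<odot>\<^bsub>E\<^esub> e) = \<zero>\<^bsub>E\<^esub>" if a: "a \<in> A" and c: "c \<in> ?P" for a c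
  proof -
    have aR: "a \<in> carrier R" using a A by auto
    have "k a \<le> K" using a A(2) by (simp add: K_def)
    then have "c \<in> ideal_power R m (k a)" using c ideal_power_antimono[OF m.ideal_axioms] by auto
    then have "c \<odot>\<^bsub>E\<^esub> (a \<odot>\<^bsub>E\<^esub> e) = \<zero>\<^bsub>E\<^esub>" using k a Am by auto
    then show "a \<odot>\<^bsub>E\<^esub> (c \<odot>\<^bsub>E\<^esub> e) = \<zero>\<^bsub>E\<^esub>" using E.smult_left_commute[of a c e] aR eE c PR by auto
  qed
  then have "A \<subseteq> {a \<in> carrier R. \<forall>x\<in>?U. a \<odot>\<^bsub>E\<^esub> x = \<zero>\<^bsub>E\<^esub>}" using A(1) by auto
  moreover have "?U \<subseteq> carrier E" using PR eE by auto
  ultimately have mX: "m \<subseteq> {a \<in> carrier R. \<forall>x\<in>?U. a \<odot>\<^bsub>E\<^esub> x = \<zero>\<^bsub>E\<^esub>}"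
    using genideal_minimal[OF E.annihilator_ideal] A(3) by blast
  have "x \<in> carrier R \<and> x \<odot>\<^bsub>E\<^esub> e = \<zero>\<^bsub>E\<^esub>" if "x \<in> ideal_prod R ?P m" for x
    using that
  proof (induction rule: ideal_prod.induct)
    case (prod c a)
    then have "a \<odot>\<^bsub>E\<^esub> (c \<odot>\<^bsub>E\<^esub> e) = \<zero>\<^bsub>E\<^esub>" using mX by auto
    then show ?case using prod PR m.Icarr eE
      by (auto simp: E.smult_assoc1 E.smult_left_commute[of c a e] subset_iff)
  next
    case (sum x y)
    then show ?case using eE by (simp add: E.smult_l_distr)
  qed
  then have "\<forall>a\<in>ideal_power R m (Suc K). a \<odot>\<^bsub>E\<^esub> e = \<zero>\<^bsub>E\<^esub>" by (simp add: ideal_power_Suc)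
  then show False using e unfolding bad_def by blast
qed

end

text \<open>Locality in the form in which it is applied: a colon ideal that misses
  \<open>\<one>\<close> lies in \<open>m\<close> and therefore kills
  \<open>e\<^sub>0\<close>.\<close>

locale local_residue_hull = residue_hull +
  assumes proper_le_m: "ideal I R \<Longrightarrow> I \<noteq> carrier R \<Longrightarrow> I \<subseteq> m"
begin

text \<open>The cogenerator property: for \<open>x\<close> outside \<open>N\<close> the colon ideal
  \<open>(N : x)\<close> is proper, hence kills \<open>e\<^sub>0\<close>, and nothing prevents
  sending \<open>N\<close> to zero and \<open>x\<close> to \<open>e\<^sub>0\<close>.\<close>

lemma separate_submodule:
  fixes M :: "('a, 'm) module"
  assumes M: "module R M" and N: "submodule N R M" and x: "x \<in> carrier M" "x \<notin> N"
  obtains f where "f \<in> lin_maps R M E" "\<And>y. y \<in> N \<Longrightarrow> f y = \<zero>\<^bsub>E\<^esub>" "f x = e\<^sub>0"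
proof -
  interpret M: module R M by fact
  have "\<one> \<notin> {a \<in> carrier R. a \<odot>\<^bsub>M\<^esub> x \<in> N}" using x by simp
  then have "{a \<in> carrier R. a \<odot>\<^bsub>M\<^esub> x \<in> N} \<subseteq> m"
    using proper_le_m[OF M.colon_ideal[OF N x(1)]] one_closed by blast
  then have ann: "r \<odot>\<^bsub>E\<^esub> e\<^sub>0 = \<zero>\<^bsub>E\<^esub>" if "r \<in> carrier R" "r \<odot>\<^bsub>M\<^esub> x \<in> N" for r
    using that e0_annihilator by blast
  show thesis by (rule injective_extend_cyclic[OF injective M N x(1) e0_closed]) (fact ann, rule that)
qed

text \<open>Maps from \<open>R\<close> as a module over itself have the form
  \<open>x \<mapsto> x e\<close>, so separating \<open>a\<close> from \<open>I\<close> produces an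
  element \<open>e\<close>. Consequently, scalars that act alike on the part of \<open>E\<close>
  killed by \<open>I\<close> are congruent modulo \<open>I\<close>.\<close>

lemma separate_ideal:
  assumes I: "ideal I R" and a: "a \<in> carrier R" "a \<notin> I"
  obtains e where "e \<in> carrier E" "\<And>x. x \<in> I \<Longrightarrow> x \<odot>\<^bsub>E\<^esub> e = \<zero>\<^bsub>E\<^esub>" "a \<odot>\<^bsub>E\<^esub> e \<noteq> \<zero>\<^bsub>E\<^esub>"
proof -
  let ?R = "restrict_scalars (\<lambda>a. a) R"
  have R: "module R ?R" by (rule regular_module) (rule is_cring)
  interpret RM: module R ?R by (rule R)
  have s: "carrier ?R = carrier R" "\<zero>\<^bsub>?R\<^esub> = \<zero>" "\<And>x y. x \<oplus>\<^bsub>?R\<^esub> y = x \<oplus> y" "\<And>x y. x \<odot>\<^bsub>?R\<^esub> y = x \<otimes> y"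
    by (auto simp: restrict_scalars_def)
  interpret I: ideal I R by fact
  have "submodule I R ?R"
    by (rule RM.submoduleI') (use I.Icarr I.I_l_closed in \<open>auto simp: s\<close>)
  from this obtain f where f: "f \<in> lin_maps R ?R E" "\<And>y. y \<in> I \<Longrightarrow> f y = \<zero>\<^bsub>E\<^esub>" "f a = e\<^sub>0"
  proof (rule separate_submodule[OF R])
    show "a \<in> carrier ?R" "a \<notin> I" using a by (simp_all add: s)
  qed (rule that)
  have fx: "f x = x \<odot>\<^bsub>E\<^esub> f \<one>" if "x \<in> carrier R" for x
    using lin_mapsD(3)[OF f(1), of x \<one>] that by (simp add: s)
  show thesis
  proof (rule that)
    show "f \<one> \<in> carrier E" using lin_mapsD(1)[OF f(1), of \<one>] by (simp add: s)
    show "x \<odot>\<^bsub>E\<^esub> f \<one> = \<zero>\<^bsub>E\<^esub>" if "x \<in> I" for x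
      using fx[OF I.Icarr[OF that]] f(2)[OF that] by simp
    show "a \<odot>\<^bsub>E\<^esub> f \<one> \<noteq> \<zero>\<^bsub>E\<^esub>" using fx[OF a(1)] f(3) e0_nonzero by simp
  qed
qed

text \<open>
  Noetherian induction on \<open>I\<close>: \<open>s\<close> spans a line in the socle of \<open>R/I\<close>, and a map vanishing on the
  annihilator of \<open>I + R s\<close> factors through multiplication by \<open>s\<close>, hence through the socle of \<open>E\<close>.
\<close>

lemma annihilator_map_is_multiplication:
  assumes I: "ideal I R" "ideal_power R m k \<subseteq> I"
    and G: "\<And>x. x \<in> carrier E \<Longrightarrow> \<forall>a\<in>I. a \<odot>\<^bsub>E\<^esub> x = \<zero>\<^bsub>E\<^esub> \<Longrightarrow> G x \<in> carrier E"
      "\<And>x y. x \<in> carrier E \<Longrightarrow> y \<in> carrier E \<Longrightarrow> \<forall>a\<in>I. a \<odot>\<^bsub>E\<^esub> x = \<zero>\<^bsub>E\<^esub> \<Longrightarrow> \<forall>a\<in>I. a \<odot>\<^bsub>E\<^esub> y = \<zero>\<^bsub>E\<^esub> \<Longrightarrow>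
        G (x \<oplus>\<^bsub>E\<^esub> y) = G x \<oplus>\<^bsub>E\<^esub> G y"
      "\<And>r x. r \<in> carrier R \<Longrightarrow> x \<in> carrier E \<Longrightarrow> \<forall>a\<in>I. a \<odot>\<^bsub>E\<^esub> x = \<zero>\<^bsub>E\<^esub> \<Longrightarrow> G (r \<odot>\<^bsub>E\<^esub> x) = r \<odot>\<^bsub>E\<^esub> G x"
  shows "\<exists>r\<in>carrier R. \<forall>x\<in>carrier E. (\<forall>a\<in>I. a \<odot>\<^bsub>E\<^esub> x = \<zero>\<^bsub>E\<^esub>) \<longrightarrow> G x = r \<odot>\<^bsub>E\<^esub> x"
proof -
  define T where "T I = {x \<in> carrier E. \<forall>a\<in>I. a \<odot>\<^bsub>E\<^esub> x = \<zero>\<^bsub>E\<^esub>}" for I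
  \<comment> \<open>Linearity is asked of \<open>G\<close> only on \<open>T I\<close>, so the same
    function can be used on the smaller \<open>T J\<close> of a larger ideal
    \<open>J\<close>.\<close>
  define lin where "lin G I \<longleftrightarrow> (\<forall>x\<in>T I. G x \<in> carrier E) \<and> (\<forall>x\<in>T I. \<forall>y\<in>T I. G (x \<oplus>\<^bsub>E\<^esub> y) = G x \<oplus>\<^bsub>E\<^esub> G y) \<and>
    (\<forall>r\<in>carrier R. \<forall>x\<in>T I. G (r \<odot>\<^bsub>E\<^esub> x) = r \<odot>\<^bsub>E\<^esub> G x)" for G I
  define good where "good I \<longleftrightarrow> (\<forall>G. lin G I \<longrightarrow> (\<exists>r\<in>carrier R. \<forall>x\<in>T I. G x = r \<odot>\<^bsub>E\<^esub> x))" for I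
  have "good I"
  proof (rule ccontr)
    let ?S = "{J. ideal J R \<and> ideal_power R m k \<subseteq> J \<and> \<not> good J}"
    assume "\<not> good I"
    then have "?S \<noteq> {}" using I by auto
    then obtain I where "I \<in> ?S" and max: "\<And>J. J \<in> ?S \<Longrightarrow> I \<subseteq> J \<Longrightarrow> J = I"
      by (rule ex_maximal_ideal_in) auto
    then have I: "ideal I R" "ideal_power R m k \<subseteq> I" "\<not> good I" by auto
    interpret I: ideal I R by fact
    have TE: "x \<in> carrier E" if "x \<in> T J" for x J using that by (simp add: T_def)
    have Tadd: "x \<oplus>\<^bsub>E\<^esub> y \<in> T I" if "x \<in> T I" "y \<in> T I" for x y
      using that I.Icarr by (auto simp: T_def E.smult_r_distr)
    have Tmul: "r \<odot>\<^bsub>E\<^esub> x \<in> T I" if "r \<in> carrier R" "x \<in> T I" for r x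
      using that I.Icarr by (auto simp: T_def E.smult_left_commute[of _ r x])
    \<comment> \<open>The first power of \<open>m\<close> inside \<open>I\<close>. An element
      \<open>s\<close> of the preceding power that is outside \<open>I\<close> satisfies
      \<open>m s \<subseteq> I\<close>.\<close>
    define j where "j = (LEAST j. ideal_power R m j \<subseteq> I)"
    have j: "ideal_power R m j \<subseteq> I" unfolding j_def by (rule LeastI) (rule I(2))
    obtain G where G: "lin G I" and nG: "\<And>r. r \<in> carrier R \<Longrightarrow> \<exists>x\<in>T I. G x \<noteq> r \<odot>\<^bsub>E\<^esub> x"
      using I(3) unfolding good_def by blast
    have "I \<noteq> carrier R"
    proof
      assume "I = carrier R"
      have z: "x = \<zero>\<^bsub>E\<^esub>" if "x \<in> T I" for x
      proof -
        have "\<one> \<in> I" using \<open>I = carrier R\<close> by simp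
        then have "\<one> \<odot>\<^bsub>E\<^esub> x = \<zero>\<^bsub>E\<^esub>" using that unfolding T_def by blast
        then show ?thesis using TE[OF that] by simp
      qed
      obtain x where x: "x \<in> T I" "G x \<noteq> \<zero> \<odot>\<^bsub>E\<^esub> x" using nG by blast
      have "G x = G (\<zero> \<odot>\<^bsub>E\<^esub> x)" using z[OF x(1)] TE[OF x(1)] by simp
      also have "\<dots> = \<zero> \<odot>\<^bsub>E\<^esub> G x" using G x(1) unfolding lin_def by blast
      also have "\<dots> = \<zero> \<odot>\<^bsub>E\<^esub> x" using G x(1) TE[OF x(1)] unfolding lin_def by simp
      finally show False using x by blast
    qed
    then have "j \<noteq> 0" using j ideal_power_0 I.a_subset by (metis subset_antisym)
    then obtain i where i: "j = Suc i" using not0_implies_Suc by blast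
    then have "\<not> ideal_power R m i \<subseteq> I" using not_less_Least[of i "\<lambda>j. ideal_power R m j \<subseteq> I"] by (simp add: j_def)
    then obtain s where s: "s \<in> ideal_power R m i" "s \<notin> I" by blast
    have sR: "s \<in> carrier R" using s ideal.Icarr[OF ideal_power_ideal[OF m.ideal_axioms]] by blast
    have ms: "s \<otimes> a \<in> I" if "a \<in> m" for a
      using ideal_prod.prod[OF s(1) that, of R] j i by (auto simp: ideal_power_Suc)
    let ?J = "Idl (insert s I)"
    have insR: "insert s I \<subseteq> carrier R" using sR I.a_subset by auto
    have J: "ideal ?J R" "insert s I \<subseteq> ?J"
      using genideal_ideal[OF insR] genideal_self[OF insR] by auto
    have TJ: "x \<in> T ?J" if "x \<in> T I" "s \<odot>\<^bsub>E\<^esub> x = \<zero>\<^bsub>E\<^esub>" for x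
    proof -
      have "insert s I \<subseteq> {a \<in> carrier R. \<forall>x\<in>{x}. a \<odot>\<^bsub>E\<^esub> x = \<zero>\<^bsub>E\<^esub>}"
        using that sR I.Icarr by (auto simp: T_def)
      then have "?J \<subseteq> {a \<in> carrier R. \<forall>x\<in>{x}. a \<odot>\<^bsub>E\<^esub> x = \<zero>\<^bsub>E\<^esub>}"
        using genideal_minimal E.annihilator_ideal[of "{x}"] TE[OF that(1)] by blast
      then show ?thesis using TE[OF that(1)] by (auto simp: T_def)
    qed
    have JI: "T ?J \<subseteq> T I" using J(2) by (auto simp: T_def)
    have "good ?J" using max[of ?J] J I(2) s(2) by blast
    moreover have "lin G ?J" using G JI unfolding lin_def by blast
    ultimately obtain r where r: "r \<in> carrier R" "\<And>x. x \<in> T ?J \<Longrightarrow> G x = r \<odot>\<^bsub>E\<^esub> x"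
      unfolding good_def by blast
    \<comment> \<open>If \<open>s\<close> killed all of \<open>T I\<close>, then \<open>T I\<close>
      would be contained in \<open>T ?J\<close>, where \<open>G\<close> is already multiplication by
      \<open>r\<close>.\<close>
    have "\<exists>x\<in>T I. s \<odot>\<^bsub>E\<^esub> x \<noteq> \<zero>\<^bsub>E\<^esub>" using nG[OF r(1)] r(2) TJ by blast
    then obtain x where x: "x \<in> T I" "s \<odot>\<^bsub>E\<^esub> x \<noteq> \<zero>\<^bsub>E\<^esub>" by blast
    then obtain c where c: "c \<in> carrier R" "c \<odot>\<^bsub>E\<^esub> (s \<odot>\<^bsub>E\<^esub> x) = e\<^sub>0" using essential TE sR by blast
    define e1 where "e1 = c \<odot>\<^bsub>E\<^esub> x"
    have e1: "e1 \<in> T I" "s \<odot>\<^bsub>E\<^esub> e1 = e\<^sub>0"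
      using Tmul[OF c(1) x(1)] c TE[OF x(1)] sR by (auto simp: e1_def E.smult_left_commute[of s c x])
    note e1E = TE[OF e1(1)]
    have GE: "G x \<in> carrier E" if "x \<in> T I" for x using G that unfolding lin_def by blast
    \<comment> \<open>The defect of the multiplier \<open>r\<close> at \<open>e1\<close>. Since
      \<open>s\<close> kills \<open>m e1\<close>, the multiplier is already right on
      \<open>m e1\<close>, so the defect is killed by \<open>m\<close> and equals
      \<open>u e\<^sub>0 = (u s) e1\<close>. This shows that \<open>u \<otimes> s\<close> is the
      correction to add to \<open>r\<close>.\<close>
    define w where "w = G e1 \<ominus>\<^bsub>E\<^esub> r \<odot>\<^bsub>E\<^esub> e1"
    have "a \<odot>\<^bsub>E\<^esub> w = \<zero>\<^bsub>E\<^esub>" if "a \<in> m" for a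
    proof -
      have a: "a \<in> carrier R" using that m.Icarr by simp
      have "s \<odot>\<^bsub>E\<^esub> (a \<odot>\<^bsub>E\<^esub> e1) = \<zero>\<^bsub>E\<^esub>"
        using e1 e0_annihilator[OF a] that a sR e1E by (simp add: E.smult_left_commute[of s a e1])
      then have "a \<odot>\<^bsub>E\<^esub> e1 \<in> T ?J" using TJ Tmul[OF a e1(1)] by blast
      then have "G (a \<odot>\<^bsub>E\<^esub> e1) = r \<odot>\<^bsub>E\<^esub> (a \<odot>\<^bsub>E\<^esub> e1)" by (rule r(2))
      moreover have "G (a \<odot>\<^bsub>E\<^esub> e1) = a \<odot>\<^bsub>E\<^esub> G e1" using G a e1(1) unfolding lin_def by blast
      ultimately show ?thesis using a r(1) e1E GE[OF e1(1)]
        by (simp add: w_def E.smult_diff_r E.smult_left_commute[of a r e1] E.M.minus_eq_zero_iff)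
    qed
    moreover have "w \<in> carrier E" using r(1) e1E GE[OF e1(1)] by (simp add: w_def)
    ultimately obtain u where u: "u \<in> carrier R" "w = u \<odot>\<^bsub>E\<^esub> e\<^sub>0" using socle by blast
    have Ge1: "G e1 = r \<odot>\<^bsub>E\<^esub> e1 \<oplus>\<^bsub>E\<^esub> u \<odot>\<^bsub>E\<^esub> e\<^sub>0"
      using u(2) r(1) e1E GE[OF e1(1)] unfolding w_def u(2)[symmetric]
      by (simp add: E.M.minus_eq E.M.a_lcomm E.M.r_neg)
    have "G x = (r \<oplus> u \<otimes> s) \<odot>\<^bsub>E\<^esub> x" if x: "x \<in> T I" for x
    proof -
      note xE = TE[OF x]
      have "a \<odot>\<^bsub>E\<^esub> (s \<odot>\<^bsub>E\<^esub> x) = \<zero>\<^bsub>E\<^esub>" if "a \<in> m" for a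
        using ms[OF that] x m.Icarr[OF that] sR xE
        by (simp add: E.smult_assoc1[symmetric] m_comm[of a s] T_def)
      then obtain v where v: "v \<in> carrier R" "s \<odot>\<^bsub>E\<^esub> x = v \<odot>\<^bsub>E\<^esub> e\<^sub>0" using socle[of "s \<odot>\<^bsub>E\<^esub> x"] sR xE by auto
      \<comment> \<open>Here \<open>s x = v e\<^sub>0 = s (v e1)\<close>, so subtracting
        \<open>v e1\<close> moves \<open>x\<close> into \<open>T ?J\<close>, where \<open>G\<close>
        is known.\<close>
      define y where "y = x \<oplus>\<^bsub>E\<^esub> (\<ominus> v) \<odot>\<^bsub>E\<^esub> e1"
      have y: "y \<in> T I" using Tadd[OF x Tmul[OF _ e1(1)]] v(1) by (simp add: y_def)
      have "s \<odot>\<^bsub>E\<^esub> y = \<zero>\<^bsub>E\<^esub>" using sR v e1 e1E xE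
        by (simp add: y_def E.smult_r_distr E.smult_r_minus E.smult_left_commute[of s v e1] E.smult_l_minus E.M.r_neg)
      then have Gy: "G y = r \<odot>\<^bsub>E\<^esub> y" using r(2) TJ y by blast
      have xy: "x = y \<oplus>\<^bsub>E\<^esub> v \<odot>\<^bsub>E\<^esub> e1"
        using v(1) e1E xE by (simp add: y_def E.smult_l_minus E.M.a_assoc E.M.l_neg)
      have "G x = G y \<oplus>\<^bsub>E\<^esub> v \<odot>\<^bsub>E\<^esub> G e1"
        using G y Tmul[OF v(1) e1(1)] e1(1) v(1) unfolding lin_def by (subst xy) auto
      also have "\<dots> = r \<odot>\<^bsub>E\<^esub> y \<oplus>\<^bsub>E\<^esub> v \<odot>\<^bsub>E\<^esub> (r \<odot>\<^bsub>E\<^esub> e1 \<oplus>\<^bsub>E\<^esub> u \<odot>\<^bsub>E\<^esub> e\<^sub>0)" by (simp add: Gy Ge1)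
      also have "\<dots> = r \<odot>\<^bsub>E\<^esub> (y \<oplus>\<^bsub>E\<^esub> v \<odot>\<^bsub>E\<^esub> e1) \<oplus>\<^bsub>E\<^esub> u \<odot>\<^bsub>E\<^esub> (v \<odot>\<^bsub>E\<^esub> e\<^sub>0)"
        using r(1) v(1) u(1) TE[OF y] e1E
        by (simp add: E.smult_r_distr E.smult_left_commute[of v r] E.smult_left_commute[of v u] E.M.a_assoc)
      also have "\<dots> = (r \<oplus> u \<otimes> s) \<odot>\<^bsub>E\<^esub> x"
        using r(1) u(1) sR xE by (simp add: xy[symmetric] v(2)[symmetric] E.smult_l_distr E.smult_assoc1)
      finally show ?thesis .
    qed
    then show False using nG[of "r \<oplus> u \<otimes> s"] r(1) u(1) sR by auto
  qed
  moreover have "lin G I" using G by (auto simp: lin_def T_def)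
  ultimately show ?thesis unfolding good_def T_def by blast
qed

text \<open>On the elements killed by the \<open>k\<close>-th power of \<open>m\<close> the map
  \<open>h\<close> is multiplication by some \<open>s k\<close>. By \<open>separate_ideal\<close>
  these scalars form a Cauchy sequence, and \<open>power_torsion\<close> makes its limit act on
  every element as \<open>h\<close> does.\<close>

lemma complete_imp_multiplication:
  assumes "adic_complete R m" and h: "h \<in> lin_maps R E E"
  shows "\<exists>r\<in>carrier R. \<forall>x\<in>carrier E. h x = r \<odot>\<^bsub>E\<^esub> x"
proof -
  note pow = ideal_power_ideal[OF m.ideal_axioms]
  have "\<exists>r\<in>carrier R. \<forall>x\<in>carrier E. (\<forall>a\<in>ideal_power R m k. a \<odot>\<^bsub>E\<^esub> x = \<zero>\<^bsub>E\<^esub>) \<longrightarrow> h x = r \<odot>\<^bsub>E\<^esub> x" for k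
    by (rule annihilator_map_is_multiplication[OF pow order_refl]) (use lin_mapsD[OF h] in auto)
  then obtain s where s: "\<And>k. s k \<in> carrier R"
    "\<And>k x. x \<in> carrier E \<Longrightarrow> \<forall>a\<in>ideal_power R m k. a \<odot>\<^bsub>E\<^esub> x = \<zero>\<^bsub>E\<^esub> \<Longrightarrow> h x = s k \<odot>\<^bsub>E\<^esub> x"
    by metis
  have "s i \<ominus> s j \<in> ideal_power R m k" if "k \<le> i" "k \<le> j" for i j k
  proof (rule ccontr)
    assume "s i \<ominus> s j \<notin> ideal_power R m k"
    then obtain e where e: "e \<in> carrier E" "\<And>a. a \<in> ideal_power R m k \<Longrightarrow> a \<odot>\<^bsub>E\<^esub> e = \<zero>\<^bsub>E\<^esub>"
      "(s i \<ominus> s j) \<odot>\<^bsub>E\<^esub> e \<noteq> \<zero>\<^bsub>E\<^esub>" using separate_ideal[OF pow] s(1) by (metis minus_closed)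
    have "h e = s l \<odot>\<^bsub>E\<^esub> e" if "k \<le> l" for l
      using s(2)[OF e(1), of l] e(2) ideal_power_antimono[OF m.ideal_axioms that] by blast
    then have "s i \<odot>\<^bsub>E\<^esub> e = s j \<odot>\<^bsub>E\<^esub> e" using that by metis
    then show False using e s(1) E.smult_diff_zero_iff by simp
  qed
  then have "adic_Cauchy R m s" using s(1) unfolding adic_Cauchy_def by auto
  then obtain r where r: "adic_limit R m s r" using assms(1) unfolding adic_complete_def by blast
  then have rR: "r \<in> carrier R" by (simp add: adic_limit_def)
  have "h x = r \<odot>\<^bsub>E\<^esub> x" if x: "x \<in> carrier E" for x
  proof -
    obtain k where k: "\<forall>a\<in>ideal_power R m k. a \<odot>\<^bsub>E\<^esub> x = \<zero>\<^bsub>E\<^esub>" using power_torsion[OF x] by blast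
    obtain N where N: "\<And>i. i \<ge> N \<Longrightarrow> s i \<ominus> r \<in> ideal_power R m k"
      using r unfolding adic_limit_def by blast
    let ?i = "max N k"
    have "h x = s ?i \<odot>\<^bsub>E\<^esub> x"
      using s(2)[OF x, of ?i] k ideal_power_antimono[OF m.ideal_axioms, of k ?i] by auto
    moreover have "(s ?i \<ominus> r) \<odot>\<^bsub>E\<^esub> x = \<zero>\<^bsub>E\<^esub>" using N[of ?i] k by auto
    ultimately show ?thesis using E.smult_diff_zero_iff[OF s(1) rR x] by simp
  qed
  then show ?thesis using rR by blast
qed

text \<open>By \<open>power_torsion\<close> a Cauchy sequence of scalars acts on each single element
  of \<open>E\<close> as an eventually constant sequence. The eventual value defines an
  endomorphism; a scalar that realises it is the limit, by \<open>separate_ideal\<close>.\<close>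

lemma multiplication_imp_complete:
  assumes mult: "\<And>h. h \<in> lin_maps R E E \<Longrightarrow> \<exists>r\<in>carrier R. \<forall>x\<in>carrier E. h x = r \<odot>\<^bsub>E\<^esub> x"
  shows "adic_complete R m"
  unfolding adic_complete_def
proof (intro allI impI)
  note pow = ideal_power_ideal[OF m.ideal_axioms]
  fix s assume s: "adic_Cauchy R m s"
  then have sR: "s i \<in> carrier R" for i by (auto simp: adic_Cauchy_def)
  have C: "\<exists>N. \<forall>i\<ge>N. \<forall>j\<ge>N. s i \<ominus> s j \<in> ideal_power R m k" for k
    using s unfolding adic_Cauchy_def by blast
  have ev: "\<exists>c. \<exists>N. \<forall>i\<ge>N. s i \<odot>\<^bsub>E\<^esub> x = c" if x: "x \<in> carrier E" for x
  proof -
    obtain k where k: "\<forall>a\<in>ideal_power R m k. a \<odot>\<^bsub>E\<^esub> x = \<zero>\<^bsub>E\<^esub>" using power_torsion[OF x] by blast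
    obtain N where "\<forall>i\<ge>N. \<forall>j\<ge>N. s i \<ominus> s j \<in> ideal_power R m k" using C by blast
    then have "\<forall>i\<ge>N. s i \<odot>\<^bsub>E\<^esub> x = s N \<odot>\<^bsub>E\<^esub> x"
      using k E.smult_diff_zero_iff[OF sR sR x] by blast
    then show ?thesis by blast
  qed
  define h where "h x = (SOME c. \<exists>N. \<forall>i\<ge>N. s i \<odot>\<^bsub>E\<^esub> x = c)" for x
  have hN: "\<exists>N. \<forall>i\<ge>N. s i \<odot>\<^bsub>E\<^esub> x = h x" if "x \<in> carrier E" for x
    unfolding h_def by (rule someI_ex) (rule ev[OF that])
  have hE: "h x \<in> carrier E" if "x \<in> carrier E" for x
  proof -
    from hN[OF that] obtain N where "\<forall>i\<ge>N. s i \<odot>\<^bsub>E\<^esub> x = h x" by blast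
    then have "s N \<odot>\<^bsub>E\<^esub> x = h x" by simp
    moreover have "s N \<odot>\<^bsub>E\<^esub> x \<in> carrier E" using sR that by simp
    ultimately show ?thesis by simp
  qed
  have "(\<lambda>x\<in>carrier E. h x) \<in> lin_maps R E E"
  proof (rule lin_maps_restrictI)
    fix x y assume xy: "x \<in> carrier E" "y \<in> carrier E"
    obtain N1 where N1: "\<forall>i\<ge>N1. s i \<odot>\<^bsub>E\<^esub> x = h x" using hN[OF xy(1)] by blast
    obtain N2 where N2: "\<forall>i\<ge>N2. s i \<odot>\<^bsub>E\<^esub> y = h y" using hN[OF xy(2)] by blast
    obtain N3 where "\<forall>i\<ge>N3. s i \<odot>\<^bsub>E\<^esub> (x \<oplus>\<^bsub>E\<^esub> y) = h (x \<oplus>\<^bsub>E\<^esub> y)"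
      using hN[OF E.M.a_closed[OF xy]] by blast
    with N1 N2 have "s (N1 + N2 + N3) \<odot>\<^bsub>E\<^esub> x = h x" "s (N1 + N2 + N3) \<odot>\<^bsub>E\<^esub> y = h y"
      "s (N1 + N2 + N3) \<odot>\<^bsub>E\<^esub> (x \<oplus>\<^bsub>E\<^esub> y) = h (x \<oplus>\<^bsub>E\<^esub> y)" by auto
    then show "h (x \<oplus>\<^bsub>E\<^esub> y) = h x \<oplus>\<^bsub>E\<^esub> h y" using E.smult_r_distr[OF sR xy] by metis
  next
    fix a x assume ax: "a \<in> carrier R" "x \<in> carrier E"
    obtain N1 where N1: "\<forall>i\<ge>N1. s i \<odot>\<^bsub>E\<^esub> x = h x" using hN[OF ax(2)] by blast
    obtain N2 where "\<forall>i\<ge>N2. s i \<odot>\<^bsub>E\<^esub> (a \<odot>\<^bsub>E\<^esub> x) = h (a \<odot>\<^bsub>E\<^esub> x)"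
      using hN[OF E.smult_closed[OF ax]] by blast
    with N1 have "s (N1 + N2) \<odot>\<^bsub>E\<^esub> x = h x" "s (N1 + N2) \<odot>\<^bsub>E\<^esub> (a \<odot>\<^bsub>E\<^esub> x) = h (a \<odot>\<^bsub>E\<^esub> x)" by auto
    then show "h (a \<odot>\<^bsub>E\<^esub> x) = a \<odot>\<^bsub>E\<^esub> h x" using E.smult_left_commute[OF sR ax] by metis
  qed (use hE E.module_axioms in auto)
  from mult[OF this] obtain r where r: "r \<in> carrier R" "\<And>x. x \<in> carrier E \<Longrightarrow> h x = r \<odot>\<^bsub>E\<^esub> x"
    by auto
  have lim: "adic_limit R m s r"
    unfolding adic_limit_def
  proof (intro conjI allI)
    fix k
    obtain N where N: "\<And>i j. i \<ge> N \<Longrightarrow> j \<ge> N \<Longrightarrow> s i \<ominus> s j \<in> ideal_power R m k" using C by blast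
    have "s i \<ominus> r \<in> ideal_power R m k" if i: "i \<ge> N" for i
    proof (rule ccontr)
      assume "s i \<ominus> r \<notin> ideal_power R m k"
      then obtain e where e: "e \<in> carrier E" "\<And>a. a \<in> ideal_power R m k \<Longrightarrow> a \<odot>\<^bsub>E\<^esub> e = \<zero>\<^bsub>E\<^esub>"
        "(s i \<ominus> r) \<odot>\<^bsub>E\<^esub> e \<noteq> \<zero>\<^bsub>E\<^esub>" using separate_ideal[OF pow] sR r(1) by (metis minus_closed)
      obtain N' where N': "\<forall>j\<ge>N'. s j \<odot>\<^bsub>E\<^esub> e = h e" using hN[OF e(1)] by blast
      have "s i \<odot>\<^bsub>E\<^esub> e = s (N + N') \<odot>\<^bsub>E\<^esub> e"
        using e(2)[OF N[OF i, of "N + N'"]] E.smult_diff_zero_iff[OF sR sR e(1)] by simp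
      also have "\<dots> = r \<odot>\<^bsub>E\<^esub> e" using N' r(2)[OF e(1)] by simp
      finally show False using e(3) E.smult_diff_zero_iff[OF sR r(1) e(1)] by simp
    qed
    then show "\<exists>N. \<forall>i\<ge>N. s i \<ominus> r \<in> ideal_power R m k" by blast
  qed (rule r(1))
  \<comment> \<open>Separatedness: any limit acts on each element of \<open>E\<close> as
    \<open>s\<close> does eventually, and \<open>E\<close> is faithful by
    \<open>separate_ideal\<close> for the zero ideal.\<close>
  have "y = r" if y: "adic_limit R m s y" for y
  proof (rule ccontr)
    assume "y \<noteq> r"
    have yR: "y \<in> carrier R" using y by (simp add: adic_limit_def)
    then have "y \<ominus> r \<notin> {\<zero>}" using \<open>y \<noteq> r\<close> r(1) minus_eq_zero_iff by simp
    then obtain e where e: "e \<in> carrier E" "(y \<ominus> r) \<odot>\<^bsub>E\<^esub> e \<noteq> \<zero>\<^bsub>E\<^esub>"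
      using separate_ideal[OF zeroideal, of "y \<ominus> r"] yR r(1) by auto
    obtain k where k: "\<forall>a\<in>ideal_power R m k. a \<odot>\<^bsub>E\<^esub> e = \<zero>\<^bsub>E\<^esub>" using power_torsion[OF e(1)] by blast
    obtain N where N: "\<forall>i\<ge>N. s i \<ominus> y \<in> ideal_power R m k" using y unfolding adic_limit_def by blast
    obtain N' where "\<forall>i\<ge>N'. s i \<ominus> r \<in> ideal_power R m k" using lim unfolding adic_limit_def by blast
    with N have "s (N + N') \<ominus> y \<in> ideal_power R m k" "s (N + N') \<ominus> r \<in> ideal_power R m k" by auto
    then have "s (N + N') \<odot>\<^bsub>E\<^esub> e = y \<odot>\<^bsub>E\<^esub> e" "s (N + N') \<odot>\<^bsub>E\<^esub> e = r \<odot>\<^bsub>E\<^esub> e"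
      using k E.smult_diff_zero_iff[OF sR yR e(1)] E.smult_diff_zero_iff[OF sR r(1) e(1)] by blast+
    then show False using e(2) E.smult_diff_zero_iff[OF yR r(1) e(1)] by simp
  qed
  then show "\<exists>!x. adic_limit R m s x" using lim by blast
qed

end


section \<open>Reflexivity and interpolation\<close>

lemma Hom_module_diff_closed:
  assumes "module R M" "module R N" "f \<in> lin_maps R M N" "g \<in> lin_maps R M N"
  shows "f \<ominus>\<^bsub>Hom_module R M N\<^esub> g \<in> lin_maps R M N"
proof -
  interpret H: module R "Hom_module R M N" by (rule Hom_module_is_module[OF assms(1,2)])
  show ?thesis using H.M.minus_closed[of f g] assms(3,4) by simp
qed

lemma Hom_module_diff_apply:
  assumes "module R M" "module R N" "f \<in> lin_maps R M N" "g \<in> lin_maps R M N" "x \<in> carrier M"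
  shows "(f \<ominus>\<^bsub>Hom_module R M N\<^esub> g) x = f x \<ominus>\<^bsub>N\<^esub> g x"
  using lin_maps_diff[OF Hom_module_is_module[OF assms(1,2)] assms(2) evaluation_lin_map[OF assms(1,2,5)], of f g]
    Hom_module_diff_closed[OF assms(1-4)] assms(3,4) by simp

section \<open>Common kernels and images as submodules\<close>

lemma common_kernel_submodule:
  assumes M: "module R M" and N: "module R N" and F: "F \<subseteq> lin_maps R M N"
  shows "submodule {x \<in> carrier M. \<forall>f\<in>F. f x = \<zero>\<^bsub>N\<^esub>} R M"
proof -
  interpret M: module R M by fact
  interpret N: module R N by fact
  show ?thesis
  proof (rule M.submoduleI')
    show "\<zero>\<^bsub>M\<^esub> \<in> {x \<in> carrier M. \<forall>f\<in>F. f x = \<zero>\<^bsub>N\<^esub>}"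
      using F lin_maps_zero[OF M N] by auto
  next
    fix x y assume xy: "x \<in> {x \<in> carrier M. \<forall>f\<in>F. f x = \<zero>\<^bsub>N\<^esub>}" "y \<in> {x \<in> carrier M. \<forall>f\<in>F. f x = \<zero>\<^bsub>N\<^esub>}"
    have "f (x \<oplus>\<^bsub>M\<^esub> y) = \<zero>\<^bsub>N\<^esub>" if f: "f \<in> F" for f
    proof -
      have "f (x \<oplus>\<^bsub>M\<^esub> y) = f x \<oplus>\<^bsub>N\<^esub> f y" using lin_mapsD(2)[of f R M N x y] F f xy by blast
      moreover have "f x = \<zero>\<^bsub>N\<^esub>" "f y = \<zero>\<^bsub>N\<^esub>" using f xy by blast+
      ultimately show ?thesis by simp
    qed
    then show "x \<oplus>\<^bsub>M\<^esub> y \<in> {x \<in> carrier M. \<forall>f\<in>F. f x = \<zero>\<^bsub>N\<^esub>}" using xy by simp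
  next
    fix a x assume a: "a \<in> carrier R" and x: "x \<in> {x \<in> carrier M. \<forall>f\<in>F. f x = \<zero>\<^bsub>N\<^esub>}"
    have "f (a \<odot>\<^bsub>M\<^esub> x) = \<zero>\<^bsub>N\<^esub>" if f: "f \<in> F" for f
    proof -
      have "f (a \<odot>\<^bsub>M\<^esub> x) = a \<odot>\<^bsub>N\<^esub> f x" using lin_mapsD(3)[of f R M N a x] F f a x by blast
      moreover have "f x = \<zero>\<^bsub>N\<^esub>" using f x by blast
      ultimately show ?thesis using a by simp
    qed
    then show "a \<odot>\<^bsub>M\<^esub> x \<in> {x \<in> carrier M. \<forall>f\<in>F. f x = \<zero>\<^bsub>N\<^esub>}" using a x by simp
  qed auto
qed

lemma image_submodule:
  assumes M: "module R M" and N: "module R N" and f: "f \<in> lin_maps R M N" and K: "submodule K R M"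
  shows "submodule (f ` K) R N"
proof -
  interpret M: module R M by fact
  interpret N: module R N by fact
  note sub = M.submoduleE(1)[OF K]
  show ?thesis
  proof (rule N.submoduleI')
    show "f ` K \<subseteq> carrier N" using lin_mapsD(1)[OF f] sub by blast
    have "\<zero>\<^bsub>M\<^esub> \<in> K" using K by (simp add: submodule_def subgroup_def)
    then have "f \<zero>\<^bsub>M\<^esub> \<in> f ` K" by blast
    then show "\<zero>\<^bsub>N\<^esub> \<in> f ` K" using lin_maps_zero[OF M N f] by simp
  next
    fix x y assume "x \<in> f ` K" "y \<in> f ` K"
    then obtain u v where uv: "u \<in> K" "v \<in> K" "x = f u" "y = f v" by blast
    have "u \<in> carrier M" "v \<in> carrier M" using uv sub by auto
    then have "x \<oplus>\<^bsub>N\<^esub> y = f (u \<oplus>\<^bsub>M\<^esub> v)" using lin_mapsD(2)[OF f] uv by simp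
    then show "x \<oplus>\<^bsub>N\<^esub> y \<in> f ` K" using M.submoduleE(5)[OF K uv(1,2)] by simp
  next
    fix a x assume a: "a \<in> carrier R" and "x \<in> f ` K"
    then obtain u where u: "u \<in> K" "x = f u" by blast
    have "u \<in> carrier M" using u sub by auto
    then have "a \<odot>\<^bsub>N\<^esub> x = f (a \<odot>\<^bsub>M\<^esub> u)" using lin_mapsD(3)[OF f a] u by simp
    then show "a \<odot>\<^bsub>N\<^esub> x \<in> f ` K" using M.submoduleE(4)[OF K a u(1)] by simp
  qed
qed

lemma reflexive_wrtI:
  assumes M: "module R M" and E: "module R E"
    and inj: "\<And>x. x \<in> carrier M \<Longrightarrow> x \<noteq> \<zero>\<^bsub>M\<^esub> \<Longrightarrow> \<exists>f\<in>lin_maps R M E. f x \<noteq> \<zero>\<^bsub>E\<^esub>"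
    and surj: "\<And>G. G \<in> lin_maps R (Hom_module R M E) E \<Longrightarrow> \<exists>q\<in>carrier M. \<forall>f\<in>lin_maps R M E. G f = f q"
  shows "reflexive_wrt R E M"
proof -
  interpret M: module R M by fact
  interpret E: module R E by fact
  let ?ev = "evaluation_map R E M" and ?H = "Hom_module R M E"
  have ev: "?ev x = (\<lambda>f\<in>lin_maps R M E. f x)" if "x \<in> carrier M" for x
    using that by (simp add: evaluation_map_def)
  have "?ev \<in> lin_maps R M (Hom_module R ?H E)"
    unfolding evaluation_map_def
  proof (rule lin_maps_restrictI[OF M])
    fix x assume x: "x \<in> carrier M"
    then show "(\<lambda>f\<in>lin_maps R M E. f x) \<in> carrier (Hom_module R ?H E)"
      using evaluation_lin_map[OF M E] by simp
    fix y assume y: "y \<in> carrier M"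
    show "(\<lambda>f\<in>lin_maps R M E. f (x \<oplus>\<^bsub>M\<^esub> y)) =
      (\<lambda>f\<in>lin_maps R M E. f x) \<oplus>\<^bsub>Hom_module R ?H E\<^esub> (\<lambda>f\<in>lin_maps R M E. f y)"
      using lin_mapsD(2)[of _ R M E x y] x y by (simp cong: restrict_cong)
  next
    fix a x assume "a \<in> carrier R" "x \<in> carrier M"
    then show "(\<lambda>f\<in>lin_maps R M E. f (a \<odot>\<^bsub>M\<^esub> x)) = a \<odot>\<^bsub>Hom_module R ?H E\<^esub> (\<lambda>f\<in>lin_maps R M E. f x)"
      using lin_mapsD(3)[of _ R M E a x] by (simp cong: restrict_cong)
  qed
  moreover have "inj_on ?ev (carrier M)"
  proof (rule inj_onI)
    fix x y assume xy: "x \<in> carrier M" "y \<in> carrier M" "?ev x = ?ev y"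
    have fxy: "f x = f y" if "f \<in> lin_maps R M E" for f
      using fun_cong[OF xy(3), of f] that by (simp add: ev xy(1,2))
    have "f (x \<ominus>\<^bsub>M\<^esub> y) = \<zero>\<^bsub>E\<^esub>" if "f \<in> lin_maps R M E" for f
      unfolding lin_maps_diff[OF M E that xy(1,2)] fxy[OF that]
      using lin_mapsD(1)[OF that xy(2)] by (simp add: E.M.minus_eq E.M.r_neg)
    then have "x \<ominus>\<^bsub>M\<^esub> y = \<zero>\<^bsub>M\<^esub>" using inj[of "x \<ominus>\<^bsub>M\<^esub> y"] xy(1,2) by auto
    then show "x = y" using xy(1,2) M.M.minus_eq_zero_iff by simp
  qed
  moreover have "?ev ` carrier M = carrier (Hom_module R ?H E)"
  proof
    show "?ev ` carrier M \<subseteq> carrier (Hom_module R ?H E)"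
      using lin_mapsD(1)[OF calculation(1)] by blast
    show "carrier (Hom_module R ?H E) \<subseteq> ?ev ` carrier M"
    proof
      fix G assume "G \<in> carrier (Hom_module R ?H E)"
      then have G: "G \<in> lin_maps R ?H E" by simp
      then obtain q where q: "q \<in> carrier M" "\<forall>f\<in>lin_maps R M E. G f = f q" using surj by blast
      have "G = ?ev q"
        by (rule lin_maps_eqI[OF G]) (use evaluation_lin_map[OF M E q(1)] q in \<open>simp_all add: ev\<close>)
      then show "G \<in> ?ev ` carrier M" using q by blast
    qed
  qed
  ultimately show ?thesis by (simp add: reflexive_wrt_def lin_isos_def bij_betw_def)
qed

lemma reflexive_wrtD:
  assumes "reflexive_wrt R E M" "G \<in> lin_maps R (Hom_module R M E) E"
  shows "\<exists>q\<in>carrier M. \<forall>f\<in>lin_maps R M E. G f = f q"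
proof -
  have "G \<in> evaluation_map R E M ` carrier M"
    using assms by (simp add: reflexive_wrt_def lin_isos_def bij_betw_def)
  then show ?thesis by (auto simp: evaluation_map_def)
qed

context local_residue_hull
begin

text \<open>Given \<open>mult\<close>, a map that vanishes on the common kernel of \<open>F\<close>
  is a linear combination of \<open>F\<close>, and the induction unrolls this. On the common kernel
  \<open>K\<close> of the smaller set, \<open>f\<close> factors through \<open>f0\<close>; the
  factor extends to an endomorphism of \<open>E\<close>, which is a scalar \<open>r\<close>, and
  \<open>f - r f0\<close> is a case for the smaller set.\<close>

lemma vanishing_on_common_kernel:
  fixes M :: "('a, 'm) module"
  assumes mult: "\<And>h. h \<in> lin_maps R E E \<Longrightarrow> \<exists>r\<in>carrier R. \<forall>x\<in>carrier E. h x = r \<odot>\<^bsub>E\<^esub> x"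
    and M: "module R M" and G: "G \<in> lin_maps R (Hom_module R M E) E"
    and "finite F" "F \<subseteq> lin_maps R M E" "f \<in> lin_maps R M E"
    and "\<And>x. x \<in> carrier M \<Longrightarrow> \<forall>g\<in>F. g x = \<zero>\<^bsub>E\<^esub> \<Longrightarrow> f x = \<zero>\<^bsub>E\<^esub>"
    and "\<And>g. g \<in> F \<Longrightarrow> G g = \<zero>\<^bsub>E\<^esub>"
  shows "G f = \<zero>\<^bsub>E\<^esub>"
  using assms(4-)
proof (induction F arbitrary: f)
  interpret M: module R M by fact
  note E = E.module_axioms
  let ?H = "Hom_module R M E"
  have H: "module R ?H" by (rule Hom_module_is_module[OF M E])
  interpret H: module R ?H by fact
  {
    case empty
    have "f = \<zero>\<^bsub>?H\<^esub>"
      by (rule lin_maps_eqI[OF empty(2)]) (use empty lin_maps_zero_map[OF M E] in simp_all)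
    then show ?case using lin_maps_zero[OF H E G] by (simp only:)
  next
    case (insert f0 F)
    have f0: "f0 \<in> lin_maps R M E" and F: "F \<subseteq> lin_maps R M E" and f: "f \<in> lin_maps R M E"
      using insert.prems by auto
    define K where "K = {x \<in> carrier M. \<forall>g\<in>F. g x = \<zero>\<^bsub>E\<^esub>}"
    have KM: "x \<in> carrier M" if "x \<in> K" for x using that by (simp add: K_def)
    have K: "submodule K R M" unfolding K_def by (rule common_kernel_submodule[OF M E F])
    note Kadd = M.submoduleE(5)[OF K] and Kmul = M.submoduleE(4)[OF K]
    have fK: "f x = \<zero>\<^bsub>E\<^esub>" if "x \<in> K" "f0 x = \<zero>\<^bsub>E\<^esub>" for x
      using that insert.prems(3)[of x] by (simp add: K_def)
    have wd: "f x = f y" if "x \<in> K" "y \<in> K" "f0 x = f0 y" for x y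
    proof -
      note xy = KM[OF that(1)] KM[OF that(2)]
      have "x \<ominus>\<^bsub>M\<^esub> y = x \<oplus>\<^bsub>M\<^esub> (\<ominus> \<one>) \<odot>\<^bsub>M\<^esub> y" using xy by (simp add: M.M.minus_eq M.smult_l_minus)
      then have "x \<ominus>\<^bsub>M\<^esub> y \<in> K" using Kadd[OF that(1) Kmul[OF _ that(2)], of "\<ominus> \<one>"] by simp
      moreover have "f0 (x \<ominus>\<^bsub>M\<^esub> y) = \<zero>\<^bsub>E\<^esub>"
        using lin_maps_diff[OF M E f0 xy] that(3) lin_mapsD(1)[OF f0 xy(2)]
        by (simp add: E.M.minus_eq_zero_iff)
      ultimately have "f (x \<ominus>\<^bsub>M\<^esub> y) = \<zero>\<^bsub>E\<^esub>" by (rule fK)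
      then show ?thesis
        using lin_maps_diff[OF M E f xy] lin_mapsD(1)[OF f] xy E.M.minus_eq_zero_iff by simp
    qed
    define g where "g e = f (SOME x. x \<in> K \<and> f0 x = e)" for e
    have g: "g (f0 x) = f x" if "x \<in> K" for x
    proof -
      have "(SOME y. y \<in> K \<and> f0 y = f0 x) \<in> K \<and> f0 (SOME y. y \<in> K \<and> f0 y = f0 x) = f0 x"
        by (rule someI[of "\<lambda>y. y \<in> K \<and> f0 y = f0 x"]) (use that in simp)
      then show ?thesis using wd that unfolding g_def by blast
    qed
    have N: "submodule (f0 ` K) R E" by (rule image_submodule[OF M E f0 K])
    obtain h where h: "h \<in> lin_maps R E E" "\<And>x. x \<in> f0 ` K \<Longrightarrow> h x = g x"
    proof (rule injective_extend[OF injective E N, of g])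
      fix x assume "x \<in> f0 ` K"
      then obtain u where u: "u \<in> K" "x = f0 u" by blast
      then show "g x \<in> carrier E" using g[OF u(1)] lin_mapsD(1)[OF f KM] by simp
    next
      fix x y assume "x \<in> f0 ` K" "y \<in> f0 ` K"
      then obtain u v where uv: "u \<in> K" "v \<in> K" "x = f0 u" "y = f0 v" by blast
      have "x \<oplus>\<^bsub>E\<^esub> y = f0 (u \<oplus>\<^bsub>M\<^esub> v)" using lin_mapsD(2)[OF f0 KM KM] uv by simp
      then show "g (x \<oplus>\<^bsub>E\<^esub> y) = g x \<oplus>\<^bsub>E\<^esub> g y"
        using g[OF Kadd[OF uv(1,2)]] g[OF uv(1)] g[OF uv(2)] lin_mapsD(2)[OF f KM KM] uv by simp
    next
      fix a x assume a: "a \<in> carrier R" and "x \<in> f0 ` K"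
      then obtain u where u: "u \<in> K" "x = f0 u" by blast
      have "a \<odot>\<^bsub>E\<^esub> x = f0 (a \<odot>\<^bsub>M\<^esub> u)" using lin_mapsD(3)[OF f0 a KM] u by simp
      then show "g (a \<odot>\<^bsub>E\<^esub> x) = a \<odot>\<^bsub>E\<^esub> g x"
        using g[OF Kmul[OF a u(1)]] g[OF u(1)] lin_mapsD(3)[OF f a KM] u by simp
    qed (rule that)
    from mult[OF h(1)] obtain r where r: "r \<in> carrier R" "\<And>x. x \<in> carrier E \<Longrightarrow> h x = r \<odot>\<^bsub>E\<^esub> x" by blast
    let ?rf0 = "r \<odot>\<^bsub>?H\<^esub> f0"
    have rf0: "?rf0 \<in> lin_maps R M E" using lin_maps_smult[OF M E f0 r(1)] by simp
    let ?f = "f \<ominus>\<^bsub>?H\<^esub> ?rf0"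
    have "G ?f = \<zero>\<^bsub>E\<^esub>"
    proof (rule insert.IH)
      show "?f \<in> lin_maps R M E" by (rule Hom_module_diff_closed[OF M E f rf0])
      fix x assume x: "x \<in> carrier M" "\<forall>g\<in>F. g x = \<zero>\<^bsub>E\<^esub>"
      then have xK: "x \<in> K" by (simp add: K_def)
      have "f x = r \<odot>\<^bsub>E\<^esub> f0 x"
        using g[OF xK] h(2)[of "f0 x"] xK r(2)[OF lin_mapsD(1)[OF f0 x(1)]] by simp
      then show "?f x = \<zero>\<^bsub>E\<^esub>"
        using Hom_module_diff_apply[OF M E f rf0 x(1)] x(1) lin_mapsD(1)[OF f0 x(1)] r(1)
        by (simp add: E.M.minus_eq_zero_iff)
    qed (use insert.prems F in auto)
    moreover have "G ?f = G f \<ominus>\<^bsub>E\<^esub> r \<odot>\<^bsub>E\<^esub> G f0"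
      using lin_maps_diff[OF H E G, of f ?rf0] lin_mapsD(3)[OF G r(1), of f0] f rf0 f0 by simp
    moreover have "G f0 = \<zero>\<^bsub>E\<^esub>" using insert.prems(4) by simp
    moreover have "G f \<in> carrier E" using lin_mapsD(1)[OF G, of f] f by simp
    ultimately show ?case using r(1) E.M.minus_eq_zero_iff[of "G f" "\<zero>\<^bsub>E\<^esub>"] by simp
  }
qed

text \<open>One map at a time: after subtracting the evaluation at the point found for
  \<open>F\<close>, the functional kills \<open>F\<close>, and the point may still be moved inside
  the common kernel \<open>K\<close> of \<open>F\<close> so as to fit the new map.\<close>

lemma finite_interpolation:
  fixes M :: "('a, 'm) module"
  assumes mult: "\<And>h. h \<in> lin_maps R E E \<Longrightarrow> \<exists>r\<in>carrier R. \<forall>x\<in>carrier E. h x = r \<odot>\<^bsub>E\<^esub> x"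
    and M: "module R M" and G: "G \<in> lin_maps R (Hom_module R M E) E"
    and "finite F" "F \<subseteq> lin_maps R M E"
  shows "\<exists>q\<in>carrier M. \<forall>f\<in>F. G f = f q"
  using assms(4,5)
proof (induction F)
  interpret M: module R M by fact
  note E = E.module_axioms
  let ?H = "Hom_module R M E"
  have H: "module R ?H" by (rule Hom_module_is_module[OF M E])
  interpret H: module R ?H by fact
  {
    case empty
    then show ?case using M.M.zero_closed by blast
  next
    case (insert f0 F)
    have f0: "f0 \<in> lin_maps R M E" and F: "F \<subseteq> lin_maps R M E" using insert.prems by auto
    obtain q where q: "q \<in> carrier M" "\<And>f. f \<in> F \<Longrightarrow> G f = f q" using insert.IH[OF F] by blast
    let ?ev = "\<lambda>f\<in>lin_maps R M E. f q"
    have ev: "?ev \<in> lin_maps R ?H E" by (rule evaluation_lin_map[OF M E q(1)])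
    define G' where "G' = G \<ominus>\<^bsub>Hom_module R ?H E\<^esub> ?ev"
    have G': "G' \<in> lin_maps R ?H E" unfolding G'_def by (rule Hom_module_diff_closed[OF H E G ev])
    have G'a: "G' f = G f \<ominus>\<^bsub>E\<^esub> f q" if "f \<in> lin_maps R M E" for f
      using Hom_module_diff_apply[OF H E G ev, of f] that by (simp add: G'_def)
    have G'F: "G' f = \<zero>\<^bsub>E\<^esub>" if "f \<in> F" for f
      using G'a[of f] F q(2)[OF that] that lin_mapsD(1)[of f R M E q] q(1)
      by (auto simp: E.M.minus_eq_zero_iff)
    define K where "K = {x \<in> carrier M. \<forall>g\<in>F. g x = \<zero>\<^bsub>E\<^esub>}"
    have KM: "x \<in> carrier M" if "x \<in> K" for x using that by (simp add: K_def)
    have K: "submodule K R M" unfolding K_def by (rule common_kernel_submodule[OF M E F])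
    note Kadd = M.submoduleE(5)[OF K] and Kmul = M.submoduleE(4)[OF K]
    have N: "submodule (f0 ` K) R E" by (rule image_submodule[OF M E f0 K])
    have G'f0: "G' f0 \<in> carrier E" using lin_mapsD(1)[OF G', of f0] f0 by simp
    \<comment> \<open>If no point of \<open>K\<close> fits, some endomorphism of \<open>E\<close>,
      that is a scalar \<open>r\<close>, kills the image of \<open>K\<close> under \<open>f0\<close>
      but sends \<open>G' f0\<close> to \<open>e\<^sub>0\<close>. Then \<open>r f0\<close> vanishes
      on \<open>K\<close>, so \<open>G'\<close> kills it, against
      \<open>r (G' f0) = e\<^sub>0\<close>.\<close>
    have "G' f0 \<in> f0 ` K"
    proof (rule ccontr)
      assume "G' f0 \<notin> f0 ` K"
      then obtain h where h: "h \<in> lin_maps R E E" "\<And>y. y \<in> f0 ` K \<Longrightarrow> h y = \<zero>\<^bsub>E\<^esub>" "h (G' f0) = e\<^sub>0"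
        by (rule separate_submodule[OF E N G'f0]) (rule that)
      from mult[OF h(1)] obtain r where r: "r \<in> carrier R" "\<And>x. x \<in> carrier E \<Longrightarrow> h x = r \<odot>\<^bsub>E\<^esub> x" by blast
      let ?rf0 = "r \<odot>\<^bsub>?H\<^esub> f0"
      have rf0: "?rf0 \<in> lin_maps R M E" using lin_maps_smult[OF M E f0 r(1)] by simp
      have "G' ?rf0 = \<zero>\<^bsub>E\<^esub>"
      proof (rule vanishing_on_common_kernel[OF mult M G' insert.hyps(1) F rf0 _ G'F])
        fix x assume x: "x \<in> carrier M" "\<forall>g\<in>F. g x = \<zero>\<^bsub>E\<^esub>"
        then have "f0 x \<in> f0 ` K" by (simp add: K_def)
        then show "?rf0 x = \<zero>\<^bsub>E\<^esub>" using h(2)[of "f0 x"] r(2)[OF lin_mapsD(1)[OF f0 x(1)]] x(1) by simp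
      qed
      moreover have "G' ?rf0 = e\<^sub>0" using lin_mapsD(3)[OF G' r(1), of f0] f0 h(3) r(2)[OF G'f0] by simp
      ultimately show False using e0_nonzero by simp
    qed
    then obtain z where z: "z \<in> K" "G' f0 = f0 z" by blast
    have zM: "z \<in> carrier M" using KM[OF z(1)] .
    have "G f = f (q \<oplus>\<^bsub>M\<^esub> z)" if "f \<in> insert f0 F" for f
    proof -
      have f: "f \<in> lin_maps R M E" using that insert.prems by auto
      have "G' f = f z" using z G'F that by (auto simp: K_def)
      then have "G f \<ominus>\<^bsub>E\<^esub> f q = f z" using G'a[OF f] by simp
      moreover have "G f \<in> carrier E" "f q \<in> carrier E" "f z \<in> carrier E"
        using lin_mapsD(1)[OF G, of f] lin_mapsD(1)[OF f] f q(1) zM by auto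
      ultimately have "G f = f q \<oplus>\<^bsub>E\<^esub> f z"
        by (metis E.M.minus_eq E.M.a_comm E.M.a_inv_closed E.M.r_neg1 E.M.a_lcomm E.M.r_neg E.M.r_zero)
      then show ?thesis using lin_mapsD(2)[OF f q(1) zM] by simp
    qed
    then show ?case using q(1) zM by blast
  }
qed

end


section \<open>The field of fractions in dimension at most one\<close>

lemma (in abelian_group) minus_eq_imp_eq_add:
  assumes "x \<in> carrier G" "y \<in> carrier G" "x \<ominus> y = z"
  shows "x = y \<oplus> z"
  unfolding assms(3)[symmetric] using assms(1,2) by (simp add: minus_eq a_lcomm r_neg)

lemma (in cring) cgenideal_iff:
  assumes "a \<in> carrier R"
  shows "x \<in> PIdl a \<longleftrightarrow> (\<exists>r\<in>carrier R. x = a \<otimes> r)"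
  unfolding cgenideal_def using assms by (auto intro: m_comm exI)

locale fraction_domain = noetherian_domain R
  for R :: "('a, 'r) ring_scheme" (structure) +
  fixes Q :: "('q, 's) ring_scheme" and \<phi> :: "'a \<Rightarrow> 'q"
  assumes fractions: "fraction_field R Q \<phi>"
begin

sublocale Q: field Q using fractions by (simp add: fraction_field_def)

sublocale \<phi>: ring_hom_cring R Q \<phi>
  using fractions by unfold_locales (auto simp: fraction_field_def)

abbreviation QM :: "('a, 'q) module"
  where "QM \<equiv> restrict_scalars \<phi> Q"

lemma QM_simps [simp]:
  "carrier QM = carrier Q" "\<zero>\<^bsub>QM\<^esub> = \<zero>\<^bsub>Q\<^esub>"
  "x \<oplus>\<^bsub>QM\<^esub> y = x \<oplus>\<^bsub>Q\<^esub> y" "a \<odot>\<^bsub>QM\<^esub> x = \<phi> a \<otimes>\<^bsub>Q\<^esub> x"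
  by (auto simp: restrict_scalars_def)

lemma QM_module: "module R QM"
proof (rule moduleI)
  show "abelian_group QM"
    by (rule abelian_groupI) (auto simp: Q.a_ac intro: bexI[of _ "\<ominus>\<^bsub>Q\<^esub> _"] Q.l_neg)
qed (auto simp: Q.l_distr Q.r_distr Q.m_assoc is_cring)

sublocale QM: module R QM by (rule QM_module)

lemma phi_inj: "a \<in> carrier R \<Longrightarrow> b \<in> carrier R \<Longrightarrow> \<phi> a = \<phi> b \<longleftrightarrow> a = b"
  using fractions by (auto simp: fraction_field_def inj_on_def)

lemma phi_zero_iff: "a \<in> carrier R \<Longrightarrow> \<phi> a = \<zero>\<^bsub>Q\<^esub> \<longleftrightarrow> a = \<zero>"
  using phi_inj[of a \<zero>] by simp

lemma denominator:
  assumes "x \<in> carrier Q"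
  obtains a b where "a \<in> carrier R" "b \<in> carrier R" "b \<noteq> \<zero>" "\<phi> b \<otimes>\<^bsub>Q\<^esub> x = \<phi> a"
proof -
  obtain a b where ab: "a \<in> carrier R" "b \<in> carrier R" "b \<noteq> \<zero>" "x = \<phi> a \<otimes>\<^bsub>Q\<^esub> inv\<^bsub>Q\<^esub> (\<phi> b)"
    using fractions assms unfolding fraction_field_def by blast
  have "\<phi> b \<in> Units Q" using ab phi_zero_iff by (simp add: Q.field_Units)
  then have "\<phi> b \<otimes>\<^bsub>Q\<^esub> x = \<phi> a" using ab(1,2) unfolding ab(4)
    by (metis Q.Units_inv_closed Q.m_lcomm Q.Units_r_inv Q.r_one \<phi>.hom_closed)
  then show thesis using that ab by blast
qed

lemma phi_lcancel:
  assumes "a \<in> carrier R" "a \<noteq> \<zero>" "x \<in> carrier Q" "y \<in> carrier Q"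
  shows "\<phi> a \<otimes>\<^bsub>Q\<^esub> x = \<phi> a \<otimes>\<^bsub>Q\<^esub> y \<longleftrightarrow> x = y"
  using assms phi_zero_iff Q.m_lcancel[of "\<phi> a" x y] by simp

lemma image_submodule_QM: "submodule (\<phi> ` carrier R) R QM"
proof (rule QM.submoduleI')
  show "\<zero>\<^bsub>QM\<^esub> \<in> \<phi> ` carrier R" using \<phi>.hom_zero zero_closed by (metis QM_simps(2) image_eqI)
next
  fix x y assume "x \<in> \<phi> ` carrier R" "y \<in> \<phi> ` carrier R"
  then obtain a b where "a \<in> carrier R" "b \<in> carrier R" "x = \<phi> a" "y = \<phi> b" by blast
  then have "x \<oplus>\<^bsub>QM\<^esub> y = \<phi> (a \<oplus> b)" "a \<oplus> b \<in> carrier R" by auto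
  then show "x \<oplus>\<^bsub>QM\<^esub> y \<in> \<phi> ` carrier R" by blast
next
  fix a x assume "a \<in> carrier R" "x \<in> \<phi> ` carrier R"
  then obtain b where "a \<in> carrier R" "b \<in> carrier R" "x = \<phi> b" by blast
  then have "a \<odot>\<^bsub>QM\<^esub> x = \<phi> (a \<otimes> b)" "a \<otimes> b \<in> carrier R" by auto
  then show "a \<odot>\<^bsub>QM\<^esub> x \<in> \<phi> ` carrier R" by blast
qed auto

lemma zero_submodule_QM: "submodule {\<zero>\<^bsub>Q\<^esub>} R QM"
  by (rule QM.submoduleI') auto

lemma lin_map_phi:
  assumes "f \<in> lin_maps R QM M" "r \<in> carrier R"
  shows "f (\<phi> r) = r \<odot>\<^bsub>M\<^esub> f \<one>\<^bsub>Q\<^esub>"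
  using lin_mapsD(3)[OF assms, of "\<one>\<^bsub>Q\<^esub>"] assms(2) by simp

text \<open>As \<open>Q\<close> is torsion-free, no scalar condition obstructs sending
  \<open>1\<close> to \<open>e\<close>. This recovers the elements of \<open>M\<close> from
  \<open>Hom(Q, M)\<close>; moreover, the value of such a map at \<open>1 / r\<close> divides
  \<open>e\<close> by \<open>r\<close>.\<close>

lemma injective_value_at_one:
  assumes "injective_module TYPE('a) R M" "e \<in> carrier M"
  obtains f where "f \<in> lin_maps R QM M" "f \<one>\<^bsub>Q\<^esub> = e"
proof -
  interpret M: module R M using assms(1) by (simp add: injective_module_def)
  show thesis
  proof (rule injective_extend_cyclic[OF assms(1) QM_module zero_submodule_QM _ assms(2)])
    fix r assume "r \<in> carrier R" "r \<odot>\<^bsub>QM\<^esub> \<one>\<^bsub>Q\<^esub> \<in> {\<zero>\<^bsub>Q\<^esub>}"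
    then show "r \<odot>\<^bsub>M\<^esub> e = \<zero>\<^bsub>M\<^esub>" using phi_zero_iff assms(2) by simp
  qed (use that in auto)
qed

text \<open>The usual proof that a maximal annihilator is prime, applied to \<open>Q / R\<close>.
  Only multiples of \<open>x\<close> compete, so the prime occurs at a multiple of the given
  \<open>x\<close>; this is what makes the socle of \<open>Q / R\<close> essential once
  \<open>m\<close> is the only possible prime.\<close>

lemma associated_prime:
  assumes x: "x \<in> carrier Q" "x \<notin> \<phi> ` carrier R"
  obtains r where "r \<in> carrier R" "\<phi> r \<otimes>\<^bsub>Q\<^esub> x \<notin> \<phi> ` carrier R"
    "primeideal {a \<in> carrier R. \<phi> a \<otimes>\<^bsub>Q\<^esub> (\<phi> r \<otimes>\<^bsub>Q\<^esub> x) \<in> \<phi> ` carrier R} R"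
proof -
  define C where "C z = {a \<in> carrier R. \<phi> a \<otimes>\<^bsub>Q\<^esub> z \<in> \<phi> ` carrier R}" for z
  have Cid: "ideal (C z) R" if "z \<in> carrier Q" for z
    using QM.colon_ideal[OF image_submodule_QM, of z] that by (simp add: C_def)
  let ?Z = "{\<phi> r \<otimes>\<^bsub>Q\<^esub> x | r. r \<in> carrier R \<and> \<phi> r \<otimes>\<^bsub>Q\<^esub> x \<notin> \<phi> ` carrier R}"
  have "x \<in> ?Z" using x by (intro CollectI exI[of _ \<one>]) simp
  then have ne: "C ` ?Z \<noteq> {}" by blast
  obtain P where P: "P \<in> C ` ?Z" "\<And>J. J \<in> C ` ?Z \<Longrightarrow> P \<subseteq> J \<Longrightarrow> J = P"
  proof (rule ex_maximal_ideal_in[OF ne])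
    fix I assume "I \<in> C ` ?Z"
    then show "ideal I R" using Cid x(1) by auto
  qed (rule that)
  obtain r where r: "r \<in> carrier R" "\<phi> r \<otimes>\<^bsub>Q\<^esub> x \<notin> \<phi> ` carrier R" "P = C (\<phi> r \<otimes>\<^bsub>Q\<^esub> x)" using P(1) by blast
  let ?z = "\<phi> r \<otimes>\<^bsub>Q\<^esub> x"
  have z: "?z \<in> carrier Q" using r x by simp
  have "primeideal P R"
  proof (rule primeidealI)
    show "ideal P R" using Cid[OF z] r(3) by simp
    have "\<one> \<notin> P" using r(2) z by (simp add: r(3) C_def)
    then show "carrier R \<noteq> P" by auto
    fix a b assume ab: "a \<in> carrier R" "b \<in> carrier R" "a \<otimes> b \<in> P"
    show "a \<in> P \<or> b \<in> P"
    proof (rule disjCI, rule ccontr)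
      assume "b \<notin> P" "a \<notin> P"
      have eq: "\<phi> a \<otimes>\<^bsub>Q\<^esub> ?z = \<phi> (a \<otimes> r) \<otimes>\<^bsub>Q\<^esub> x" using ab r x by (simp add: Q.m_assoc)
      moreover have "\<phi> a \<otimes>\<^bsub>Q\<^esub> ?z \<notin> \<phi> ` carrier R" using \<open>a \<notin> P\<close> ab(1) by (simp add: r(3) C_def)
      ultimately have "\<phi> (a \<otimes> r) \<otimes>\<^bsub>Q\<^esub> x \<notin> \<phi> ` carrier R" by argo
      with m_closed[OF ab(1) r(1)] have "\<phi> (a \<otimes> r) \<otimes>\<^bsub>Q\<^esub> x \<in> ?Z" by blast
      then have "\<phi> a \<otimes>\<^bsub>Q\<^esub> ?z \<in> ?Z" unfolding eq .
      moreover have "P \<subseteq> C (\<phi> a \<otimes>\<^bsub>Q\<^esub> ?z)"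
      proof
        fix c assume "c \<in> P"
        then have c: "c \<in> carrier R" "\<phi> c \<otimes>\<^bsub>Q\<^esub> ?z \<in> \<phi> ` carrier R" by (auto simp: r(3) C_def)
        have "\<phi> c \<otimes>\<^bsub>Q\<^esub> (\<phi> a \<otimes>\<^bsub>Q\<^esub> ?z) = a \<odot>\<^bsub>QM\<^esub> (\<phi> c \<otimes>\<^bsub>Q\<^esub> ?z)"
          using c ab(1) z by (simp only: QM_simps) (simp add: Q.m_lcomm)
        then show "c \<in> C (\<phi> a \<otimes>\<^bsub>Q\<^esub> ?z)"
          using c QM.submoduleE(4)[OF image_submodule_QM ab(1) c(2)] unfolding C_def by auto
      qed
      ultimately have "C (\<phi> a \<otimes>\<^bsub>Q\<^esub> ?z) = P" using P(2) by blast
      moreover have "b \<in> C (\<phi> a \<otimes>\<^bsub>Q\<^esub> ?z)"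
      proof -
        have "\<phi> b \<otimes>\<^bsub>Q\<^esub> (\<phi> a \<otimes>\<^bsub>Q\<^esub> ?z) = \<phi> (a \<otimes> b) \<otimes>\<^bsub>Q\<^esub> ?z"
          using ab z by (simp add: Q.m_assoc Q.m_lcomm)
        then show ?thesis using ab unfolding C_def r(3) by simp
      qed
      ultimately show False using \<open>b \<notin> P\<close> by simp
    qed
  qed (rule is_cring)
  then show thesis using that[OF r(1,2)] by (simp add: r(3) C_def)
qed

end

locale fraction_residue_hull = local_residue_hull R E m e\<^sub>0 + fraction_domain R Q \<phi>
  for R :: "('a, 'r) ring_scheme" (structure) and E :: "('a, 'e) module" and m e\<^sub>0
    and Q :: "('q, 's) ring_scheme" and \<phi>
begin

text \<open>The classes in \<open>Q / R\<close> killed by \<open>m\<close> form a finite-dimensional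
  space: as \<open>a \<in> m\<close>, division by \<open>a\<close> identifies them with the socle of
  \<open>R / a R\<close>, and \<open>R\<close> is Noetherian. The maps in \<open>F\<close> serve as
  coordinates on it.\<close>

lemma socle_coordinates:
  assumes a: "a \<in> m" "a \<noteq> \<zero>"
  shows "\<exists>F. finite F \<and> F \<subseteq> lin_maps R QM E \<and>
    (\<forall>x\<in>carrier Q. (\<forall>c\<in>m. \<phi> c \<otimes>\<^bsub>Q\<^esub> x \<in> \<phi> ` carrier R) \<longrightarrow> (\<forall>f\<in>F. f x = \<zero>\<^bsub>E\<^esub>) \<longrightarrow> x \<in> \<phi> ` carrier R)"
proof -
  have aR: "a \<in> carrier R" using a m.Icarr by simp
  have aU: "\<phi> a \<in> Units Q" using aR a(2) phi_zero_iff by (simp add: Q.field_Units)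
  define d where "d x = inv\<^bsub>Q\<^esub> (\<phi> a) \<otimes>\<^bsub>Q\<^esub> \<phi> x" for x
  have dQ: "d x \<in> carrier Q" if "x \<in> carrier R" for x using that aU by (simp add: d_def)
  have ad: "\<phi> a \<otimes>\<^bsub>Q\<^esub> d x = \<phi> x" if "x \<in> carrier R" for x
    using that aU aR by (simp add: d_def Q.m_assoc[symmetric])
  have da: "d (a \<otimes> x) = \<phi> x" if "x \<in> carrier R" for x
    using that aU aR by (simp add: d_def Q.m_assoc[symmetric])
  have dadd: "d (x \<oplus> y) = d x \<oplus>\<^bsub>Q\<^esub> d y" if "x \<in> carrier R" "y \<in> carrier R" for x y
    using that aU by (simp add: d_def Q.r_distr)
  have dmul: "d (c \<otimes> x) = \<phi> c \<otimes>\<^bsub>Q\<^esub> d x" if "c \<in> carrier R" "x \<in> carrier R" for c x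
    using that aU by (simp add: d_def Q.m_lcomm)
  have dinj: "d x = d y \<longleftrightarrow> x = y" if "x \<in> carrier R" "y \<in> carrier R" for x y
    using that ad phi_inj by metis
  \<comment> \<open>In place of a dimension count: \<open>good\<close> describes a part of the socle
    of \<open>R / a R\<close> on which finitely many maps have trivial common kernel. The zero part
    \<open>PIdl a\<close> is a starting point, and a maximal good ideal turns out to be the whole
    socle.\<close>
  define good where "good I \<longleftrightarrow> ideal I R \<and> PIdl a \<subseteq> I \<and> (\<forall>x\<in>I. \<forall>c\<in>m. c \<otimes> x \<in> PIdl a) \<and>
    (\<exists>F. finite F \<and> F \<subseteq> lin_maps R QM E \<and>
      (\<forall>x\<in>I. (\<forall>f\<in>F. f (d x) = \<zero>\<^bsub>E\<^esub>) \<longrightarrow> x \<in> PIdl a))" for I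
  interpret A: ideal "PIdl a" R by (rule cgenideal_ideal[OF aR])
  have "good (PIdl a)"
    unfolding good_def
  proof (intro conjI ballI)
    fix x c assume "x \<in> PIdl a" "c \<in> m"
    then show "c \<otimes> x \<in> PIdl a" using A.I_l_closed m.Icarr by simp
  next
    show "\<exists>F. finite F \<and> F \<subseteq> lin_maps R QM E \<and>
      (\<forall>x\<in>PIdl a. (\<forall>f\<in>F. f (d x) = \<zero>\<^bsub>E\<^esub>) \<longrightarrow> x \<in> PIdl a)"
      by (rule exI[of _ "{}"]) simp
  qed (use A.ideal_axioms in simp_all)
  then have ne: "Collect good \<noteq> {}" by auto
  obtain I where I: "good I" and max: "\<And>J. good J \<Longrightarrow> I \<subseteq> J \<Longrightarrow> J = I"
  proof (rule ex_maximal_ideal_in[OF ne])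
    fix J assume "J \<in> Collect good"
    then show "ideal J R" by (simp add: good_def)
  next
    fix I assume "I \<in> Collect good" "\<And>J. J \<in> Collect good \<Longrightarrow> I \<subseteq> J \<Longrightarrow> J = I"
    then show thesis using that by simp
  qed
  interpret I: ideal I R using I by (simp add: good_def)
  have aI: "PIdl a \<subseteq> I" and mI: "\<And>x c. x \<in> I \<Longrightarrow> c \<in> m \<Longrightarrow> c \<otimes> x \<in> PIdl a" using I by (auto simp: good_def)
  obtain F where F: "finite F" "F \<subseteq> lin_maps R QM E"
    "\<And>x. x \<in> I \<Longrightarrow> \<forall>f\<in>F. f (d x) = \<zero>\<^bsub>E\<^esub> \<Longrightarrow> x \<in> PIdl a"
  proof -
    have "\<exists>F. finite F \<and> F \<subseteq> lin_maps R QM E \<and>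
      (\<forall>x\<in>I. (\<forall>f\<in>F. f (d x) = \<zero>\<^bsub>E\<^esub>) \<longrightarrow> x \<in> PIdl a)" using I by (simp only: good_def)
    then obtain F where *: "finite F" "F \<subseteq> lin_maps R QM E"
      "\<forall>x\<in>I. (\<forall>f\<in>F. f (d x) = \<zero>\<^bsub>E\<^esub>) \<longrightarrow> x \<in> PIdl a" by (elim exE conjE)
    show thesis by (rule that[OF *(1,2) mp[OF bspec[OF *(3)]]])
  qed
  have socI: "s \<in> I" if s: "s \<in> carrier R" "\<And>c. c \<in> m \<Longrightarrow> c \<otimes> s \<in> PIdl a" for s
  proof (rule ccontr)
    assume sI: "s \<notin> I"
    let ?J = "{x \<oplus> r \<otimes> s | x r. x \<in> I \<and> r \<in> carrier R}"
    have JI: "x \<oplus> r \<otimes> s \<in> ?J" if "x \<in> I" "r \<in> carrier R" for x r using that by blast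
    have "submodule (d ` I) R QM"
    proof (rule QM.submoduleI')
      show "d ` I \<subseteq> carrier QM" using dQ I.Icarr by auto
      have "d \<zero> = \<zero>\<^bsub>Q\<^esub>" using aU by (simp add: d_def)
      then show "\<zero>\<^bsub>QM\<^esub> \<in> d ` I" using I.zero_closed by (metis QM_simps(2) image_eqI)
    next
      fix x y assume "x \<in> d ` I" "y \<in> d ` I"
      then obtain u v where uv: "u \<in> I" "v \<in> I" "x = d u" "y = d v" by blast
      then have "x \<oplus>\<^bsub>QM\<^esub> y = d (u \<oplus> v)" using dadd I.Icarr by simp
      then show "x \<oplus>\<^bsub>QM\<^esub> y \<in> d ` I" using uv by simp
    next
      fix c x assume c: "c \<in> carrier R" and "x \<in> d ` I"
      then obtain u where u: "u \<in> I" "x = d u" by blast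
      then have "c \<odot>\<^bsub>QM\<^esub> x = d (c \<otimes> u)" using dmul c I.Icarr by simp
      then show "c \<odot>\<^bsub>QM\<^esub> x \<in> d ` I" using u c I.I_l_closed by simp
    qed
    moreover have "d s \<notin> d ` I" using sI s(1) dinj I.Icarr by blast
    moreover have "d s \<in> carrier QM" using dQ s(1) by simp
    ultimately obtain f0 where f0: "f0 \<in> lin_maps R QM E" "\<And>y. y \<in> d ` I \<Longrightarrow> f0 y = \<zero>\<^bsub>E\<^esub>" "f0 (d s) = e\<^sub>0"
      using separate_submodule[OF QM_module, of "d ` I" "d s" thesis] by blast
    have "good ?J"
      unfolding good_def
    proof (intro conjI ballI)
      show "ideal ?J R"
      proof (rule idealI')
        show "?J \<subseteq> carrier R" using I.Icarr s(1) by auto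
        show "\<zero> \<in> ?J" using JI[OF I.zero_closed zero_closed] s(1) by simp
      next
        fix x y assume "x \<in> ?J" "y \<in> ?J"
        then obtain u v r r' where *: "u \<in> I" "v \<in> I" "r \<in> carrier R" "r' \<in> carrier R"
          "x = u \<oplus> r \<otimes> s" "y = v \<oplus> r' \<otimes> s" by blast
        have "u \<in> carrier R" "v \<in> carrier R" using * I.Icarr by auto
        then have "x \<oplus> y = (u \<oplus> v) \<oplus> (r \<oplus> r') \<otimes> s"
          using *(3-6) s(1) by (simp add: l_distr a_ac)
        then show "x \<oplus> y \<in> ?J" using JI[of "u \<oplus> v" "r \<oplus> r'"] * by simp
      next
        fix c x assume c: "c \<in> carrier R" and "x \<in> ?J"
        then obtain u r where *: "u \<in> I" "r \<in> carrier R" "x = u \<oplus> r \<otimes> s" by blast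
        have "u \<in> carrier R" using * I.Icarr by auto
        then have "c \<otimes> x = c \<otimes> u \<oplus> (c \<otimes> r) \<otimes> s" using * c s(1) by (simp add: r_distr m_assoc)
        then show "c \<otimes> x \<in> ?J" using JI[of "c \<otimes> u" "c \<otimes> r"] * c I.I_l_closed by simp
      qed
      have IJ: "I \<subseteq> ?J"
      proof
        fix x assume "x \<in> I"
        then show "x \<in> ?J" using JI[of x \<zero>] I.Icarr s(1) by simp
      qed
      then show "PIdl a \<subseteq> ?J" using aI by blast
      fix x c assume "x \<in> ?J" and c: "c \<in> m"
      then obtain u r where *: "u \<in> I" "r \<in> carrier R" "x = u \<oplus> r \<otimes> s" by blast
      have "c \<otimes> x = c \<otimes> u \<oplus> r \<otimes> (c \<otimes> s)"
        using * I.Icarr m.Icarr[OF c] s(1) by (simp add: r_distr m_lcomm)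
      then show "c \<otimes> x \<in> PIdl a" using mI[OF *(1) c] s(2)[OF c] *(2) A.I_l_closed by simp
    next
      \<comment> \<open>On \<open>(u + r s) / a\<close> the new map \<open>f0\<close> takes the
        value \<open>r e\<^sub>0\<close>, so its vanishing means \<open>r \<in> m\<close>. In that
        case \<open>r s\<close> already lies in \<open>PIdl a\<close>, and the old maps
        decide.\<close>
      have "x \<in> PIdl a" if x: "x \<in> ?J" "\<forall>f\<in>insert f0 F. f (d x) = \<zero>\<^bsub>E\<^esub>" for x
      proof -
        from x(1) obtain u r where *: "u \<in> I" "r \<in> carrier R" "x = u \<oplus> r \<otimes> s" by blast
        have uR: "u \<in> carrier R" using * I.Icarr by simp
        have "f0 (d x) = f0 (d u) \<oplus>\<^bsub>E\<^esub> r \<odot>\<^bsub>E\<^esub> f0 (d s)"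
          using lin_mapsD(2)[OF f0(1), of "d u" "\<phi> r \<otimes>\<^bsub>Q\<^esub> d s"] lin_mapsD(3)[OF f0(1) *(2), of "d s"]
            * uR s(1) dQ by (simp add: dadd dmul)
        then have "r \<odot>\<^bsub>E\<^esub> e\<^sub>0 = \<zero>\<^bsub>E\<^esub>" using f0(2)[of "d u"] f0(3) *(1,2) x(2) by simp
        then have "r \<in> m" using e0_annihilator *(2) by simp
        then have "r \<otimes> s \<in> I" using s(2) aI by blast
        then have "x \<in> I" using * by simp
        then show ?thesis using F(3) x(2) by blast
      qed
      then show "\<exists>F. finite F \<and> F \<subseteq> lin_maps R QM E \<and>
        (\<forall>x\<in>?J. (\<forall>f\<in>F. f (d x) = \<zero>\<^bsub>E\<^esub>) \<longrightarrow> x \<in> PIdl a)"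
        using F(1,2) f0(1) by (intro exI[of _ "insert f0 F"]) auto
    qed
    moreover have "I \<subseteq> ?J"
    proof
      fix x assume "x \<in> I"
      then show "x \<in> ?J" using JI[of x \<zero>] I.Icarr s(1) by simp
    qed
    ultimately have "?J = I" by (rule max)
    moreover have "s \<in> ?J" using JI[of \<zero> \<one>] s(1) by simp
    ultimately show False using sI by simp
  qed
  show ?thesis
  proof (intro exI[of _ F] conjI ballI impI)
    fix x assume x: "x \<in> carrier Q" "\<forall>c\<in>m. \<phi> c \<otimes>\<^bsub>Q\<^esub> x \<in> \<phi> ` carrier R" "\<forall>f\<in>F. f x = \<zero>\<^bsub>E\<^esub>"
    then obtain s where s: "s \<in> carrier R" "\<phi> a \<otimes>\<^bsub>Q\<^esub> x = \<phi> s" using a(1) by auto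
    have xd: "x = d s" using ad[OF s(1)] s(2) phi_lcancel[OF aR a(2) x(1) dQ[OF s(1)]] by simp
    have "c \<otimes> s \<in> PIdl a" if c: "c \<in> m" for c
    proof -
      obtain r where r: "r \<in> carrier R" "\<phi> c \<otimes>\<^bsub>Q\<^esub> x = \<phi> r" using x(2) c by auto
      have cR: "c \<in> carrier R" using c m.Icarr by simp
      have "d (c \<otimes> s) = d (a \<otimes> r)" using dmul[OF cR s(1)] da[OF r(1)] r(2) xd by simp
      then have "c \<otimes> s = a \<otimes> r" using dinj cR s(1) aR r(1) by simp
      then show ?thesis using r(1) cgenideal_iff[OF aR] by blast
    qed
    then have "s \<in> I" using socI s(1) by blast
    then have "s \<in> PIdl a" using F(3) x(3) xd by simp
    then obtain r where "r \<in> carrier R" "s = a \<otimes> r" using cgenideal_iff[OF aR] by blast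
    then show "x \<in> \<phi> ` carrier R" using xd da[of r] by simp
  qed (use F in auto)
qed

lemma reflexive_if_dim_le_one:
  assumes mult: "\<And>h. h \<in> lin_maps R E E \<Longrightarrow> \<exists>r\<in>carrier R. \<forall>x\<in>carrier E. h x = r \<odot>\<^bsub>E\<^esub> x"
    and prime: "\<And>P. primeideal P R \<Longrightarrow> P \<noteq> {\<zero>} \<Longrightarrow> P = m"
  shows "reflexive_wrt R E QM"
proof (rule reflexive_wrtI[OF QM_module E.module_axioms])
  fix x assume x: "x \<in> carrier QM" "x \<noteq> \<zero>\<^bsub>QM\<^esub>"
  have "\<exists>f. f \<in> lin_maps R QM E \<and> f x = e\<^sub>0"
    by (rule separate_submodule[OF QM_module zero_submodule_QM, of x]) (use x in auto)
  then show "\<exists>f\<in>lin_maps R QM E. f x \<noteq> \<zero>\<^bsub>E\<^esub>" using e0_nonzero by blast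
next
  note E = E.module_axioms
  let ?H = "Hom_module R QM E"
  have H: "module R ?H" by (rule Hom_module_is_module[OF QM_module E])
  fix G assume G: "G \<in> lin_maps R ?H E"
  \<comment> \<open>The colon ideal of an element of \<open>Q\<close> contains a denominator, so it
    is not zero. An associated prime of \<open>Q / R\<close> is therefore \<open>m\<close>, and some
    multiple of \<open>x\<close> represents a nonzero socle element.\<close>
  have soc: "\<exists>r\<in>carrier R. \<phi> r \<otimes>\<^bsub>Q\<^esub> x \<notin> \<phi> ` carrier R \<and> (\<forall>c\<in>m. \<phi> c \<otimes>\<^bsub>Q\<^esub> (\<phi> r \<otimes>\<^bsub>Q\<^esub> x) \<in> \<phi> ` carrier R)"
    if x: "x \<in> carrier Q" "x \<notin> \<phi> ` carrier R" for x
  proof -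
    obtain r where r: "r \<in> carrier R" "\<phi> r \<otimes>\<^bsub>Q\<^esub> x \<notin> \<phi> ` carrier R"
      "primeideal {a \<in> carrier R. \<phi> a \<otimes>\<^bsub>Q\<^esub> (\<phi> r \<otimes>\<^bsub>Q\<^esub> x) \<in> \<phi> ` carrier R} R"
      by (rule associated_prime[OF x])
    have "\<phi> r \<otimes>\<^bsub>Q\<^esub> x \<in> carrier Q" using r(1) x(1) by simp
    then obtain a b where ab: "a \<in> carrier R" "b \<in> carrier R" "b \<noteq> \<zero>" "\<phi> b \<otimes>\<^bsub>Q\<^esub> (\<phi> r \<otimes>\<^bsub>Q\<^esub> x) = \<phi> a"
      by (rule denominator)
    then have "b \<in> {a \<in> carrier R. \<phi> a \<otimes>\<^bsub>Q\<^esub> (\<phi> r \<otimes>\<^bsub>Q\<^esub> x) \<in> \<phi> ` carrier R}" by simp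
    then have "{a \<in> carrier R. \<phi> a \<otimes>\<^bsub>Q\<^esub> (\<phi> r \<otimes>\<^bsub>Q\<^esub> x) \<in> \<phi> ` carrier R} = m"
      using prime[OF r(3)] ab(3) by blast
    then show ?thesis using r(1,2) by blast
  qed
  obtain F where F: "finite F" "F \<subseteq> lin_maps R QM E"
    "\<And>x. x \<in> carrier Q \<Longrightarrow> \<forall>f\<in>F. f x = \<zero>\<^bsub>E\<^esub> \<Longrightarrow> x \<in> \<phi> ` carrier R"
  proof (cases "m = {\<zero>}")
    \<comment> \<open>Then \<open>R\<close> is a field and \<open>\<phi>\<close> is onto, so the
      empty set of maps serves as \<open>F\<close>. The other case has a nonzero element of
      \<open>m\<close> to divide by.\<close>
    case True
    have "x \<in> \<phi> ` carrier R" if x: "x \<in> carrier Q" for x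
    proof -
      obtain a b where ab: "a \<in> carrier R" "b \<in> carrier R" "b \<noteq> \<zero>" "\<phi> b \<otimes>\<^bsub>Q\<^esub> x = \<phi> a"
        by (rule denominator[OF x])
      then obtain u where u: "u \<in> carrier R" "u \<otimes> b \<ominus> \<one> \<in> m" using unit_mod_maximal[OF maximal, of b] True by blast
      then have "u \<otimes> b = \<one>" using True minus_eq_zero_iff[of "u \<otimes> b" \<one>] ab by simp
      then have "\<phi> (u \<otimes> b) = \<one>\<^bsub>Q\<^esub>" by simp
      then have "\<phi> (u \<otimes> a) = x" using ab u x
        by (simp add: ab(4)[symmetric] Q.m_assoc[symmetric])
      then show ?thesis using u(1) ab(1) by blast
    qed
    then show thesis using that[of "{}"] by blast
  next
    case False
    then obtain a where a: "a \<in> m" "a \<noteq> \<zero>" using m.zero_closed by blast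
    from socle_coordinates[OF a] obtain F where F: "finite F" "F \<subseteq> lin_maps R QM E"
      "\<forall>x\<in>carrier Q. (\<forall>c\<in>m. \<phi> c \<otimes>\<^bsub>Q\<^esub> x \<in> \<phi> ` carrier R) \<longrightarrow> (\<forall>f\<in>F. f x = \<zero>\<^bsub>E\<^esub>) \<longrightarrow> x \<in> \<phi> ` carrier R"
      by (elim exE conjE)
    have "x \<in> \<phi> ` carrier R" if x: "x \<in> carrier Q" "\<forall>f\<in>F. f x = \<zero>\<^bsub>E\<^esub>" for x
    proof (rule ccontr)
      assume "x \<notin> \<phi> ` carrier R"
      from soc[OF x(1) this] obtain r where r: "r \<in> carrier R" "\<phi> r \<otimes>\<^bsub>Q\<^esub> x \<notin> \<phi> ` carrier R"
        "\<forall>c\<in>m. \<phi> c \<otimes>\<^bsub>Q\<^esub> (\<phi> r \<otimes>\<^bsub>Q\<^esub> x) \<in> \<phi> ` carrier R" by blast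
      have "f (\<phi> r \<otimes>\<^bsub>Q\<^esub> x) = \<zero>\<^bsub>E\<^esub>" if f: "f \<in> F" for f
      proof -
        have "f x = \<zero>\<^bsub>E\<^esub>" using f x(2) by blast
        then show ?thesis using lin_mapsD(3)[OF subsetD[OF F(2) f] r(1), of x] x(1) r(1) by simp
      qed
      then show False using bspec[OF F(3), of "\<phi> r \<otimes>\<^bsub>Q\<^esub> x"] r x(1) by auto
    qed
    then show thesis using that[OF F(1,2)] by blast
  qed
  obtain q0 where q0: "q0 \<in> carrier Q" "\<And>f. f \<in> F \<Longrightarrow> G f = f q0"
    using finite_interpolation[OF mult QM_module G F(1,2)] unfolding QM_simps by blast
  \<comment> \<open>Interpolation on \<open>insert f F\<close> gives a point \<open>q\<close> that
    depends on \<open>f\<close>; but it agrees with \<open>q0\<close> on \<open>F\<close>, so it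
    differs from \<open>q0\<close> by an element of \<open>R\<close>, where \<open>f\<close>
    vanishes.\<close>
  have G0: "G f = f q0" if f: "f \<in> lin_maps R QM E" "\<And>r. r \<in> carrier R \<Longrightarrow> f (\<phi> r) = \<zero>\<^bsub>E\<^esub>" for f
  proof -
    obtain q where q: "q \<in> carrier Q" "\<And>g. g \<in> insert f F \<Longrightarrow> G g = g q"
    proof -
      have "finite (insert f F)" "insert f F \<subseteq> lin_maps R QM E" using F(1,2) f(1) by auto
      from finite_interpolation[OF mult QM_module G this] show thesis
        unfolding QM_simps using that by blast
    qed
    have diff: "g (q \<ominus>\<^bsub>QM\<^esub> q0) = g q \<ominus>\<^bsub>E\<^esub> g q0" if "g \<in> lin_maps R QM E" for g
      using lin_maps_diff[OF QM_module E that, of q q0] q q0 by simp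
    have gE: "g q \<in> carrier E" "g q0 \<in> carrier E" if "g \<in> lin_maps R QM E" for g
      using lin_mapsD(1)[OF that] q(1) q0(1) by auto
    have "g (q \<ominus>\<^bsub>QM\<^esub> q0) = \<zero>\<^bsub>E\<^esub>" if g: "g \<in> F" for g
    proof -
      have gH: "g \<in> lin_maps R QM E" using g F(2) by blast
      have "g q = g q0" using q(2)[of g] q0(2)[OF g] g by simp
      then show ?thesis using diff[OF gH] gE[OF gH] by (simp add: E.M.minus_eq E.M.r_neg)
    qed
    moreover have "q \<ominus>\<^bsub>QM\<^esub> q0 \<in> carrier Q" using q(1) q0(1) QM.M.minus_closed[of q q0] by simp
    ultimately obtain r where "r \<in> carrier R" "q \<ominus>\<^bsub>QM\<^esub> q0 = \<phi> r" using F(3) by blast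
    then have "f (q \<ominus>\<^bsub>QM\<^esub> q0) = \<zero>\<^bsub>E\<^esub>" using f(2) by simp
    then have "f q = f q0" using diff[OF f(1)] gE[OF f(1)] E.M.minus_eq_zero_iff by simp
    then show ?thesis using q(2)[of f] by simp
  qed
  let ?ev = "\<lambda>f\<in>lin_maps R QM E. f q0"
  have ev: "?ev \<in> lin_maps R ?H E" using evaluation_lin_map[OF QM_module E] q0(1) by simp
  define G' where "G' = G \<ominus>\<^bsub>Hom_module R ?H E\<^esub> ?ev"
  have G': "G' \<in> lin_maps R ?H E" unfolding G'_def by (rule Hom_module_diff_closed[OF H E G ev])
  have G'a: "G' f = G f \<ominus>\<^bsub>E\<^esub> f q0" if "f \<in> lin_maps R QM E" for f
    using Hom_module_diff_apply[OF H E G ev, of f] that by (simp add: G'_def)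
  \<comment> \<open>Maps that agree at \<open>1\<close> agree on \<open>R\<close>, so
    \<open>G0\<close> applies to their difference: \<open>G'\<close> factors through the evaluation
    at \<open>1\<close>.\<close>
  have G'_cong: "G' f = G' g" if fg: "f \<in> lin_maps R QM E" "g \<in> lin_maps R QM E" "f \<one>\<^bsub>Q\<^esub> = g \<one>\<^bsub>Q\<^esub>" for f g
  proof -
    let ?d = "f \<ominus>\<^bsub>?H\<^esub> g"
    have d: "?d \<in> lin_maps R QM E" by (rule Hom_module_diff_closed[OF QM_module E fg(1,2)])
    have "?d (\<phi> r) = \<zero>\<^bsub>E\<^esub>" if "r \<in> carrier R" for r
    proof -
      have "f (\<phi> r) = g (\<phi> r)" using lin_map_phi[OF fg(1) that] lin_map_phi[OF fg(2) that] fg(3) by simp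
      then show ?thesis
        using Hom_module_diff_apply[OF QM_module E fg(1,2), of "\<phi> r"] that lin_mapsD(1)[OF fg(2), of "\<phi> r"]
        by (simp add: E.M.minus_eq E.M.r_neg)
    qed
    then have "G ?d = ?d q0" by (rule G0[OF d])
    then have "G' ?d = \<zero>\<^bsub>E\<^esub>" using G'a[OF d] lin_mapsD(1)[OF d, of q0] q0(1) by (simp add: E.M.minus_eq E.M.r_neg)
    then show ?thesis
      using lin_maps_diff[OF H E G', of f g] fg(1,2) lin_mapsD(1)[OF G', of f] lin_mapsD(1)[OF G', of g]
        E.M.minus_eq_zero_iff by simp
  qed
  \<comment> \<open>The choice of \<open>lift\<close> need not be linear; by \<open>G'_cong\<close>
    its composition with \<open>G'\<close> is.\<close>
  have "\<exists>f. f \<in> lin_maps R QM E \<and> f \<one>\<^bsub>Q\<^esub> = e" if "e \<in> carrier E" for e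
    using injective_value_at_one[OF injective that] by blast
  then obtain lift where lift: "\<And>e. e \<in> carrier E \<Longrightarrow> lift e \<in> lin_maps R QM E"
    "\<And>e. e \<in> carrier E \<Longrightarrow> lift e \<one>\<^bsub>Q\<^esub> = e" by metis
  have "(\<lambda>e\<in>carrier E. G' (lift e)) \<in> lin_maps R E E"
  proof (rule lin_maps_restrictI[OF E])
    fix x assume "x \<in> carrier E"
    then show "G' (lift x) \<in> carrier E" using lin_mapsD(1)[OF G', of "lift x"] lift(1) by simp
  next
    fix x y assume xy: "x \<in> carrier E" "y \<in> carrier E"
    have s: "lift x \<oplus>\<^bsub>?H\<^esub> lift y \<in> lin_maps R QM E"
      using lin_maps_add[OF QM_module E lift(1)[OF xy(1)] lift(1)[OF xy(2)]] by simp
    have "G' (lift (x \<oplus>\<^bsub>E\<^esub> y)) = G' (lift x \<oplus>\<^bsub>?H\<^esub> lift y)"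
      by (rule G'_cong[OF lift(1) s]) (use xy lift(2) in auto)
    also have "\<dots> = G' (lift x) \<oplus>\<^bsub>E\<^esub> G' (lift y)"
      by (rule lin_mapsD(2)[OF G']) (use lift(1) xy in auto)
    finally show "G' (lift (x \<oplus>\<^bsub>E\<^esub> y)) = G' (lift x) \<oplus>\<^bsub>E\<^esub> G' (lift y)" .
  next
    fix a x assume ax: "a \<in> carrier R" "x \<in> carrier E"
    have s: "a \<odot>\<^bsub>?H\<^esub> lift x \<in> lin_maps R QM E"
      using lin_maps_smult[OF QM_module E lift(1)[OF ax(2)] ax(1)] by simp
    have "G' (lift (a \<odot>\<^bsub>E\<^esub> x)) = G' (a \<odot>\<^bsub>?H\<^esub> lift x)"
      by (rule G'_cong[OF lift(1) s]) (use ax lift(2) in auto)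
    also have "\<dots> = a \<odot>\<^bsub>E\<^esub> G' (lift x)"
      by (rule lin_mapsD(3)[OF G' ax(1)]) (use lift(1) ax in auto)
    finally show "G' (lift (a \<odot>\<^bsub>E\<^esub> x)) = a \<odot>\<^bsub>E\<^esub> G' (lift x)" .
  qed
  from mult[OF this] obtain r where r: "r \<in> carrier R" "\<And>x. x \<in> carrier E \<Longrightarrow> G' (lift x) = r \<odot>\<^bsub>E\<^esub> x"
    by auto
  have "G f = f (q0 \<oplus>\<^bsub>Q\<^esub> \<phi> r)" if f: "f \<in> lin_maps R QM E" for f
  proof -
    have f1: "f \<one>\<^bsub>Q\<^esub> \<in> carrier E" using lin_mapsD(1)[OF f] by simp
    have fq: "f q0 \<in> carrier E" "f (\<phi> r) \<in> carrier E" using lin_mapsD(1)[OF f] q0(1) r(1) by auto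
    have "G' f = G' (lift (f \<one>\<^bsub>Q\<^esub>))" by (rule G'_cong[OF f lift(1)[OF f1]]) (simp add: lift(2)[OF f1])
    also have "\<dots> = f (\<phi> r)" using r(2)[OF f1] lin_map_phi[OF f r(1)] by simp
    finally have "G f \<ominus>\<^bsub>E\<^esub> f q0 = f (\<phi> r)" using G'a[OF f] by simp
    moreover have "G f \<in> carrier E" using lin_mapsD(1)[OF G, of f] f by simp
    ultimately have "G f = f q0 \<oplus>\<^bsub>E\<^esub> f (\<phi> r)" using fq(1) E.M.minus_eq_imp_eq_add by blast
    then show ?thesis using lin_mapsD(2)[OF f, of q0 "\<phi> r"] q0(1) r(1) by simp
  qed
  then show "\<exists>q\<in>carrier QM. \<forall>f\<in>lin_maps R QM E. G f = f q" using q0(1) r(1) by (intro bexI[of _ "q0 \<oplus>\<^bsub>Q\<^esub> \<phi> r"]) auto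
qed

end


section \<open>Dimension at least two\<close>

lemma (in ideal) finsum_closed_ideal:
  assumes "finite A" "\<And>i. i \<in> A \<Longrightarrow> f i \<in> I"
  shows "finsum R f A \<in> I"
  using assms
proof (induction A)
  case (insert x A)
  then have "f \<in> A \<rightarrow> carrier R" "f x \<in> carrier R" using Icarr by auto
  then show ?case using insert by simp
qed simp

section \<open>The submodule \<open>R[t]\<close> of \<open>Q\<close> as the image of the
  polynomials\<close>

lemma (in fraction_domain) UP_eval: "UP_pre_univ_prop R Q \<phi>"
  by (rule UP_pre_univ_propI) (use is_cring Q.is_cring \<phi>.homh in auto)

lemma (in fraction_domain) eval_smult:
  assumes t: "t \<in> carrier Q" and c: "c \<in> carrier R" and p: "p \<in> carrier (UP R)"
  shows "UnivPoly.eval R Q \<phi> t (c \<odot>\<^bsub>UP R\<^esub> p) = \<phi> c \<otimes>\<^bsub>Q\<^esub> UnivPoly.eval R Q \<phi> t p"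
proof -
  interpret P: UP_pre_univ_prop R Q \<phi> "UP R" using UP_eval by simp_all
  show ?thesis
    using ring_hom_mult[OF P.eval_ring_hom[OF t], of "up_ring.monom (UP R) c 0" p] c p P.eval_const[OF t c]
    by (simp add: P.monom_mult_is_smult)
qed

lemma (in fraction_domain) eval_image_submodule:
  assumes t: "t \<in> carrier Q"
  shows "submodule (UnivPoly.eval R Q \<phi> t ` carrier (UP R)) R QM"
proof -
  interpret P: UP_pre_univ_prop R Q \<phi> "UP R" using UP_eval by simp_all
  let ?ev = "UnivPoly.eval R Q \<phi> t"
  have ev: "?ev \<in> ring_hom (UP R) Q" by (rule P.eval_ring_hom[OF t])
  show ?thesis
  proof (rule QM.submoduleI')
    have "?ev \<zero>\<^bsub>UP R\<^esub> = \<zero>\<^bsub>Q\<^esub>" using ring_hom_zero[OF ev P.UP_ring Q.ring_axioms] .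
    then show "\<zero>\<^bsub>QM\<^esub> \<in> ?ev ` carrier (UP R)" using P.UP_zero_closed by (metis QM_simps(2) image_eqI)
  next
    fix x y assume "x \<in> ?ev ` carrier (UP R)" "y \<in> ?ev ` carrier (UP R)"
    then obtain p q where pq: "p \<in> carrier (UP R)" "q \<in> carrier (UP R)" "x = ?ev p" "y = ?ev q" by blast
    then have "x \<oplus>\<^bsub>QM\<^esub> y = ?ev (p \<oplus>\<^bsub>UP R\<^esub> q)" using ring_hom_add[OF ev] by simp
    then show "x \<oplus>\<^bsub>QM\<^esub> y \<in> ?ev ` carrier (UP R)" using pq by simp
  next
    fix c x assume c: "c \<in> carrier R" and "x \<in> ?ev ` carrier (UP R)"
    then obtain p where p: "p \<in> carrier (UP R)" "x = ?ev p" by blast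
    then have "c \<odot>\<^bsub>QM\<^esub> x = ?ev (c \<odot>\<^bsub>UP R\<^esub> p)" using eval_smult[OF t] c by simp
    then show "c \<odot>\<^bsub>QM\<^esub> x \<in> ?ev ` carrier (UP R)" using p c by simp
  qed (use ring_hom_closed[OF ev] in auto)
qed

context fraction_residue_hull
begin

text \<open>
  Analytic independence of \<open>a\<close> and \<open>b ^ Suc s\<close>: the top term \<open>c t^(n+1)\<close> of a relation has
  \<open>c \<in> (a : b ^ s)\<close>, so it can be rewritten as a multiple of \<open>t^n\<close> with coefficient in \<open>m\<close>.
\<close>

lemma relation_coefficients:
  assumes a: "a \<in> carrier R" "a \<noteq> \<zero>" and b: "b \<in> m"
    and s: "\<And>n c. c \<in> carrier R \<Longrightarrow> c \<otimes> b [^] (n::nat) \<in> PIdl a \<Longrightarrow> c \<otimes> b [^] (s::nat) \<in> PIdl a"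
    and nb: "\<And>n. b [^] (n::nat) \<notin> PIdl a"
    and t: "t \<in> carrier Q" "\<phi> a \<otimes>\<^bsub>Q\<^esub> t = \<phi> (b [^] Suc s)"
    and u: "\<And>i. u i \<in> carrier R"
    and c: "c \<in> carrier R"
    and rel: "(\<Oplus>\<^bsub>Q\<^esub>i\<in>{..<n}. \<phi> (u i) \<otimes>\<^bsub>Q\<^esub> t [^]\<^bsub>Q\<^esub> i) \<oplus>\<^bsub>Q\<^esub> \<phi> c \<otimes>\<^bsub>Q\<^esub> t [^]\<^bsub>Q\<^esub> (n::nat) = \<zero>\<^bsub>Q\<^esub>"
  shows "c \<in> m \<and> (\<forall>i<n. u i \<in> m)"
  using c rel
proof (induction n arbitrary: c)
  case 0
  then have "c = \<zero>" using phi_zero_iff by simp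
  then show ?case by simp
next
  case (Suc n)
  note c = Suc.prems(1)
  have bR: "b \<in> carrier R" using b m.Icarr by simp
  let ?S = "\<lambda>n. \<Oplus>\<^bsub>Q\<^esub>i\<in>{..<n}. \<phi> (u i) \<otimes>\<^bsub>Q\<^esub> t [^]\<^bsub>Q\<^esub> i"
  have S: "?S n \<in> carrier Q" for n by (rule Q.finsum_closed) (use u t(1) in auto)
  have SSuc: "?S (Suc n) = ?S n \<oplus>\<^bsub>Q\<^esub> \<phi> (u n) \<otimes>\<^bsub>Q\<^esub> t [^]\<^bsub>Q\<^esub> n" for n
    using u t(1) S[of n] by (simp add: lessThan_Suc Q.finsum_insert Pi_def Q.a_comm)
  have tn: "\<phi> a [^]\<^bsub>Q\<^esub> k \<otimes>\<^bsub>Q\<^esub> t [^]\<^bsub>Q\<^esub> k = \<phi> (b [^] (Suc s * k))" for k :: nat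
  proof -
    have "\<phi> a [^]\<^bsub>Q\<^esub> k \<otimes>\<^bsub>Q\<^esub> t [^]\<^bsub>Q\<^esub> k = (\<phi> a \<otimes>\<^bsub>Q\<^esub> t) [^]\<^bsub>Q\<^esub> k"
      using a t(1) by (simp add: Q.nat_pow_distrib)
    also have "\<dots> = \<phi> ((b [^] Suc s) [^] k)" using bR unfolding t(2) by (simp del: nat_pow_Suc)
    also have "\<dots> = \<phi> (b [^] (Suc s * k))" by (simp only: nat_pow_pow[OF bR])
    finally show ?thesis .
  qed
  \<comment> \<open>The \<open>k\<close>-th power of \<open>a\<close> clears the denominators of all
    terms up to the \<open>k\<close>-th power of \<open>t\<close>.\<close>
  have clear: "\<exists>w\<in>carrier R. \<phi> a [^]\<^bsub>Q\<^esub> k \<otimes>\<^bsub>Q\<^esub> ?S (Suc k) = \<phi> w" for k :: nat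
  proof (induction k)
    case 0
    then show ?case using u[of 0] t(1) SSuc[of 0] by auto
  next
    case (Suc k)
    then obtain w where w: "w \<in> carrier R" "\<phi> a [^]\<^bsub>Q\<^esub> k \<otimes>\<^bsub>Q\<^esub> ?S (Suc k) = \<phi> w" by blast
    have "\<phi> a [^]\<^bsub>Q\<^esub> Suc k \<otimes>\<^bsub>Q\<^esub> ?S (Suc (Suc k)) = \<phi> a \<otimes>\<^bsub>Q\<^esub> (\<phi> a [^]\<^bsub>Q\<^esub> k \<otimes>\<^bsub>Q\<^esub> ?S (Suc k)) \<oplus>\<^bsub>Q\<^esub>
      \<phi> (u (Suc k)) \<otimes>\<^bsub>Q\<^esub> (\<phi> a [^]\<^bsub>Q\<^esub> Suc k \<otimes>\<^bsub>Q\<^esub> t [^]\<^bsub>Q\<^esub> Suc k)"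
      unfolding SSuc[of "Suc k"] using S[of "Suc k"] a(1) t(1) u[of "Suc k"]
      by (simp add: Q.r_distr Q.m_assoc Q.m_lcomm Q.m_comm)
    also have "\<dots> = \<phi> (a \<otimes> w \<oplus> u (Suc k) \<otimes> b [^] (Suc s * Suc k))"
      unfolding w(2) tn using a(1) w(1) u[of "Suc k"] bR by (simp del: nat_pow_Suc)
    finally have "\<phi> a [^]\<^bsub>Q\<^esub> Suc k \<otimes>\<^bsub>Q\<^esub> ?S (Suc (Suc k)) = \<phi> (a \<otimes> w \<oplus> u (Suc k) \<otimes> b [^] (Suc s * Suc k))" .
    moreover have "a \<otimes> w \<oplus> u (Suc k) \<otimes> b [^] (Suc s * Suc k) \<in> carrier R"
      using a(1) w(1) u[of "Suc k"] bR by simp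
    ultimately show ?case by blast
  qed
  obtain w where w: "w \<in> carrier R" "\<phi> a [^]\<^bsub>Q\<^esub> n \<otimes>\<^bsub>Q\<^esub> ?S (Suc n) = \<phi> w" using clear by blast
  let ?N = "Suc s * Suc n"
  \<comment> \<open>The relation is multiplied by one power of \<open>a\<close> more than the terms
    up to \<open>t ^ n\<close> require. They contribute a multiple of \<open>a\<close>, and
    therefore so does the top term \<open>c b ^ ?N\<close>.\<close>
  have "\<zero>\<^bsub>Q\<^esub> = \<phi> a [^]\<^bsub>Q\<^esub> Suc n \<otimes>\<^bsub>Q\<^esub> (?S (Suc n) \<oplus>\<^bsub>Q\<^esub> \<phi> c \<otimes>\<^bsub>Q\<^esub> t [^]\<^bsub>Q\<^esub> Suc n)"
    using Suc.prems(2) a(1) by simp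
  also have "\<dots> = \<phi> a \<otimes>\<^bsub>Q\<^esub> (\<phi> a [^]\<^bsub>Q\<^esub> n \<otimes>\<^bsub>Q\<^esub> ?S (Suc n)) \<oplus>\<^bsub>Q\<^esub>
      \<phi> c \<otimes>\<^bsub>Q\<^esub> (\<phi> a [^]\<^bsub>Q\<^esub> Suc n \<otimes>\<^bsub>Q\<^esub> t [^]\<^bsub>Q\<^esub> Suc n)"
    using S[of "Suc n"] a(1) t(1) c by (simp add: Q.r_distr Q.m_assoc Q.m_lcomm Q.m_comm)
  also have "\<dots> = \<phi> (a \<otimes> w \<oplus> c \<otimes> b [^] ?N)"
    unfolding w(2) tn using a(1) w(1) c bR by (simp del: nat_pow_Suc)
  finally have "\<phi> (a \<otimes> w \<oplus> c \<otimes> b [^] ?N) = \<zero>\<^bsub>Q\<^esub>" by simp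
  then have "a \<otimes> w \<oplus> c \<otimes> b [^] ?N = \<zero>"
    using phi_zero_iff[of "a \<otimes> w \<oplus> c \<otimes> b [^] ?N"] a(1) w(1) c bR by (simp del: nat_pow_Suc)
  then have "c \<otimes> b [^] ?N = \<ominus> (a \<otimes> w)"
    using a(1) w(1) c bR minus_equality[of "c \<otimes> b [^] ?N" "a \<otimes> w"] a_comm[of "a \<otimes> w" "c \<otimes> b [^] ?N"]
    by (simp del: nat_pow_Suc)
  also have "\<dots> = a \<otimes> (\<ominus> w)" using a(1) w(1) by (simp add: r_minus)
  finally have cN: "c \<otimes> b [^] ?N \<in> PIdl a" using cgenideal_iff[OF a(1)] w(1) by blast
  interpret A: ideal "PIdl a" R by (rule cgenideal_ideal[OF a(1)])
  \<comment> \<open>Outside \<open>m\<close> the element \<open>c\<close> is a unit, and then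
    \<open>b ^ ?N\<close> itself would lie in \<open>PIdl a\<close>, against
    \<open>nb\<close>.\<close>
  have cm: "c \<in> m"
  proof (rule ccontr)
    assume "c \<notin> m"
    then have "PIdl c = carrier R"
      using proper_le_m[OF cgenideal_ideal[OF c]] cgenideal_self[OF c] by blast
    then have "\<one> \<in> PIdl c" by simp
    then obtain d where d: "d \<in> carrier R" "\<one> = c \<otimes> d" using cgenideal_iff[OF c] by blast
    have "b [^] ?N = (c \<otimes> d) \<otimes> b [^] ?N" using bR d(2)[symmetric] by (simp del: nat_pow_Suc)
    also have "\<dots> = d \<otimes> (c \<otimes> b [^] ?N)"
      using c d(1) nat_pow_closed[OF bR, of ?N] by (simp only: m_assoc m_lcomm m_closed)
    also have "\<dots> \<in> PIdl a" using A.I_l_closed[OF cN d(1)] .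
    finally show False using nb by blast
  qed
  obtain v where v: "v \<in> carrier R" "c \<otimes> b [^] s = a \<otimes> v"
    using s[OF c cN] cgenideal_iff[OF a(1)] by blast
  have vb: "v \<otimes> b \<in> m" using m.I_l_closed[OF b v(1)] .
  \<comment> \<open>Since \<open>c b ^ s = a v\<close> and \<open>t = b ^ Suc s / a\<close>, one
    factor \<open>b\<close> survives and \<open>c t = v b\<close>. The exponent \<open>Suc s\<close>
    is there for this factor: it puts the coefficient that is added to \<open>u n\<close> into
    \<open>m\<close>.\<close>
  have "\<phi> a \<otimes>\<^bsub>Q\<^esub> (\<phi> c \<otimes>\<^bsub>Q\<^esub> t) = \<phi> c \<otimes>\<^bsub>Q\<^esub> (\<phi> a \<otimes>\<^bsub>Q\<^esub> t)"
    using a(1) c t(1) by (simp add: Q.m_lcomm)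
  also have "\<dots> = \<phi> ((c \<otimes> b [^] s) \<otimes> b)" unfolding t(2) using c bR by (simp add: Q.m_assoc)
  also have "\<dots> = \<phi> a \<otimes>\<^bsub>Q\<^esub> \<phi> (v \<otimes> b)" unfolding v(2) using a(1) v(1) bR by (simp add: Q.m_assoc)
  finally have ct: "\<phi> c \<otimes>\<^bsub>Q\<^esub> t = \<phi> (v \<otimes> b)"
    using phi_lcancel[OF a] c t(1) v(1) bR by simp
  have "?S n \<oplus>\<^bsub>Q\<^esub> \<phi> (u n \<oplus> v \<otimes> b) \<otimes>\<^bsub>Q\<^esub> t [^]\<^bsub>Q\<^esub> n =
    (?S n \<oplus>\<^bsub>Q\<^esub> \<phi> (u n) \<otimes>\<^bsub>Q\<^esub> t [^]\<^bsub>Q\<^esub> n) \<oplus>\<^bsub>Q\<^esub> \<phi> (v \<otimes> b) \<otimes>\<^bsub>Q\<^esub> t [^]\<^bsub>Q\<^esub> n"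
    using S[of n] u[of n] v(1) bR t(1) by (simp add: Q.l_distr Q.a_assoc)
  also have "\<dots> = ?S (Suc n) \<oplus>\<^bsub>Q\<^esub> \<phi> c \<otimes>\<^bsub>Q\<^esub> t [^]\<^bsub>Q\<^esub> Suc n"
    unfolding SSuc ct[symmetric] using c t(1) by (simp add: Q.m_ac)
  also have "\<dots> = \<zero>\<^bsub>Q\<^esub>" by (rule Suc.prems(2))
  finally have "u n \<oplus> v \<otimes> b \<in> m \<and> (\<forall>i<n. u i \<in> m)"
    using Suc.IH[of "u n \<oplus> v \<otimes> b"] u[of n] v(1) bR by simp
  moreover have "u n = (u n \<oplus> v \<otimes> b) \<ominus> v \<otimes> b" using u[of n] v(1) bR by algebra
  ultimately have "u n \<in> m" using vb m.a_closed m.a_inv_closed by (metis minus_eq)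
  then show ?case using cm \<open>u n \<oplus> v \<otimes> b \<in> m \<and> (\<forall>i<n. u i \<in> m)\<close> less_Suc_eq by auto
qed

text \<open>By \<open>ker\<close> the residue of \<open>L p\<close> modulo \<open>m\<close> depends
  only on the value of \<open>p\<close> at \<open>t\<close>, and \<open>R / m\<close> sits in
  \<open>E\<close> as the multiples of \<open>e\<^sub>0\<close>; injectivity then extends the map
  from \<open>R[t]\<close> to \<open>Q\<close>. Single coefficients and the sum of all coefficients
  are the two choices of \<open>L\<close>.\<close>

lemma extend_from_polynomials:
  assumes t: "t \<in> carrier Q"
    and L: "\<And>p. p \<in> carrier (UP R) \<Longrightarrow> L p \<in> carrier R"
      "\<And>p q. p \<in> carrier (UP R) \<Longrightarrow> q \<in> carrier (UP R) \<Longrightarrow> L (p \<oplus>\<^bsub>UP R\<^esub> q) = L p \<oplus> L q"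
      "\<And>c p. c \<in> carrier R \<Longrightarrow> p \<in> carrier (UP R) \<Longrightarrow> L (c \<odot>\<^bsub>UP R\<^esub> p) = c \<otimes> L p"
    and ker: "\<And>p. p \<in> carrier (UP R) \<Longrightarrow> UnivPoly.eval R Q \<phi> t p = \<zero>\<^bsub>Q\<^esub> \<Longrightarrow> L p \<in> m"
  shows "\<exists>f\<in>lin_maps R QM E. \<forall>p\<in>carrier (UP R). f (UnivPoly.eval R Q \<phi> t p) = L p \<odot>\<^bsub>E\<^esub> e\<^sub>0"
proof -
  interpret P: UP_pre_univ_prop R Q \<phi> "UP R" using UP_eval by simp_all
  let ?ev = "UnivPoly.eval R Q \<phi> t"
  have ev: "?ev \<in> ring_hom (UP R) Q" by (rule P.eval_ring_hom[OF t])
  have evc: "?ev p \<in> carrier Q" if "p \<in> carrier (UP R)" for p using ring_hom_closed[OF ev that] .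
  have evadd: "?ev (p \<oplus>\<^bsub>UP R\<^esub> q) = ?ev p \<oplus>\<^bsub>Q\<^esub> ?ev q" if "p \<in> carrier (UP R)" "q \<in> carrier (UP R)" for p q
    using ring_hom_add[OF ev that] .
  note evmul = eval_smult[OF t]
  have wd: "L p \<odot>\<^bsub>E\<^esub> e\<^sub>0 = L q \<odot>\<^bsub>E\<^esub> e\<^sub>0" if pq: "p \<in> carrier (UP R)" "q \<in> carrier (UP R)" "?ev p = ?ev q" for p q
  proof -
    let ?d = "p \<oplus>\<^bsub>UP R\<^esub> (\<ominus> \<one>) \<odot>\<^bsub>UP R\<^esub> q"
    have nq: "(\<ominus> \<one>) \<odot>\<^bsub>UP R\<^esub> q \<in> carrier (UP R)" using pq by simp
    have "?ev ?d = ?ev p \<oplus>\<^bsub>Q\<^esub> \<ominus>\<^bsub>Q\<^esub> ?ev q"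
      using evadd[OF pq(1) nq] evmul[OF _ pq(2), of "\<ominus> \<one>"] evc[OF pq(2)] by (simp add: Q.l_minus)
    then have "?ev ?d = \<zero>\<^bsub>Q\<^esub>" using pq(3) evc[OF pq(2)] by (simp add: Q.r_neg)
    then have "L ?d \<in> m" using ker pq(1) nq by simp
    moreover have "L ?d = L p \<ominus> L q"
      using L(2)[OF pq(1) nq] L(3)[OF _ pq(2), of "\<ominus> \<one>"] L(1)[OF pq(2)] by (simp add: minus_eq l_minus)
    ultimately have "(L p \<ominus> L q) \<odot>\<^bsub>E\<^esub> e\<^sub>0 = \<zero>\<^bsub>E\<^esub>"
      using e0_annihilator[of "L p \<ominus> L q"] L(1) pq by simp
    then show ?thesis using E.smult_diff_zero_iff[of "L p" "L q" e\<^sub>0] L(1) pq by simp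
  qed
  define g where "g x = L (SOME p. p \<in> carrier (UP R) \<and> ?ev p = x) \<odot>\<^bsub>E\<^esub> e\<^sub>0" for x
  have g: "g (?ev p) = L p \<odot>\<^bsub>E\<^esub> e\<^sub>0" if p: "p \<in> carrier (UP R)" for p
  proof -
    have "(SOME q. q \<in> carrier (UP R) \<and> ?ev q = ?ev p) \<in> carrier (UP R) \<and>
      ?ev (SOME q. q \<in> carrier (UP R) \<and> ?ev q = ?ev p) = ?ev p"
      by (rule someI[of "\<lambda>q. q \<in> carrier (UP R) \<and> ?ev q = ?ev p"]) (use p in simp)
    then show ?thesis unfolding g_def using wd[OF _ p] by blast
  qed
  obtain h where h: "h \<in> lin_maps R QM E" "\<And>x. x \<in> ?ev ` carrier (UP R) \<Longrightarrow> h x = g x"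
  proof (rule injective_extend[OF injective QM_module, of "?ev ` carrier (UP R)" g])
    show "submodule (?ev ` carrier (UP R)) R QM" by (rule eval_image_submodule[OF t])
  next
    fix x assume "x \<in> ?ev ` carrier (UP R)"
    then show "g x \<in> carrier E" using g L(1) by auto
  next
    fix x y assume "x \<in> ?ev ` carrier (UP R)" "y \<in> ?ev ` carrier (UP R)"
    then obtain p q where pq: "p \<in> carrier (UP R)" "q \<in> carrier (UP R)" "x = ?ev p" "y = ?ev q" by blast
    have "x \<oplus>\<^bsub>QM\<^esub> y = ?ev (p \<oplus>\<^bsub>UP R\<^esub> q)" using evadd[OF pq(1,2)] pq(3,4) by simp
    then show "g (x \<oplus>\<^bsub>QM\<^esub> y) = g x \<oplus>\<^bsub>E\<^esub> g y"
      using g[OF pq(1)] g[OF pq(2)] g[of "p \<oplus>\<^bsub>UP R\<^esub> q"] pq L(1,2) by (simp add: E.smult_l_distr)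
  next
    fix c x assume c: "c \<in> carrier R" and "x \<in> ?ev ` carrier (UP R)"
    then obtain p where p: "p \<in> carrier (UP R)" "x = ?ev p" by blast
    have "c \<odot>\<^bsub>QM\<^esub> x = ?ev (c \<odot>\<^bsub>UP R\<^esub> p)" using evmul[OF c p(1)] p(2) by simp
    then show "g (c \<odot>\<^bsub>QM\<^esub> x) = c \<odot>\<^bsub>E\<^esub> g x"
      using g[OF p(1)] g[of "c \<odot>\<^bsub>UP R\<^esub> p"] p c L(1,3) by (simp add: E.smult_assoc1)
  qed (rule that)
  then show ?thesis using g by (intro bexI[of _ h]) auto
qed

text \<open>
  The images of the powers of \<open>t\<close> form a basis of \<open>R[t] / m R[t]\<close> over \<open>R / m\<close>, and a vector space of
  infinite dimension is not reflexive: a functional on the dual that vanishes on the maps with only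
  finitely many nonzero coordinates, but not on the map with all coordinates \<open>e\<^sub>0\<close>, is not an evaluation.
\<close>

lemma not_reflexive:
  assumes t: "t \<in> carrier Q"
    and indep: "\<And>u n c. (\<And>i. u i \<in> carrier R) \<Longrightarrow> c \<in> carrier R \<Longrightarrow>
      (\<Oplus>\<^bsub>Q\<^esub>i\<in>{..<n}. \<phi> (u i) \<otimes>\<^bsub>Q\<^esub> t [^]\<^bsub>Q\<^esub> i) \<oplus>\<^bsub>Q\<^esub> \<phi> c \<otimes>\<^bsub>Q\<^esub> t [^]\<^bsub>Q\<^esub> n = \<zero>\<^bsub>Q\<^esub> \<Longrightarrow>
      c \<in> m \<and> (\<forall>i<(n::nat). u i \<in> m)"
  shows "\<not> reflexive_wrt R E QM"
proof
  assume refl: "reflexive_wrt R E QM"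
  interpret P: UP_pre_univ_prop R Q \<phi> "UP R" using UP_eval by simp_all
  have id: "UP_pre_univ_prop R R (\<lambda>x. x)"
    using UP_pre_univ_propI[OF is_cring is_cring, of "\<lambda>x. x"] by (simp add: ring_hom_def)
  note E = E.module_axioms
  let ?H = "Hom_module R QM E"
  have H: "module R ?H" by (rule Hom_module_is_module[OF QM_module E])
  interpret H: module R ?H by fact
  let ?ev = "UnivPoly.eval R Q \<phi> t" and ?X = "up_ring.monom (UP R) \<one>"
  have evX: "?ev (?X n) = t [^]\<^bsub>Q\<^esub> n" for n using P.eval_monom[OF one_closed t] t by simp
  have coeffs: "up_ring.coeff (UP R) p i \<in> m" if p: "p \<in> carrier (UP R)" "?ev p = \<zero>\<^bsub>Q\<^esub>" for p i
  proof (cases "i \<le> deg R p")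
    case True
    let ?n = "deg R p"
    have "?ev p = (\<Oplus>\<^bsub>Q\<^esub>i\<in>{..<?n}. \<phi> (up_ring.coeff (UP R) p i) \<otimes>\<^bsub>Q\<^esub> t [^]\<^bsub>Q\<^esub> i) \<oplus>\<^bsub>Q\<^esub>
      \<phi> (up_ring.coeff (UP R) p ?n) \<otimes>\<^bsub>Q\<^esub> t [^]\<^bsub>Q\<^esub> ?n"
      unfolding P.eval_on_carrier[OF p(1)] lessThan_Suc_atMost[symmetric] lessThan_Suc
      using p(1) t by (subst Q.finsum_insert) (auto intro!: Q.a_comm Q.finsum_closed)
    then have "up_ring.coeff (UP R) p ?n \<in> m \<and> (\<forall>i<?n. up_ring.coeff (UP R) p i \<in> m)"
      using indep[of "up_ring.coeff (UP R) p" "up_ring.coeff (UP R) p ?n" ?n] p by simp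
    then show ?thesis using True by (cases "i = ?n") auto
  next
    case False
    then have "up_ring.coeff (UP R) p i = \<zero>" using P.deg_aboveD[OF _ p(1)] by simp
    then show ?thesis by simp
  qed
  \<comment> \<open>The sum of the coefficients, as evaluation at \<open>1\<close>. It is
    \<open>1\<close> on every power of the variable, so \<open>f1\<close> below takes the value
    \<open>e\<^sub>0\<close> at every power of \<open>t\<close>.\<close>
  define S where "S = UnivPoly.eval R R (\<lambda>x. x) \<one>"
  have S: "S \<in> ring_hom (UP R) R" unfolding S_def by (rule UP_pre_univ_prop.eval_ring_hom[OF id one_closed])
  have Sm: "S p \<in> m" if p: "p \<in> carrier (UP R)" "\<And>i. up_ring.coeff (UP R) p i \<in> m" for p
    unfolding S_def P.eval_on_carrier[OF p(1)]
    by (rule m.finsum_closed_ideal) (use p(2) m.Icarr in auto)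
  have SX: "S (?X n) = \<one>" for n unfolding S_def using UP_pre_univ_prop.eval_monom[OF id one_closed one_closed, of n] by simp
  have "\<exists>f\<in>lin_maps R QM E. \<forall>p\<in>carrier (UP R). f (?ev p) = S p \<odot>\<^bsub>E\<^esub> e\<^sub>0"
  proof (rule extend_from_polynomials[OF t])
    fix c p assume "c \<in> carrier R" "p \<in> carrier (UP R)"
    then show "S (c \<odot>\<^bsub>UP R\<^esub> p) = c \<otimes> S p"
      using ring_hom_mult[OF S, of "up_ring.monom (UP R) c 0" p] UP_pre_univ_prop.eval_const[OF id one_closed, of c]
      by (simp add: P.monom_mult_is_smult S_def)
  qed (use ring_hom_closed[OF S] ring_hom_add[OF S] Sm coeffs in auto)
  then obtain f1 where f1: "f1 \<in> lin_maps R QM E" "\<And>p. p \<in> carrier (UP R) \<Longrightarrow> f1 (?ev p) = S p \<odot>\<^bsub>E\<^esub> e\<^sub>0"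
    by blast
  define H0 where "H0 = {f \<in> lin_maps R QM E. \<exists>N. \<forall>n\<ge>N. f (t [^]\<^bsub>Q\<^esub> (n::nat)) = \<zero>\<^bsub>E\<^esub>}"
  have "submodule H0 R ?H"
  proof (rule H.submoduleI')
    show "H0 \<subseteq> carrier ?H" by (auto simp: H0_def)
    show "\<zero>\<^bsub>?H\<^esub> \<in> H0" using lin_maps_zero_map[OF QM_module E] t by (simp add: H0_def)
  next
    fix f g assume fg: "f \<in> H0" "g \<in> H0"
    then obtain N N' where N: "\<forall>n\<ge>N. f (t [^]\<^bsub>Q\<^esub> (n::nat)) = \<zero>\<^bsub>E\<^esub>" "\<forall>n\<ge>N'. g (t [^]\<^bsub>Q\<^esub> (n::nat)) = \<zero>\<^bsub>E\<^esub>"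
      unfolding H0_def by blast
    have "f \<oplus>\<^bsub>?H\<^esub> g \<in> lin_maps R QM E" using fg lin_maps_add[OF QM_module E] by (simp add: H0_def)
    moreover have "\<forall>n\<ge>max N N'. (f \<oplus>\<^bsub>?H\<^esub> g) (t [^]\<^bsub>Q\<^esub> n) = \<zero>\<^bsub>E\<^esub>" using N t by simp
    ultimately show "f \<oplus>\<^bsub>?H\<^esub> g \<in> H0" unfolding H0_def by blast
  next
    fix a f assume a: "a \<in> carrier R" and f: "f \<in> H0"
    then obtain N where N: "\<forall>n\<ge>N. f (t [^]\<^bsub>Q\<^esub> (n::nat)) = \<zero>\<^bsub>E\<^esub>" unfolding H0_def by blast
    have "a \<odot>\<^bsub>?H\<^esub> f \<in> lin_maps R QM E" using f a lin_maps_smult[OF QM_module E] by (simp add: H0_def)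
    moreover have "\<forall>n\<ge>N. (a \<odot>\<^bsub>?H\<^esub> f) (t [^]\<^bsub>Q\<^esub> n) = \<zero>\<^bsub>E\<^esub>" using N t a by simp
    ultimately show "a \<odot>\<^bsub>?H\<^esub> f \<in> H0" unfolding H0_def by blast
  qed
  moreover have "f1 \<notin> H0"
  proof
    assume "f1 \<in> H0"
    then obtain N where "f1 (t [^]\<^bsub>Q\<^esub> (N::nat)) = \<zero>\<^bsub>E\<^esub>" unfolding H0_def by blast
    then show False using f1(2)[of "?X N"] SX[of N] evX[of N] e0_nonzero by simp
  qed
  moreover have "f1 \<in> carrier ?H" using f1(1) by simp
  ultimately obtain G where G: "G \<in> lin_maps R ?H E" "\<And>f. f \<in> H0 \<Longrightarrow> G f = \<zero>\<^bsub>E\<^esub>" "G f1 = e\<^sub>0"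
    using separate_submodule[OF H, of H0 f1 thesis] by blast
  from reflexive_wrtD[OF refl G(1)] obtain q where q: "q \<in> carrier Q"
    "\<And>f. f \<in> lin_maps R QM E \<Longrightarrow> G f = f q" by auto
  have N: "submodule (?ev ` carrier (UP R)) R QM" by (rule eval_image_submodule[OF t])
  \<comment> \<open>A map that kills \<open>R[t]\<close> belongs to \<open>H0\<close>, so it
    vanishes at \<open>q\<close>; hence \<open>q\<close> cannot be separated from
    \<open>R[t]\<close>.\<close>
  have "q \<in> ?ev ` carrier (UP R)"
  proof (rule ccontr)
    assume "q \<notin> ?ev ` carrier (UP R)"
    moreover have "q \<in> carrier QM" using q by simp
    ultimately obtain f where f: "f \<in> lin_maps R QM E" "\<And>y. y \<in> ?ev ` carrier (UP R) \<Longrightarrow> f y = \<zero>\<^bsub>E\<^esub>" "f q = e\<^sub>0"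
      using separate_submodule[OF QM_module N, of q thesis] by blast
    have "f (t [^]\<^bsub>Q\<^esub> n) = \<zero>\<^bsub>E\<^esub>" for n :: nat
      unfolding evX[symmetric] by (rule f(2)) simp
    then have "f \<in> H0" using f(1) by (simp add: H0_def)
    then show False using G(2) q(2)[OF f(1)] f(3) e0_nonzero by simp
  qed
  then obtain p where p: "p \<in> carrier (UP R)" "q = ?ev p" by blast
  \<comment> \<open>The \<open>i\<close>-th coordinate map vanishes at all other powers of
    \<open>t\<close>. It belongs to \<open>H0\<close>, so it vanishes at \<open>q\<close>, where its
    value is the \<open>i\<close>-th coefficient of \<open>p\<close> times
    \<open>e\<^sub>0\<close>.\<close>
  have "up_ring.coeff (UP R) p i \<in> m" for i
  proof -
    have "\<exists>f\<in>lin_maps R QM E. \<forall>p\<in>carrier (UP R). f (?ev p) = up_ring.coeff (UP R) p i \<odot>\<^bsub>E\<^esub> e\<^sub>0"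
      by (rule extend_from_polynomials[OF t]) (use coeffs in auto)
    then obtain f where f: "f \<in> lin_maps R QM E" "\<And>p. p \<in> carrier (UP R) \<Longrightarrow> f (?ev p) = up_ring.coeff (UP R) p i \<odot>\<^bsub>E\<^esub> e\<^sub>0"
      by blast
    have "f (t [^]\<^bsub>Q\<^esub> n) = \<zero>\<^bsub>E\<^esub>" if "n \<ge> Suc i" for n :: nat
      using f(2)[of "?X n"] evX[of n] that by simp
    then have "f \<in> H0" using f(1) unfolding H0_def by blast
    then have "up_ring.coeff (UP R) p i \<odot>\<^bsub>E\<^esub> e\<^sub>0 = \<zero>\<^bsub>E\<^esub>" using G(2) q(2)[OF f(1)] f(2)[OF p(1)] p(2) by simp
    then show ?thesis using e0_annihilator p(1) by simp
  qed
  then have "S p \<in> m" by (rule Sm[OF p(1)])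
  then have "f1 q = \<zero>\<^bsub>E\<^esub>" using f1(2)[OF p(1)] p(2) e0_annihilator[of "S p"] m.Icarr by simp
  then show False using G(3) q(2)[OF f1(1)] e0_nonzero by simp
qed

lemma reflexive_imp_power_mem:
  assumes refl: "reflexive_wrt R E QM" and a: "a \<in> carrier R" "a \<noteq> \<zero>" and b: "b \<in> m"
  shows "\<exists>n::nat. b [^] n \<in> PIdl a"
proof (rule ccontr)
  assume nb: "\<not> ?thesis"
  have bR: "b \<in> carrier R" using b m.Icarr by simp
  interpret A: ideal "PIdl a" R by (rule cgenideal_ideal[OF a(1)])
  \<comment> \<open>The colon ideals \<open>(a R : b ^ n)\<close> ascend with \<open>n\<close>;
    \<open>s\<close> will be an index from which on they are constant.\<close>
  define C where "C n = {c \<in> carrier R. c \<otimes> b [^] n \<in> PIdl a}" for n :: nat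
  have C_mono: "C n \<subseteq> C (n + k)" for n k
  proof
    fix c assume "c \<in> C n"
    then have c: "c \<in> carrier R" "c \<otimes> b [^] n \<in> PIdl a" by (auto simp: C_def)
    have "c \<otimes> b [^] (n + k) = b [^] k \<otimes> (c \<otimes> b [^] n)"
      using c(1) bR by (simp add: nat_pow_mult[symmetric] m_ac)
    then show "c \<in> C (n + k)" using c A.I_l_closed[OF c(2), of "b [^] k"] bR by (simp add: C_def)
  qed
  have Cid: "ideal (C n) R" for n
  proof (rule idealI')
    show "C n \<subseteq> carrier R" by (auto simp: C_def)
    show "\<zero> \<in> C n" using bR by (simp add: C_def)
    show "x \<oplus> y \<in> C n" if "x \<in> C n" "y \<in> C n" for x y
      using that bR by (simp add: C_def l_distr)
    show "c \<otimes> x \<in> C n" if "c \<in> carrier R" "x \<in> C n" for c x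
      using that bR A.I_l_closed by (simp add: C_def m_assoc)
  qed
  obtain I where "I \<in> range C" and max: "\<And>J. J \<in> range C \<Longrightarrow> I \<subseteq> J \<Longrightarrow> J = I"
  proof (rule ex_maximal_ideal_in[of "range C"])
    fix J assume "J \<in> range C"
    then show "ideal J R" using Cid by blast
  qed (simp, rule that)
  then obtain s where Is: "I = C s" by blast
  have s: "c \<otimes> b [^] s \<in> PIdl a" if "c \<in> carrier R" "c \<otimes> b [^] n \<in> PIdl a" for c and n :: nat
  proof -
    have "C (s + n) = C s" using max[of "C (s + n)"] C_mono[of s n] Is by blast
    moreover have "c \<in> C n" using that by (simp add: C_def)
    ultimately have "c \<in> C s" using C_mono[of n s] by (auto simp: add.commute)
    then show ?thesis by (simp add: C_def)
  qed
  have aU: "\<phi> a \<in> Units Q" using a phi_zero_iff by (simp add: Q.field_Units)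
  define t where "t = inv\<^bsub>Q\<^esub> (\<phi> a) \<otimes>\<^bsub>Q\<^esub> \<phi> (b [^] Suc s)"
  have t: "t \<in> carrier Q" "\<phi> a \<otimes>\<^bsub>Q\<^esub> t = \<phi> (b [^] Suc s)"
    using aU a(1) bR by (simp_all add: t_def Q.m_assoc[symmetric])
  have "\<not> reflexive_wrt R E QM"
    by (rule not_reflexive[OF t(1)]) (rule relation_coefficients[OF a b s _ t], use nb in auto)
  then show False using refl by simp
qed

end


section \<open>Direct sums of injective hulls\<close>

lemma direct_sum_simps [simp]:
  "\<zero>\<^bsub>direct_sum I M\<^esub> = (\<lambda>i\<in>I. \<zero>\<^bsub>M i\<^esub>)"
  "x \<oplus>\<^bsub>direct_sum I M\<^esub> y = (\<lambda>i\<in>I. x i \<oplus>\<^bsub>M i\<^esub> y i)"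
  "a \<odot>\<^bsub>direct_sum I M\<^esub> x = (\<lambda>i\<in>I. a \<odot>\<^bsub>M i\<^esub> x i)"
  by (auto simp: direct_sum_def)

lemma direct_sum_carrier_iff:
  "x \<in> carrier (direct_sum I M) \<longleftrightarrow>
    x \<in> extensional I \<and> (\<forall>i\<in>I. x i \<in> carrier (M i)) \<and> finite {i \<in> I. x i \<noteq> \<zero>\<^bsub>M i\<^esub>}"
  by (auto simp: direct_sum_def PiE_def)

lemma direct_sum_restrictI:
  assumes "\<And>i. i \<in> I \<Longrightarrow> f i \<in> carrier (M i)" "finite A" "\<And>i. i \<in> I \<Longrightarrow> i \<notin> A \<Longrightarrow> f i = \<zero>\<^bsub>M i\<^esub>"
  shows "(\<lambda>i\<in>I. f i) \<in> carrier (direct_sum I M)"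
proof -
  have "{i \<in> I. restrict f I i \<noteq> \<zero>\<^bsub>M i\<^esub>} \<subseteq> A" using assms(3) by auto
  then have "finite {i \<in> I. restrict f I i \<noteq> \<zero>\<^bsub>M i\<^esub>}" using assms(2) by (rule finite_subset)
  then show ?thesis using assms(1) unfolding direct_sum_carrier_iff by simp
qed

lemma direct_sum_eqI:
  assumes "x \<in> carrier (direct_sum I M)" "y \<in> carrier (direct_sum I M)" "\<And>i. i \<in> I \<Longrightarrow> x i = y i"
  shows "x = y"
  using assms by (auto simp: direct_sum_carrier_iff intro: extensionalityI)

lemma direct_sum_is_module:
  assumes R: "cring R" and M: "\<And>i. i \<in> I \<Longrightarrow> module R (M i)"
  shows "module R (direct_sum I M)"
proof -
  interpret cring R by fact
  let ?D = "direct_sum I M"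
  have car: "x i \<in> carrier (M i)" if "x \<in> carrier ?D" "i \<in> I" for x i
    using that by (simp add: direct_sum_carrier_iff)
  have fin: "finite {i \<in> I. x i \<noteq> \<zero>\<^bsub>M i\<^esub>}" if "x \<in> carrier ?D" for x
    using that by (simp add: direct_sum_carrier_iff)
  have grp: "abelian_group (M i)" if "i \<in> I" for i using M[OF that] by (simp add: module_def)
  have zero: "\<zero>\<^bsub>?D\<^esub> \<in> carrier ?D"
    using grp abelian_group.axioms(1) abelian_monoid.zero_closed
    by (auto intro!: direct_sum_restrictI[where A = "{}"])
  have add: "x \<oplus>\<^bsub>?D\<^esub> y \<in> carrier ?D" if xy: "x \<in> carrier ?D" "y \<in> carrier ?D" for x y
    unfolding direct_sum_simps
  proof (rule direct_sum_restrictI[OF _ finite_UnI[OF fin[OF xy(1)] fin[OF xy(2)]]])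
    fix i assume i: "i \<in> I"
    interpret Mi: module R "M i" using M[OF i] .
    show "x i \<oplus>\<^bsub>M i\<^esub> y i \<in> carrier (M i)" using car i xy by simp
    assume "i \<notin> {i \<in> I. x i \<noteq> \<zero>\<^bsub>M i\<^esub>} \<union> {i \<in> I. y i \<noteq> \<zero>\<^bsub>M i\<^esub>}"
    then have "x i = \<zero>\<^bsub>M i\<^esub>" "y i = \<zero>\<^bsub>M i\<^esub>" using i by auto
    then show "x i \<oplus>\<^bsub>M i\<^esub> y i = \<zero>\<^bsub>M i\<^esub>" by simp
  qed
  have smult: "a \<odot>\<^bsub>?D\<^esub> x \<in> carrier ?D" if a: "a \<in> carrier R" and x: "x \<in> carrier ?D" for a x
    unfolding direct_sum_simps
  proof (rule direct_sum_restrictI[OF _ fin[OF x]])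
    fix i assume i: "i \<in> I"
    interpret Mi: module R "M i" using M[OF i] .
    show "a \<odot>\<^bsub>M i\<^esub> x i \<in> carrier (M i)" using car i x a by simp
    assume "i \<notin> {i \<in> I. x i \<noteq> \<zero>\<^bsub>M i\<^esub>}"
    then have "x i = \<zero>\<^bsub>M i\<^esub>" using i by auto
    then show "a \<odot>\<^bsub>M i\<^esub> x i = \<zero>\<^bsub>M i\<^esub>" using a by simp
  qed
  show ?thesis
  proof (rule moduleI)
    show "abelian_group ?D"
    proof (rule abelian_groupI)
      fix x y assume x: "x \<in> carrier ?D" and y: "y \<in> carrier ?D"
      show "x \<oplus>\<^bsub>?D\<^esub> y \<in> carrier ?D" by (rule add[OF x y])
      show "x \<oplus>\<^bsub>?D\<^esub> y = y \<oplus>\<^bsub>?D\<^esub> x"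
      proof (rule direct_sum_eqI[OF add[OF x y] add[OF y x]])
        fix i assume i: "i \<in> I"
        interpret Mi: module R "M i" using M[OF i] .
        show "(x \<oplus>\<^bsub>?D\<^esub> y) i = (y \<oplus>\<^bsub>?D\<^esub> x) i" using i car[OF x i] car[OF y i] by (simp add: Mi.M.a_comm)
      qed
      fix z assume z: "z \<in> carrier ?D"
      show "x \<oplus>\<^bsub>?D\<^esub> y \<oplus>\<^bsub>?D\<^esub> z = x \<oplus>\<^bsub>?D\<^esub> (y \<oplus>\<^bsub>?D\<^esub> z)"
      proof (rule direct_sum_eqI[OF add[OF add[OF x y] z] add[OF x add[OF y z]]])
        fix i assume i: "i \<in> I"
        interpret Mi: module R "M i" using M[OF i] .
        show "(x \<oplus>\<^bsub>?D\<^esub> y \<oplus>\<^bsub>?D\<^esub> z) i = (x \<oplus>\<^bsub>?D\<^esub> (y \<oplus>\<^bsub>?D\<^esub> z)) i"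
          using i car[OF x i] car[OF y i] car[OF z i] by (simp add: Mi.M.a_assoc)
      qed
    next
      fix x assume x: "x \<in> carrier ?D"
      show "\<zero>\<^bsub>?D\<^esub> \<oplus>\<^bsub>?D\<^esub> x = x"
      proof (rule direct_sum_eqI[OF add[OF zero x] x])
        fix i assume i: "i \<in> I"
        interpret Mi: module R "M i" using M[OF i] .
        show "(\<zero>\<^bsub>?D\<^esub> \<oplus>\<^bsub>?D\<^esub> x) i = x i" using i car[OF x i] by simp
      qed
      have n: "(\<ominus>\<^bsub>R\<^esub> \<one>\<^bsub>R\<^esub>) \<odot>\<^bsub>?D\<^esub> x \<in> carrier ?D" by (rule smult[OF _ x]) simp
      have "(\<ominus>\<^bsub>R\<^esub> \<one>\<^bsub>R\<^esub>) \<odot>\<^bsub>?D\<^esub> x \<oplus>\<^bsub>?D\<^esub> x = \<zero>\<^bsub>?D\<^esub>"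
      proof (rule direct_sum_eqI[OF add[OF n x] zero])
        fix i assume i: "i \<in> I"
        interpret Mi: module R "M i" using M[OF i] .
        show "((\<ominus>\<^bsub>R\<^esub> \<one>\<^bsub>R\<^esub>) \<odot>\<^bsub>?D\<^esub> x \<oplus>\<^bsub>?D\<^esub> x) i = \<zero>\<^bsub>?D\<^esub> i"
          using i car[OF x i] by (simp add: Mi.smult_l_minus Mi.M.l_neg)
      qed
      then show "\<exists>y\<in>carrier ?D. y \<oplus>\<^bsub>?D\<^esub> x = \<zero>\<^bsub>?D\<^esub>" using n by blast
    qed (rule zero)
  next
    fix a x assume a: "a \<in> carrier R" and x: "x \<in> carrier ?D"
    show "a \<odot>\<^bsub>?D\<^esub> x \<in> carrier ?D" by (rule smult[OF a x])
    fix b assume b: "b \<in> carrier R"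
    show "(a \<oplus>\<^bsub>R\<^esub> b) \<odot>\<^bsub>?D\<^esub> x = a \<odot>\<^bsub>?D\<^esub> x \<oplus>\<^bsub>?D\<^esub> b \<odot>\<^bsub>?D\<^esub> x"
    proof (rule direct_sum_eqI[OF smult[OF _ x] add[OF smult[OF a x] smult[OF b x]]])
      fix i assume i: "i \<in> I"
      interpret Mi: module R "M i" using M[OF i] .
      show "((a \<oplus>\<^bsub>R\<^esub> b) \<odot>\<^bsub>?D\<^esub> x) i = (a \<odot>\<^bsub>?D\<^esub> x \<oplus>\<^bsub>?D\<^esub> b \<odot>\<^bsub>?D\<^esub> x) i"
        using i a b car[OF x i] by (simp add: Mi.smult_l_distr)
    qed (use a b in simp)
    show "(a \<otimes>\<^bsub>R\<^esub> b) \<odot>\<^bsub>?D\<^esub> x = a \<odot>\<^bsub>?D\<^esub> (b \<odot>\<^bsub>?D\<^esub> x)"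
    proof (rule direct_sum_eqI[OF smult[OF _ x] smult[OF a smult[OF b x]]])
      fix i assume i: "i \<in> I"
      interpret Mi: module R "M i" using M[OF i] .
      show "((a \<otimes>\<^bsub>R\<^esub> b) \<odot>\<^bsub>?D\<^esub> x) i = (a \<odot>\<^bsub>?D\<^esub> (b \<odot>\<^bsub>?D\<^esub> x)) i"
        using i a b car[OF x i] by (simp add: Mi.smult_assoc1)
    qed (use a b in simp)
  next
    fix a x y assume a: "a \<in> carrier R" and x: "x \<in> carrier ?D" and y: "y \<in> carrier ?D"
    show "a \<odot>\<^bsub>?D\<^esub> (x \<oplus>\<^bsub>?D\<^esub> y) = a \<odot>\<^bsub>?D\<^esub> x \<oplus>\<^bsub>?D\<^esub> a \<odot>\<^bsub>?D\<^esub> y"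
    proof (rule direct_sum_eqI[OF smult[OF a add[OF x y]] add[OF smult[OF a x] smult[OF a y]]])
      fix i assume i: "i \<in> I"
      interpret Mi: module R "M i" using M[OF i] .
      show "(a \<odot>\<^bsub>?D\<^esub> (x \<oplus>\<^bsub>?D\<^esub> y)) i = (a \<odot>\<^bsub>?D\<^esub> x \<oplus>\<^bsub>?D\<^esub> a \<odot>\<^bsub>?D\<^esub> y) i"
        using i a car[OF x i] car[OF y i] by (simp add: Mi.smult_r_distr)
    qed
  next
    fix x assume x: "x \<in> carrier ?D"
    show "\<one>\<^bsub>R\<^esub> \<odot>\<^bsub>?D\<^esub> x = x"
    proof (rule direct_sum_eqI[OF smult[OF one_closed x] x])
      fix i assume i: "i \<in> I"
      interpret Mi: module R "M i" using M[OF i] .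
      show "(\<one>\<^bsub>R\<^esub> \<odot>\<^bsub>?D\<^esub> x) i = x i" using i car[OF x i] by simp
    qed
  qed (rule R)
qed

definition coprojection :: "'i set \<Rightarrow> ('i \<Rightarrow> ('a, 'm, 'k) module_scheme) \<Rightarrow> 'i \<Rightarrow> 'm \<Rightarrow> 'i \<Rightarrow> 'm"
  where "coprojection I M i = (\<lambda>x\<in>carrier (M i). \<lambda>j\<in>I. if j = i then x else \<zero>\<^bsub>M j\<^esub>)"

lemma coprojection_apply:
  "x \<in> carrier (M i) \<Longrightarrow> i \<in> I \<Longrightarrow> coprojection I M i x i = x"
  "x \<in> carrier (M i) \<Longrightarrow> j \<in> I \<Longrightarrow> j \<noteq> i \<Longrightarrow> coprojection I M i x j = \<zero>\<^bsub>M j\<^esub>"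
  by (simp_all add: coprojection_def)

lemma coprojection_lin_map:
  assumes R: "cring R" and M: "\<And>i. i \<in> I \<Longrightarrow> module R (M i)" and i: "i \<in> I"
  shows "coprojection I M i \<in> lin_maps R (M i) (direct_sum I M)"
proof -
  interpret cring R by fact
  let ?D = "direct_sum I M"
  interpret D: module R ?D by (rule direct_sum_is_module[OF R M])
  interpret Mi: module R "M i" using M[OF i] .
  let ?f = "\<lambda>x. \<lambda>j\<in>I. if j = i then x else \<zero>\<^bsub>M j\<^esub>"
  have f: "?f x \<in> carrier ?D" if x: "x \<in> carrier (M i)" for x
  proof (rule direct_sum_restrictI[where A = "{i}"])
    fix j assume j: "j \<in> I"
    interpret Mj: module R "M j" using M[OF j] .
    show "(if j = i then x else \<zero>\<^bsub>M j\<^esub>) \<in> carrier (M j)" using x by simp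
  qed auto
  show ?thesis
    unfolding coprojection_def
  proof (rule lin_maps_restrictI[OF M[OF i] f])
    fix x y assume x: "x \<in> carrier (M i)" and y: "y \<in> carrier (M i)"
    show "?f (x \<oplus>\<^bsub>M i\<^esub> y) = ?f x \<oplus>\<^bsub>?D\<^esub> ?f y"
    proof (rule direct_sum_eqI[OF f D.M.a_closed[OF f[OF x] f[OF y]]])
      fix j assume j: "j \<in> I"
      interpret Mj: module R "M j" using M[OF j] .
      show "?f (x \<oplus>\<^bsub>M i\<^esub> y) j = (?f x \<oplus>\<^bsub>?D\<^esub> ?f y) j" using j by simp
    qed (use x y in simp)
  next
    fix a x assume a: "a \<in> carrier R" and x: "x \<in> carrier (M i)"
    show "?f (a \<odot>\<^bsub>M i\<^esub> x) = a \<odot>\<^bsub>?D\<^esub> ?f x"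
    proof (rule direct_sum_eqI[OF f D.smult_closed[OF a f[OF x]]])
      fix j assume j: "j \<in> I"
      interpret Mj: module R "M j" using M[OF j] .
      show "?f (a \<odot>\<^bsub>M i\<^esub> x) j = (a \<odot>\<^bsub>?D\<^esub> ?f x) j" using j a by simp
    qed (use a x in simp)
  qed
qed

lemma projection_lin_map:
  assumes R: "cring R" and M: "\<And>i. i \<in> I \<Longrightarrow> module R (M i)" and i: "i \<in> I"
  shows "(\<lambda>x\<in>carrier (direct_sum I M). x i) \<in> lin_maps R (direct_sum I M) (M i)"
  by (rule lin_maps_restrictI[OF direct_sum_is_module[OF R M]])
    (use i in \<open>auto simp: direct_sum_carrier_iff\<close>)

text \<open>Even over a local ring the cogenerator is a direct sum, with a one-element index set,
  and its elements are functions rather than elements of \<open>M i\<close>. Projection and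
  coprojection are mutually inverse here and carry injectivity over.\<close>

lemma injective_direct_sum_singleton:
  assumes inj: "injective_module TYPE('a) R (M i)" and R: "cring (R :: ('a, 'r) ring_scheme)"
  shows "injective_module TYPE('a) R (direct_sum {i} M)"
proof -
  let ?D = "direct_sum {i} M"
  have M: "module R (M j)" if "j \<in> {i}" for j using inj that by (simp add: injective_module_def)
  have D: "module R ?D" by (rule direct_sum_is_module[OF R M])
  show ?thesis
    unfolding injective_module_def
  proof (intro conjI D allI impI ballI; elim conjE)
    fix A B :: "('a, 'a) module" and k g
    assume A: "module R A" and B: "module R B" and k: "k \<in> lin_maps R A B" "inj_on k (carrier A)"
      and g: "g \<in> lin_maps R A ?D"
    have g': "(\<lambda>x\<in>carrier A. (\<lambda>x\<in>carrier ?D. x i) (g x)) \<in> lin_maps R A (M i)"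
      by (rule lin_maps_comp[OF A g projection_lin_map[OF R M]]) auto
    have "\<exists>h\<in>lin_maps R B (M i). \<forall>x\<in>carrier A. h (k x) = (\<lambda>x\<in>carrier A. (\<lambda>x\<in>carrier ?D. x i) (g x)) x"
      using inj A B k g' unfolding injective_module_def by blast
    then obtain h where h: "h \<in> lin_maps R B (M i)"
      "\<And>x. x \<in> carrier A \<Longrightarrow> h (k x) = (\<lambda>x\<in>carrier A. (\<lambda>x\<in>carrier ?D. x i) (g x)) x" by blast
    have c: "coprojection {i} M i \<in> lin_maps R (M i) ?D" by (rule coprojection_lin_map[OF R M]) auto
    have "(\<lambda>b\<in>carrier B. coprojection {i} M i (h b)) \<in> lin_maps R B ?D"
      by (rule lin_maps_comp[OF B h(1) c])
    moreover have "(\<lambda>b\<in>carrier B. coprojection {i} M i (h b)) (k x) = g x" if x: "x \<in> carrier A" for x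
    proof -
      have kx: "k x \<in> carrier B" and gx: "g x \<in> carrier ?D" using lin_mapsD(1)[OF k(1) x] lin_mapsD(1)[OF g x] .
      have hk: "h (k x) \<in> carrier (M i)" "h (k x) = g x i" using lin_mapsD(1)[OF h(1) kx] h(2)[OF x] gx x by auto
      have "coprojection {i} M i (h (k x)) = g x"
        by (rule direct_sum_eqI[OF lin_mapsD(1)[OF c hk(1)] gx]) (use hk coprojection_apply(1)[of _ M i "{i}"] in auto)
      then show ?thesis using kx by simp
    qed
    ultimately show "\<exists>h\<in>lin_maps R B ?D. \<forall>x\<in>carrier A. h (k x) = g x" by blast
  qed
qed

text \<open>This turns an essential embedding into the data of \<open>residue_hull\<close>. For
  nonzero \<open>x\<close>, the submodule \<open>R x\<close> meets the embedded residue field in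
  some \<open>c e\<close> with \<open>c \<notin> m\<close>, and \<open>c\<close> can be inverted
  modulo \<open>m\<close> because \<open>m\<close> kills \<open>e\<close>.\<close>

lemma (in cring) injective_hull_socle:
  assumes m: "maximalideal m R" and hull: "injective_hull R (quotient_module R m) E"
  shows "\<exists>e\<in>carrier E. (\<forall>r\<in>carrier R. r \<odot>\<^bsub>E\<^esub> e = \<zero>\<^bsub>E\<^esub> \<longleftrightarrow> r \<in> m) \<and>
    (\<forall>x\<in>carrier E. x \<noteq> \<zero>\<^bsub>E\<^esub> \<longrightarrow> (\<exists>r\<in>carrier R. r \<odot>\<^bsub>E\<^esub> x = e))"
proof -
  interpret m: ideal m R using m by (simp add: maximalideal_def)
  interpret E: module R E using hull by (simp add: injective_hull_def injective_module_def)
  let ?k = "quotient_module R m"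
  have k: "carrier ?k = (+>) m ` carrier R"
    by (auto simp: quotient_module_def restrict_scalars_def FactRing_def A_RCOSETS_def')
  have smult: "a \<odot>\<^bsub>?k\<^esub> (m +> b) = m +> a \<otimes> b" if "a \<in> carrier R" "b \<in> carrier R" for a b
    using m.rcoset_mult_add[OF that] by (simp add: quotient_module_def restrict_scalars_def FactRing_def)
  obtain i where i: "i \<in> lin_maps R ?k E" "inj_on i (carrier ?k)"
    "\<And>N. submodule N R E \<Longrightarrow> N \<noteq> {\<zero>\<^bsub>E\<^esub>} \<Longrightarrow> N \<inter> i ` carrier ?k \<noteq> {\<zero>\<^bsub>E\<^esub>}"
    using hull unfolding injective_hull_def essential_embedding_def by blast
  define e where "e = i (m +> \<one>)"
  have e: "e \<in> carrier E" unfolding e_def by (rule lin_mapsD(1)[OF i(1)]) (simp add: k)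
  have ie: "i (m +> r) = r \<odot>\<^bsub>E\<^esub> e" if r: "r \<in> carrier R" for r
  proof -
    have "i (r \<odot>\<^bsub>?k\<^esub> (m +> \<one>)) = r \<odot>\<^bsub>E\<^esub> e"
      unfolding e_def by (rule lin_mapsD(3)[OF i(1) r]) (simp add: k)
    then show ?thesis using smult[OF r one_closed] r by simp
  qed
  have ann: "r \<odot>\<^bsub>E\<^esub> e = \<zero>\<^bsub>E\<^esub> \<longleftrightarrow> r \<in> m" if r: "r \<in> carrier R" for r
  proof -
    have "r \<odot>\<^bsub>E\<^esub> e = \<zero>\<^bsub>E\<^esub> \<longleftrightarrow> i (m +> r) = i (m +> \<zero>)" using ie[OF r] ie[OF zero_closed] e by simp
    also have "\<dots> \<longleftrightarrow> m +> r = m +> \<zero>" by (rule inj_on_eq_iff[OF i(2)]) (use r in \<open>auto simp: k\<close>)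
    also have "\<dots> \<longleftrightarrow> r \<ominus> \<zero> \<in> m" using quotient_eq_iff_same_a_r_cos[OF m.ideal_axioms r zero_closed] by simp
    finally show ?thesis using r by (simp add: minus_eq)
  qed
  have "\<exists>r\<in>carrier R. r \<odot>\<^bsub>E\<^esub> x = e" if x: "x \<in> carrier E" "x \<noteq> \<zero>\<^bsub>E\<^esub>" for x
  proof -
    let ?N = "(\<lambda>r. r \<odot>\<^bsub>E\<^esub> x) ` carrier R"
    have N: "submodule ?N R E"
    proof (rule E.submoduleI')
      show "\<zero>\<^bsub>E\<^esub> \<in> ?N" by (rule image_eqI[of _ _ \<zero>]) (use x in auto)
    next
      fix y z assume "y \<in> ?N" "z \<in> ?N"
      then obtain a b where "a \<in> carrier R" "b \<in> carrier R" "y = a \<odot>\<^bsub>E\<^esub> x" "z = b \<odot>\<^bsub>E\<^esub> x" by blast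
      then show "y \<oplus>\<^bsub>E\<^esub> z \<in> ?N" using x by (intro image_eqI[of _ _ "a \<oplus> b"]) (auto simp: E.smult_l_distr)
    next
      fix c y assume "c \<in> carrier R" "y \<in> ?N"
      then obtain a where "c \<in> carrier R" "a \<in> carrier R" "y = a \<odot>\<^bsub>E\<^esub> x" by blast
      then show "c \<odot>\<^bsub>E\<^esub> y \<in> ?N" using x by (intro image_eqI[of _ _ "c \<otimes> a"]) (auto simp: E.smult_assoc1)
    qed (use x in auto)
    have "x \<in> ?N" by (rule image_eqI[of _ _ \<one>]) (use x in auto)
    then have "?N \<noteq> {\<zero>\<^bsub>E\<^esub>}" using x(2) by blast
    \<comment> \<open>Essentiality only says that the intersection differs from \<open>{0}\<close>.
      Both sets contain zero, so it must have a nonzero element.\<close>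
    then have "?N \<inter> i ` carrier ?k \<noteq> {\<zero>\<^bsub>E\<^esub>}" by (rule i(3)[OF N])
    moreover have "\<zero>\<^bsub>E\<^esub> \<in> ?N" by (rule image_eqI[of _ _ \<zero>]) (use x in auto)
    moreover have "\<zero>\<^bsub>E\<^esub> \<in> i ` carrier ?k"
    proof (rule image_eqI)
      show "\<zero>\<^bsub>E\<^esub> = i (m +> \<zero>)" using ie[OF zero_closed] e by simp
    qed (simp add: k)
    ultimately obtain y where y: "y \<in> ?N" "y \<in> i ` carrier ?k" "y \<noteq> \<zero>\<^bsub>E\<^esub>" by blast
    then obtain r c where rc: "r \<in> carrier R" "c \<in> carrier R" "y = r \<odot>\<^bsub>E\<^esub> x" "y = c \<odot>\<^bsub>E\<^esub> e"
      using ie by (auto simp: k)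
    have "c \<notin> m" using ann[OF rc(2)] rc(4) y(3) by simp
    then obtain u where u: "u \<in> carrier R" "u \<otimes> c \<ominus> \<one> \<in> m" using unit_mod_maximal[OF m rc(2)] by blast
    then have "(u \<otimes> c \<ominus> \<one>) \<odot>\<^bsub>E\<^esub> e = \<zero>\<^bsub>E\<^esub>" using ann rc(2) by simp
    then have "(u \<otimes> c) \<odot>\<^bsub>E\<^esub> e = e" using E.smult_diff_zero_iff[of "u \<otimes> c" \<one> e] u rc(2) e by simp
    then have "(u \<otimes> r) \<odot>\<^bsub>E\<^esub> x = e" using u rc x e by (simp add: E.smult_assoc1)
    then show ?thesis using u(1) rc(1) by blast
  qed
  then show ?thesis using e ann by blast
qed

lemma (in noetherian_domain) residue_hull_singleton:
  fixes E :: "'a set \<Rightarrow> ('a, 'e, 'k) module_scheme"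
  assumes m: "maximalideal m R" and hull: "injective_hull R (quotient_module R m) (E m)"
  obtains e where "residue_hull R (direct_sum {m} E) m e"
proof -
  let ?D = "direct_sum {m} E"
  from injective_hull_socle[OF m hull]
  obtain e where e: "e \<in> carrier (E m)" "\<And>r. r \<in> carrier R \<Longrightarrow> r \<odot>\<^bsub>E m\<^esub> e = \<zero>\<^bsub>E m\<^esub> \<longleftrightarrow> r \<in> m"
    "\<And>x. x \<in> carrier (E m) \<Longrightarrow> x \<noteq> \<zero>\<^bsub>E m\<^esub> \<Longrightarrow> \<exists>r\<in>carrier R. r \<odot>\<^bsub>E m\<^esub> x = e"
    by blast
  have inj: "injective_module TYPE('a) R (E m)" using hull by (simp add: injective_hull_def)
  have mod: "module R (E i)" if "i \<in> {m}" for i using inj that by (simp add: injective_module_def)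
  interpret D: module R ?D by (rule direct_sum_is_module[OF is_cring mod])
  interpret Em: module R "E m" using mod by simp
  let ?c = "coprojection {m} E m"
  have c: "?c \<in> lin_maps R (E m) ?D" by (rule coprojection_lin_map[OF is_cring mod]) auto
  have cx: "?c (x m) = x" if x: "x \<in> carrier ?D" for x
  proof (rule direct_sum_eqI[OF lin_mapsD(1)[OF c] x])
    show "x m \<in> carrier (E m)" using x by (simp add: direct_sum_carrier_iff)
    then show "?c (x m) i = x i" if "i \<in> {m}" for i using coprojection_apply(1)[of "x m" E m "{m}"] that by simp
  qed
  have cm: "?c x m = x" if "x \<in> carrier (E m)" for x
    using coprojection_apply(1)[of x E m "{m}"] that by simp
  have cinj: "?c x = ?c y \<longleftrightarrow> x = y" if "x \<in> carrier (E m)" "y \<in> carrier (E m)" for x y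
    using cm[OF that(1)] cm[OF that(2)] by metis
  have c0: "?c \<zero>\<^bsub>E m\<^esub> = \<zero>\<^bsub>?D\<^esub>" by (rule lin_maps_zero[OF Em.module_axioms D.module_axioms c])
  have "residue_hull R ?D m (?c e)"
  proof (intro residue_hull.intro residue_hull_axioms.intro)
    show "noetherian_domain R" by (rule noetherian_domain_axioms)
    show "module R ?D" by (rule D.module_axioms)
    show "injective_module TYPE('a) R ?D" by (rule injective_direct_sum_singleton[where M = E, OF inj is_cring])
    show "?c e \<in> carrier ?D" by (rule lin_mapsD(1)[OF c e(1)])
    fix r assume r: "r \<in> carrier R"
    have "r \<odot>\<^bsub>?D\<^esub> ?c e = \<zero>\<^bsub>?D\<^esub> \<longleftrightarrow> ?c (r \<odot>\<^bsub>E m\<^esub> e) = ?c \<zero>\<^bsub>E m\<^esub>"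
      using lin_mapsD(3)[OF c r e(1)] c0 by simp
    also have "\<dots> \<longleftrightarrow> r \<in> m" using cinj[of "r \<odot>\<^bsub>E m\<^esub> e" "\<zero>\<^bsub>E m\<^esub>"] r e by simp
    finally show "r \<odot>\<^bsub>?D\<^esub> ?c e = \<zero>\<^bsub>?D\<^esub> \<longleftrightarrow> r \<in> m" .
  next
    fix x assume x: "x \<in> carrier ?D" "x \<noteq> \<zero>\<^bsub>?D\<^esub>"
    have xm: "x m \<in> carrier (E m)" using x by (simp add: direct_sum_carrier_iff)
    have "x m \<noteq> \<zero>\<^bsub>E m\<^esub>" using cx[OF x(1)] c0 x(2) by metis
    then obtain r where r: "r \<in> carrier R" "r \<odot>\<^bsub>E m\<^esub> x m = e" using e(3) xm by blast
    have "r \<odot>\<^bsub>?D\<^esub> ?c (x m) = ?c e" using lin_mapsD(3)[OF c r(1) xm] r(2) by simp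
    then show "\<exists>r\<in>carrier R. r \<odot>\<^bsub>?D\<^esub> x = ?c e" using cx[OF x(1)] r(1) by metis
  qed (rule m)
  then show thesis by (rule that)
qed

section \<open>Reflexivity with respect to the sum over all maximal ideals\<close>

context fraction_domain
begin

text \<open>The conclusion speaks of the values \<open>f 1\<close>: that they exhaust
  \<open>D\<close> rests on the injectivity of \<open>D\<close>, which is shown only for a single
  summand.\<close>

lemma reflexive_imp_multiplication:
  fixes E :: "'a set \<Rightarrow> ('a, 'e, 'k) module_scheme"
  defines "D \<equiv> direct_sum {m. maximalideal m R} E"
  assumes hull: "\<And>m. maximalideal m R \<Longrightarrow> injective_hull R (quotient_module R m) (E m)"
    and refl: "reflexive_wrt R D QM" and g: "g \<in> lin_maps R D D"
  shows "\<exists>r\<in>carrier R. \<forall>f\<in>lin_maps R QM D. g (f \<one>\<^bsub>Q\<^esub>) = r \<odot>\<^bsub>D\<^esub> f \<one>\<^bsub>Q\<^esub>"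
proof -
  have mod: "module R (E m)" if "m \<in> {m. maximalideal m R}" for m
    using hull[of m] that by (simp add: injective_hull_def injective_module_def)
  have D: "module R D" unfolding D_def by (rule direct_sum_is_module[OF is_cring mod])
  interpret D: module R D by (rule D)
  let ?G = "\<lambda>f\<in>carrier (Hom_module R QM D). g ((\<lambda>f\<in>lin_maps R QM D. f \<one>\<^bsub>Q\<^esub>) f)"
  have "?G \<in> lin_maps R (Hom_module R QM D) D"
    by (rule lin_maps_comp[OF Hom_module_is_module[OF QM_module D] evaluation_lin_map[OF QM_module D] g]) simp
  from reflexive_wrtD[OF refl this] obtain q where q: "q \<in> carrier Q"
    "\<And>f. f \<in> lin_maps R QM D \<Longrightarrow> g (f \<one>\<^bsub>Q\<^esub>) = f q" by auto
  have "q \<in> \<phi> ` carrier R"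
  proof (rule ccontr)
    assume nq: "q \<notin> \<phi> ` carrier R"
    let ?C = "{a \<in> carrier R. a \<odot>\<^bsub>QM\<^esub> q \<in> \<phi> ` carrier R}"
    have "ideal ?C R" by (rule QM.colon_ideal[OF image_submodule_QM]) (use q in simp)
    moreover have "\<one> \<notin> ?C" using nq q by simp
    then have "?C \<noteq> carrier R" by blast
    ultimately obtain m where m: "maximalideal m R" "?C \<subseteq> m" by (rule ideal_le_maximal)
    from injective_hull_socle[OF m(1) hull[OF m(1)]]
    obtain e where e: "e \<in> carrier (E m)" "\<And>r. r \<in> carrier R \<Longrightarrow> r \<odot>\<^bsub>E m\<^esub> e = \<zero>\<^bsub>E m\<^esub> \<longleftrightarrow> r \<in> m"
      by blast
    interpret Em: module R "E m" using mod m(1) by simp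
    have "e \<noteq> \<zero>\<^bsub>E m\<^esub>"
    proof
      assume "e = \<zero>\<^bsub>E m\<^esub>"
      then have "\<one> \<in> m" using e(2)[of \<one>] by simp
      then show False using m(1) ideal.one_imp_carrier[of m R]
        by (auto simp: maximalideal_def maximalideal_axioms_def)
    qed
    have inj: "injective_module TYPE('a) R (E m)" using hull[OF m(1)] by (simp add: injective_hull_def)
    have qQ: "q \<in> carrier QM" using q by simp
    have ann: "r \<odot>\<^bsub>E m\<^esub> e = \<zero>\<^bsub>E m\<^esub>" if "r \<in> carrier R" "r \<odot>\<^bsub>QM\<^esub> q \<in> \<phi> ` carrier R" for r
      using e(2) m(2) that by blast
    obtain f where f: "f \<in> lin_maps R QM (E m)" "\<And>y. y \<in> \<phi> ` carrier R \<Longrightarrow> f y = \<zero>\<^bsub>E m\<^esub>" "f q = e"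
    proof (rule injective_extend_cyclic[OF inj QM_module image_submodule_QM qQ e(1)])
      fix r assume "r \<in> carrier R" "r \<odot>\<^bsub>QM\<^esub> q \<in> \<phi> ` carrier R"
      then show "r \<odot>\<^bsub>E m\<^esub> e = \<zero>\<^bsub>E m\<^esub>" by (rule ann)
    qed (rule that)
    let ?c = "coprojection {m. maximalideal m R} E m"
    have c: "?c \<in> lin_maps R (E m) D"
      unfolding D_def by (rule coprojection_lin_map[OF is_cring mod]) (use m(1) in auto)
    have F: "(\<lambda>x\<in>carrier QM. ?c (f x)) \<in> lin_maps R QM D" by (rule lin_maps_comp[OF QM_module f(1) c])
    have "f \<one>\<^bsub>Q\<^esub> = \<zero>\<^bsub>E m\<^esub>" using f(2)[of "\<phi> \<one>"] by (metis \<phi>.hom_one image_eqI one_closed)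
    then have "g (?c \<zero>\<^bsub>E m\<^esub>) = ?c e" using q(2)[OF F] q(1) f(3) by simp
    then have "?c e = \<zero>\<^bsub>D\<^esub>"
      using lin_maps_zero[OF Em.module_axioms D c] lin_maps_zero[OF D D g] by simp
    then have "?c e m = \<zero>\<^bsub>E m\<^esub>" using m(1) by (simp add: D_def)
    then show False
      using coprojection_apply(1)[of e E m "{m. maximalideal m R}"] e(1) m(1) \<open>e \<noteq> \<zero>\<^bsub>E m\<^esub>\<close> by simp
  qed
  then obtain r where r: "r \<in> carrier R" "q = \<phi> r" by blast
  show ?thesis
  proof (intro bexI[OF _ r(1)] ballI)
    fix f assume f: "f \<in> lin_maps R QM D"
    show "g (f \<one>\<^bsub>Q\<^esub>) = r \<odot>\<^bsub>D\<^esub> f \<one>\<^bsub>Q\<^esub>" using q(2)[OF f] lin_map_phi[OF f r(1)] r(2) by simp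
  qed
qed

text \<open>
  The projection of the direct sum onto one summand is multiplication by some \<open>r \<in> R\<close>, which
  then annihilates every other summand; but injective modules over a domain are divisible.
\<close>

lemma reflexive_imp_unique_maximal:
  fixes E :: "'a set \<Rightarrow> ('a, 'e, 'k) module_scheme"
  assumes hull: "\<And>m. maximalideal m R \<Longrightarrow> injective_hull R (quotient_module R m) (E m)"
    and refl: "reflexive_wrt R (direct_sum {m. maximalideal m R} E) QM"
    and m: "maximalideal m\<^sub>1 R" "maximalideal m\<^sub>2 R"
  shows "m\<^sub>1 = m\<^sub>2"
proof (rule ccontr)
  assume ne: "m\<^sub>1 \<noteq> m\<^sub>2"
  let ?M = "{m. maximalideal m R}"
  let ?D = "direct_sum ?M E"
  have mod: "module R (E m)" if "m \<in> ?M" for m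
    using hull[of m] that by (simp add: injective_hull_def injective_module_def)
  have D: "module R ?D" by (rule direct_sum_is_module[OF is_cring mod])
  have inj: "injective_module TYPE('a) R (E m)" if "maximalideal m R" for m
    using hull[OF that] by (simp add: injective_hull_def)
  have c: "coprojection ?M E m \<in> lin_maps R (E m) ?D" if "maximalideal m R" for m
    by (rule coprojection_lin_map[OF is_cring mod]) (use that in auto)
  have nz: "\<exists>e\<in>carrier (E m). e \<noteq> \<zero>\<^bsub>E m\<^esub>" if m: "maximalideal m R" for m
  proof -
    from injective_hull_socle[OF m hull[OF m]]
    obtain e where e: "e \<in> carrier (E m)" "\<And>r. r \<in> carrier R \<Longrightarrow> r \<odot>\<^bsub>E m\<^esub> e = \<zero>\<^bsub>E m\<^esub> \<longleftrightarrow> r \<in> m"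
      by blast
    interpret Em: module R "E m" using mod m by simp
    have "e \<noteq> \<zero>\<^bsub>E m\<^esub>"
    proof
      assume "e = \<zero>\<^bsub>E m\<^esub>"
      then have "\<one> \<in> m" using e(2)[of \<one>] by simp
      then show False using m ideal.one_imp_carrier[of m R]
        by (auto simp: maximalideal_def maximalideal_axioms_def)
    qed
    then show ?thesis using e(1) by blast
  qed
  let ?p = "\<lambda>x\<in>carrier ?D. x m\<^sub>1"
  have p: "?p \<in> lin_maps R ?D (E m\<^sub>1)"
    by (rule projection_lin_map[OF is_cring mod]) (use m in auto)
  have g: "(\<lambda>x\<in>carrier ?D. coprojection ?M E m\<^sub>1 (?p x)) \<in> lin_maps R ?D ?D"
    by (rule lin_maps_comp[OF D p c[OF m(1)]])
  from reflexive_imp_multiplication[OF hull refl g]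
  obtain r where r: "r \<in> carrier R" "\<And>f. f \<in> lin_maps R QM ?D \<Longrightarrow>
    (\<lambda>x\<in>carrier ?D. coprojection ?M E m\<^sub>1 (?p x)) (f \<one>\<^bsub>Q\<^esub>) = r \<odot>\<^bsub>?D\<^esub> f \<one>\<^bsub>Q\<^esub>"
    by blast
  \<comment> \<open>The multiplier \<open>r\<close> is known to work on values at \<open>1\<close>.
    Elements of a single summand are such values, because that summand is injective.\<close>
  have rc: "coprojection ?M E m\<^sub>1 (coprojection ?M E m e m\<^sub>1) = r \<odot>\<^bsub>?D\<^esub> coprojection ?M E m e"
    if me: "maximalideal m R" "e \<in> carrier (E m)" for m e
  proof -
    obtain f where f: "f \<in> lin_maps R QM (E m)" "f \<one>\<^bsub>Q\<^esub> = e"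
      by (rule injective_value_at_one[OF inj[OF me(1)] me(2)])
    have "(\<lambda>x\<in>carrier QM. coprojection ?M E m (f x)) \<in> lin_maps R QM ?D"
      by (rule lin_maps_comp[OF QM_module f(1) c[OF me(1)]])
    from r(2)[OF this] show ?thesis using f(2) lin_mapsD(1)[OF c[OF me(1)] me(2)] by simp
  qed
  interpret E1: module R "E m\<^sub>1" using mod m by simp
  interpret E2: module R "E m\<^sub>2" using mod m by simp
  obtain e1 where e1: "e1 \<in> carrier (E m\<^sub>1)" "e1 \<noteq> \<zero>\<^bsub>E m\<^sub>1\<^esub>" using nz[OF m(1)] by blast
  have "r \<odot>\<^bsub>E m\<^sub>1\<^esub> e1 = e1"
    using fun_cong[OF rc[OF m(1) e1(1)], of m\<^sub>1] m(1) e1(1) coprojection_apply(1)[of _ E m\<^sub>1 ?M] by simp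
  then have rnz: "r \<noteq> \<zero>" using e1 by auto
  have r2: "r \<odot>\<^bsub>E m\<^sub>2\<^esub> e = \<zero>\<^bsub>E m\<^sub>2\<^esub>" if e: "e \<in> carrier (E m\<^sub>2)" for e
    using fun_cong[OF rc[OF m(2) e], of m\<^sub>2] m ne e coprojection_apply(1)[of e E m\<^sub>2 ?M]
      coprojection_apply(2)[of e E m\<^sub>2 m\<^sub>1 ?M] coprojection_apply(2)[of "\<zero>\<^bsub>E m\<^sub>1\<^esub>" E m\<^sub>1 m\<^sub>2 ?M] by simp
  obtain e2 where e2: "e2 \<in> carrier (E m\<^sub>2)" "e2 \<noteq> \<zero>\<^bsub>E m\<^sub>2\<^esub>" using nz[OF m(2)] by blast
  obtain f where f: "f \<in> lin_maps R QM (E m\<^sub>2)" "f \<one>\<^bsub>Q\<^esub> = e2"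
    by (rule injective_value_at_one[OF inj[OF m(2)] e2(1)])
  have rU: "\<phi> r \<in> Units Q" using r(1) rnz phi_zero_iff by (simp add: Q.field_Units)
  have "e2 = r \<odot>\<^bsub>E m\<^sub>2\<^esub> f (inv\<^bsub>Q\<^esub> (\<phi> r))"
    using lin_mapsD(3)[OF f(1) r(1), of "inv\<^bsub>Q\<^esub> (\<phi> r)"] rU f(2) by simp
  also have "\<dots> = \<zero>\<^bsub>E m\<^sub>2\<^esub>" by (rule r2) (use lin_mapsD(1)[OF f(1)] rU in simp)
  finally show False using e2(2) by simp
qed

end

section \<open>Chains of prime ideals\<close>

lemma (in noetherian_domain) prime_eq_maximal_if_krull_dim_le_one:
  assumes dim: "krull_dim R \<le> 1" and P: "primeideal P R" "P \<noteq> {\<zero>}" and m: "maximalideal m R" "P \<subseteq> m"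
  shows "P = m"
proof (rule ccontr)
  assume "P \<noteq> m"
  define C where "C i = (if i = 0 then {\<zero>} else if i = 1 then P else m)" for i :: nat
  have "{\<zero>} \<subset> P" using P by (auto simp: primeideal_def dest: additive_subgroup.zero_closed ideal.axioms(1))
  then have "\<forall>i<2. C i \<subset> C (Suc i)" using m(2) \<open>P \<noteq> m\<close> by (auto simp: C_def less_2_cases_iff)
  moreover have "\<forall>i\<le>2. primeideal (C i) R"
    using zeroprimeideal P(1) maximalideal_prime[OF m(1)] by (simp add: C_def)
  ultimately have "enat 2 \<le> krull_dim R" unfolding krull_dim_def by (intro Sup_upper) blast
  then show False using dim by (auto simp: one_enat_def dest: order_trans)
qed

text \<open>Given primes \<open>P 0 \<subset> P 1 \<subset> P 2\<close>, an \<open>a\<close> in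
  \<open>P 1\<close> outside \<open>P 0\<close> is nonzero, so every \<open>b\<close> in
  \<open>P 2\<close> has a power in \<open>a R\<close>, inside \<open>P 1\<close>. As
  \<open>P 1\<close> is prime, it would contain \<open>P 2\<close>.\<close>

lemma (in noetherian_domain) krull_dim_le_one_if_power_mem:
  assumes local: "\<And>I. ideal I R \<Longrightarrow> I \<noteq> carrier R \<Longrightarrow> I \<subseteq> m"
    and pow: "\<And>a b. a \<in> carrier R \<Longrightarrow> a \<noteq> \<zero> \<Longrightarrow> b \<in> m \<Longrightarrow> \<exists>n::nat. b [^] n \<in> PIdl a"
  shows "krull_dim R \<le> 1"
  unfolding krull_dim_def
proof (rule Sup_least)
  fix d assume "d \<in> {enat n | n. \<exists>P. (\<forall>i\<le>n. primeideal (P i) R) \<and> (\<forall>i<n. P i \<subset> P (Suc i))}"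
  then obtain n P where d: "d = enat n" and P: "\<And>i. i \<le> n \<Longrightarrow> primeideal (P i) R" "\<And>i. i < n \<Longrightarrow> P i \<subset> P (Suc i)"
    by blast
  have "n \<le> 1"
  proof (rule ccontr)
    assume "\<not> n \<le> 1"
    then have n: "0 \<le> n" "1 \<le> n" "2 \<le> n" "0 < n" "1 < n" by auto
    interpret P0: primeideal "P 0" R using P(1) n by blast
    interpret P1: primeideal "P 1" R using P(1) n by blast
    interpret P2: primeideal "P 2" R using P(1) n by blast
    obtain a where a: "a \<in> P 1" "a \<notin> P 0" using P(2)[OF n(4)] by auto
    obtain b where b: "b \<in> P 2" "b \<notin> P 1" using P(2)[OF n(5)] by (auto simp: numeral_2_eq_2)
    have "a \<noteq> \<zero>" using a P0.zero_closed by blast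
    moreover have "b \<in> m" using local[OF P2.ideal_axioms] P2.I_notcarr b by blast
    ultimately obtain k :: nat where "b [^] k \<in> PIdl a" using pow P1.Icarr[OF a(1)] by blast
    then have "b [^] k \<in> P 1" using cgenideal_minimal[OF P1.ideal_axioms a(1)] by blast
    moreover have "b [^] k \<notin> P 1" for k :: nat
    proof (induction k)
      case 0
      then show ?case using P1.one_imp_carrier P1.I_notcarr by auto
    next
      case (Suc k)
      then show ?case using P1.I_prime[of "b [^] k" b] b P2.Icarr[OF b(1)] by auto
    qed
    ultimately show False by blast
  qed
  then show "d \<le> 1" by (simp add: d one_enat_def)
qed

theorem proposition3p4:
  fixes R :: "('a, 'r) ring_scheme"
    and Q :: "('q, 's) ring_scheme" and \<phi> :: "'a \<Rightarrow> 'q"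
    and E :: "'a set \<Rightarrow> ('a, 'e, 'k) module_scheme"
  assumes "noetherian_domain R"
    and "fraction_field R Q \<phi>"
    and "\<And>m. maximalideal m R \<Longrightarrow> injective_hull R (quotient_module R m) (E m)"
  shows "reflexive_wrt R (direct_sum {m. maximalideal m R} E) (restrict_scalars \<phi> Q) \<longleftrightarrow>
    complete_local_ring R \<and> domain R \<and> krull_dim R \<le> 1"
proof -
  interpret R: noetherian_domain R by fact
  interpret fraction_domain R Q \<phi>
    using assms(1,2) by (simp add: fraction_domain_def fraction_domain_axioms_def)
  let ?D = "direct_sum {m. maximalideal m R} E"
  note hull = assms(3)
  show ?thesis
  proof
    assume refl: "reflexive_wrt R ?D QM"
    obtain m where m: "maximalideal m R"
      using R.ideal_le_maximal[OF R.zeroideal] R.one_not_zero R.one_closed by blast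
    have uniq: "m' = m" if "maximalideal m' R" for m'
      by (rule reflexive_imp_unique_maximal[OF hull refl that m])
    \<comment> \<open>With one maximal ideal the full direct sum is literally
      \<open>direct_sum {m} E\<close>, so the results on \<open>residue_hull\<close> apply to
      \<open>?D\<close> itself.\<close>
    then have Max: "{m. maximalideal m R} = {m}" using m by blast
    obtain e where "residue_hull R (direct_sum {m} E) m e"
      by (rule R.residue_hull_singleton[where E = E, OF m hull[OF m]])
    then have "residue_hull R ?D m e" by (simp only: Max)
    moreover have "I \<subseteq> m" if "ideal I R" "I \<noteq> carrier R" for I
      using R.ideal_le_maximal[OF that] uniq by metis
    ultimately interpret fraction_residue_hull R ?D m e Q \<phi>
      by (intro fraction_residue_hull.intro local_residue_hull.intro local_residue_hull_axioms.intro)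
        (auto intro: fraction_domain_axioms)
    have mult: "\<exists>r\<in>carrier R. \<forall>x\<in>carrier ?D. h x = r \<odot>\<^bsub>?D\<^esub> x" if h: "h \<in> lin_maps R ?D ?D" for h
    proof -
      from reflexive_imp_multiplication[OF hull refl h]
      obtain r where r: "r \<in> carrier R" "\<And>f. f \<in> lin_maps R QM ?D \<Longrightarrow> h (f \<one>\<^bsub>Q\<^esub>) = r \<odot>\<^bsub>?D\<^esub> f \<one>\<^bsub>Q\<^esub>"
        by blast
      \<comment> \<open>By now \<open>?D\<close> is known to be injective, so each of its elements
        is the value at \<open>1\<close> of a map from \<open>Q\<close>.\<close>
      have "h x = r \<odot>\<^bsub>?D\<^esub> x" if x: "x \<in> carrier ?D" for x
        by (rule injective_value_at_one[OF injective x]) (use r(2) in blast)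
      then show ?thesis using r(1) by blast
    qed
    have "adic_complete R m" by (rule multiplication_imp_complete[OF mult])
    then have "complete_local_ring R"
      using m uniq R.is_cring unfolding complete_local_ring_def local_ring_def by blast
    moreover have "krull_dim R \<le> 1"
      by (rule R.krull_dim_le_one_if_power_mem[OF proper_le_m reflexive_imp_power_mem[OF refl]])
    ultimately show "complete_local_ring R \<and> domain R \<and> krull_dim R \<le> 1"
      using R.domain_axioms by blast
  next
    assume R: "complete_local_ring R \<and> domain R \<and> krull_dim R \<le> 1"
    then obtain m where m: "maximalideal m R" and uniq: "\<And>m'. maximalideal m' R \<Longrightarrow> m' = m"
      unfolding complete_local_ring_def local_ring_def by blast
    have complete: "adic_complete R m" using R m unfolding complete_local_ring_def by blast
    have Max: "{m. maximalideal m R} = {m}" using m uniq by blast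
    obtain e where "residue_hull R (direct_sum {m} E) m e"
      by (rule R.residue_hull_singleton[where E = E, OF m hull[OF m]])
    then have "residue_hull R ?D m e" by (simp only: Max)
    moreover have "I \<subseteq> m" if "ideal I R" "I \<noteq> carrier R" for I
      using R.ideal_le_maximal[OF that] uniq by metis
    ultimately interpret fraction_residue_hull R ?D m e Q \<phi>
      by (intro fraction_residue_hull.intro local_residue_hull.intro local_residue_hull_axioms.intro)
        (auto intro: fraction_domain_axioms)
    show "reflexive_wrt R ?D QM"
    proof (rule reflexive_if_dim_le_one)
      show "\<exists>r\<in>carrier R. \<forall>x\<in>carrier ?D. h x = r \<odot>\<^bsub>?D\<^esub> x" if "h \<in> lin_maps R ?D ?D" for h
        by (rule complete_imp_multiplication[OF complete that])
      fix P assume P: "primeideal P R" "P \<noteq> {\<zero>\<^bsub>R\<^esub>}"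
      have "P \<subseteq> m" using proper_le_m[of P] P(1) unfolding primeideal_def primeideal_axioms_def by blast
      then show "P = m" using R.prime_eq_maximal_if_krull_dim_le_one R P m by blast
    qed
  qed
qed

end
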